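(* Let $z\in\mathbb{C}^*$ and $\ell_\pm=\pm\mathbb{R}_{>0}\cdot z$. For $t\in\mathbb{C}^*\setminus i\ell_\pm$ let $\Psi_\pm(t)\in\operatorname{Aut}\widehat{\mathbb{C}_q[\mathbb{T}]}$ be the automorphism which acts trivially on $\widehat{\mathbb{C}_q[\mathbb{T}]}_0$ and satisfies $$\Psi_\pm(t)(y_{\alpha^\vee})=\Lambda\Big(\pm\frac{z}{2\pi it},\ \tfrac12\mp\big(\theta+\tfrac\tau2\big)\ \Big|\ 1\Big)^{\pm1}\cdot y_{\alpha^\vee}.$$ Then $\Psi_\pm(t)=\operatorname{Ad}_{\psi_\pm(t)}$, where $\psi_\pm\colon\mathbb{C}^*\setminus i\ell_\pm\to\widehat{\mathbb{C}_q[\mathbb{T}]}_0\subset \widehat{\mathbb{C}_q[\mathbb{T}]}$ is defined by $$\psi_\pm(t)=F\Big(\pm\frac{z}{2\pi it},\ \frac{1+\tau}{2}\mp\theta\ \Big|\ 1,\tau\Big)^{-1}\cdot 1 .$$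
   Context: $\mathcal{H}$ is the open upper half-plane and $\mathcal{M}(\mathcal{H}\times\mathbb{C})$ the field of meromorphic functions $f(\tau,\theta)$ on $\mathcal{H}\times\mathbb{C}$. The extended quantum torus algebra is $\widehat{\mathbb{C}_q[\mathbb{T}]}=\bigoplus_{n\in\mathbb{Z}}\mathcal{M}(\mathcal{H}\times\mathbb{C})\cdot y_{n\alpha^\vee}$ with product $(f_1(\tau,\theta)y_{n_1\alpha^\vee})*(f_2(\tau,\theta)y_{n_2\alpha^\vee})=f_1(\tau,\theta)f_2(\tau,\theta+n_1\tau)\,y_{(n_1+n_2)\alpha^\vee}$, and $\widehat{\mathbb{C}_q[\mathbb{T}]}_0=\mathcal{M}(\mathcal{H}\times\mathbb{C})\cdot1$. For invertible $g$, $\operatorname{Ad}_g(a)=g*a*g^{-1}$. For $w\in\mathbb{C}^*\setminus\mathbb{R}_{<0}$, $\eta\in\mathbb{C}$: $\Lambda(w,\eta|1)=\Gamma(w+\eta)e^w(2\pi)^{-1/2}w^{\frac12-\eta-w}$, principal branch of $\log w$. Double gamma function: for $\operatorname{Re}(a_1),\operatorname{Re}(a_2)>0$ and $\operatorname{Re}(x)>0$ let $\zeta_2(s,x|a_1,a_2)=\sum_{n_1,n_2\ge0}(x+n_1a_1+n_2a_2)^{-s}$ for $\operatorname{Re}(s)>2$, continued meromorphically in $s$, and $\Gamma_2(x|a_1,a_2)=\exp\frac{\partial}{\partial s}\zeta_2(s,x|a_1,a_2)|_{s=0}$, continued meromorphically to $x\in\mathbb{C}$. Let $$B_{2,2}(x|a_1,a_2)=\frac{x^2}{a_1a_2}-\Big(\frac1{a_1}+\frac1{a_2}\Big)x+\frac16\Big(\frac{a_2}{a_1}+\frac{a_1}{a_2}\Big)+\frac12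 .$$ The function $\Gamma_2$ is analytically continued in the parameters to $a_1,a_2\in\mathbb{C}^*\setminus\mathbb{R}_{<0}$ lying in a common open half-plane with principal arguments satisfying $|\arg a_1-\arg a_2|<\pi$; explicitly, with $\lambda=e^{-im}$, $m=\frac12(\arg a_1+\arg a_2)$, one has $\Gamma_2(x|a_1,a_2)=\exp\big(-\tfrac{i m}{2}B_{2,2}(x|a_1,a_2)\big)\,\Gamma_2(\lambda x|\lambda a_1,\lambda a_2)$. In particular $\Gamma_2(x|1,\tau)$ is defined for all $\tau\in\mathcal{H}$. For $w\in\mathbb{C}^*\setminus\mathbb{R}_{<0}$, $\eta\in\mathbb{C}$ set $$F(w,\eta|a_1,a_2)=\Gamma_2(w+\eta|a_1,a_2)\,\exp\Big(\tfrac12B_{2,2}(w+\eta|a_1,a_2)\log w\Big)\exp\Big(-\frac{3w^2}{4a_1a_2}-\frac{\eta w}{a_1a_2}+\frac{w(a_1+a_2)}{2a_1a_2}\Big)$$ with the principal branch of $\log w$. *)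

theory Defs
  imports "HOL-Complex_Analysis.Complex_Analysis" "HOL-Library.Poly_Mapping"
begin

section \<open>The field of meromorphic functions on the product of the upper half-plane and the plane\<close>

definition HC :: "(complex \<times> complex) set" where
  "HC = {(\<tau>, \<theta>). Im \<tau> > 0}"

definition holo2_on :: "(complex \<times> complex \<Rightarrow> complex) \<Rightarrow> (complex \<times> complex) set \<Rightarrow> bool" where
  "holo2_on f U \<longleftrightarrow> (\<forall>p\<in>U. \<exists>a b. (f has_derivative (\<lambda>(h, k). a * h + b * k)) (at p))"

text \<open>A meromorphic function is locally a quotient \<open>g / h\<close> of holomorphic functions, where \<open>h\<close>
  vanishes identically on no nonempty open set. It is represented by a total function whose values
  where \<open>h\<close> vanishes are arbitrary; two representatives are identified if they agree on a
  dense open subset.\<close>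

definition mero2 :: "(complex \<times> complex \<Rightarrow> complex) \<Rightarrow> bool" where
  "mero2 f \<longleftrightarrow> (\<forall>p\<in>HC. \<exists>U g h. open U \<and> p \<in> U \<and> U \<subseteq> HC \<and> holo2_on g U \<and> holo2_on h U \<and>
     U \<subseteq> closure {q\<in>U. h q \<noteq> 0} \<and> (\<forall>q\<in>U. h q \<noteq> 0 \<longrightarrow> f q = g q / h q))"

definition mero2_eq :: "(complex \<times> complex \<Rightarrow> complex) \<Rightarrow> (complex \<times> complex \<Rightarrow> complex) \<Rightarrow> bool" where
  "mero2_eq f g \<longleftrightarrow> (\<exists>D. open D \<and> D \<subseteq> HC \<and> HC \<subseteq> closure D \<and> (\<forall>q\<in>D. f q = g q))"

lemma closure_meets_open: "r \<in> closure S \<Longrightarrow> open V \<Longrightarrow> r \<in> V \<Longrightarrow> S \<inter> V \<noteq> {}"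
  by (metis closure_iff_nhds_not_empty subset_refl)

lemma dense_open_Int:
  fixes A B U :: "'a::topological_space set"
  assumes "open U" "open A" "open B" "A \<subseteq> U" "B \<subseteq> U" "U \<subseteq> closure A" "U \<subseteq> closure B"
  shows "U \<subseteq> closure (A \<inter> B)"
proof -
  have "A = A \<inter> closure B" using assms(4,7) by blast
  also have "\<dots> \<subseteq> closure (A \<inter> B)" by (rule open_Int_closure_subset[OF assms(2)])
  finally have "A \<subseteq> closure (A \<inter> B)" .
  hence "closure A \<subseteq> closure (A \<inter> B)" by (simp add: closure_minimal)
  thus ?thesis using assms(6) by simp
qed

lemma dense_restrict:
  fixes W U S :: "'a::topological_space set"
  assumes "open W" "W \<subseteq> U" "U \<subseteq> closure S" shows "W \<subseteq> closure (W \<inter> S)"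
proof -
  have "W = W \<inter> closure S" using assms by blast
  also have "\<dots> \<subseteq> closure (W \<inter> S)" by (rule open_Int_closure_subset[OF assms(1)])
  finally show ?thesis .
qed

lemma open_HC: "open HC"
proof -
  have "HC = (\<lambda>p. Im (fst p)) -` {0<..}" by (auto simp: HC_def)
  also have "open \<dots>" by (intro open_vimage continuous_intros open_greaterThan)
  finally show ?thesis .
qed

lemma convex_HC: "convex HC"
proof -
  have "HC = {\<tau>. Im \<tau> > 0} \<times> UNIV" by (auto simp: HC_def)
  moreover have "convex \<dots>" by (intro convex_Times convex_halfspace_Im_gt convex_UNIV)
  ultimately show ?thesis by simp
qed

lemma holo2_on_continuous: "holo2_on f U \<Longrightarrow> continuous_on U f"
  unfolding holo2_on_def
  by (meson continuous_at_imp_continuous_on has_derivative_continuous)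

lemma holo2_on_subset: "holo2_on f U \<Longrightarrow> V \<subseteq> U \<Longrightarrow> holo2_on f V"
  unfolding holo2_on_def by blast

lemma holo2_on_const: "holo2_on (\<lambda>_. c) U"
  unfolding holo2_on_def
proof
  fix p
  have "((\<lambda>_::complex \<times> complex. c) has_derivative (\<lambda>(h, k). 0 * h + 0 * k)) (at p)"
    by (simp add: case_prod_unfold)
  thus "\<exists>a b. ((\<lambda>_. c) has_derivative (\<lambda>(h, k). a * h + b * k)) (at p)" by blast
qed

lemma holo2_on_add:
  assumes "holo2_on f U" "holo2_on g U" shows "holo2_on (\<lambda>q. f q + g q) U"
  unfolding holo2_on_def
proof
  fix p assume "p \<in> U"
  then obtain a b c d where
    "(f has_derivative (\<lambda>(h, k). a * h + b * k)) (at p)"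
    "(g has_derivative (\<lambda>(h, k). c * h + d * k)) (at p)"
    using assms unfolding holo2_on_def by blast
  from has_derivative_add[OF this]
  have "((\<lambda>q. f q + g q) has_derivative (\<lambda>(h, k). (a + c) * h + (b + d) * k)) (at p)"
    by (simp add: case_prod_unfold algebra_simps)
  thus "\<exists>a b. ((\<lambda>q. f q + g q) has_derivative (\<lambda>(h, k). a * h + b * k)) (at p)" by blast
qed

lemma holo2_on_mult:
  assumes "holo2_on f U" "holo2_on g U" shows "holo2_on (\<lambda>q. f q * g q) U"
  unfolding holo2_on_def
proof
  fix p assume "p \<in> U"
  then obtain a b c d where
    "(f has_derivative (\<lambda>(h, k). a * h + b * k)) (at p)"
    "(g has_derivative (\<lambda>(h, k). c * h + d * k)) (at p)"
    using assms unfolding holo2_on_def by blast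
  from has_derivative_mult[OF this]
  have "((\<lambda>q. f q * g q) has_derivative
      (\<lambda>(h, k). (f p * c + a * g p) * h + (f p * d + b * g p) * k)) (at p)"
    by (simp add: case_prod_unfold algebra_simps)
  thus "\<exists>a b. ((\<lambda>q. f q * g q) has_derivative (\<lambda>(h, k). a * h + b * k)) (at p)" by blast
qed

lemma open_nonzero_set:
  assumes "open U" "holo2_on h U" shows "open {q\<in>U. h q \<noteq> 0}"
proof -
  have "open (U \<inter> h -` (- {0}))"
    using continuous_open_preimage[OF holo2_on_continuous[OF assms(2)] assms(1), of "- {0}"] by auto
  thus ?thesis by (simp add: vimage_def Int_def)
qed

lemma mero2E:
  assumes "mero2 f" "p \<in> HC"
  obtains U g h where "open U" "p \<in> U" "U \<subseteq> HC" "holo2_on g U" "holo2_on h U"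
    "U \<subseteq> closure {q\<in>U. h q \<noteq> 0}" "\<forall>q\<in>U. h q \<noteq> 0 \<longrightarrow> f q = g q / h q"
  using bspec[OF assms(1)[unfolded mero2_def] assms(2)]
  by (elim exE conjE) (rule that; assumption)

lemma mero2_ballE:
  assumes "mero2 f" "p \<in> HC"
  obtains U g h where "open U" "convex U" "p \<in> U" "U \<subseteq> HC" "holo2_on g U" "holo2_on h U"
    "U \<subseteq> closure {q\<in>U. h q \<noteq> 0}" "\<forall>q\<in>U. h q \<noteq> 0 \<longrightarrow> f q = g q / h q"
proof -
  obtain U g h where U: "open U" "p \<in> U" "U \<subseteq> HC" "holo2_on g U" "holo2_on h U"
    "U \<subseteq> closure {q\<in>U. h q \<noteq> 0}" "\<forall>q\<in>U. h q \<noteq> 0 \<longrightarrow> f q = g q / h q"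
    using assms by (rule mero2E)
  obtain e where e: "e > 0" "ball p e \<subseteq> U" using U(1,2) open_contains_ball by blast
  let ?B = "ball p e"
  have "?B \<subseteq> closure (?B \<inter> {q\<in>U. h q \<noteq> 0})"
    by (rule dense_restrict[OF _ e(2) U(6)]) simp
  also have "?B \<inter> {q\<in>U. h q \<noteq> 0} = {q\<in>?B. h q \<noteq> 0}" using e by auto
  finally have "?B \<subseteq> closure {q\<in>?B. h q \<noteq> 0}" .
  moreover have "convex ?B" "open ?B" "p \<in> ?B" "?B \<subseteq> HC" using e U by auto
  moreover have "holo2_on g ?B" "holo2_on h ?B" using U e by (auto intro: holo2_on_subset)
  ultimately show thesis by (intro that[of ?B g h]) (use U(7) e(2) in auto)
qed

lemma mero2_local2:
  assumes "mero2 f" "mero2 f'" "p \<in> HC"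
  obtains U g h g' h' where "open U" "p \<in> U" "U \<subseteq> HC" "holo2_on g U" "holo2_on h U"
    "holo2_on g' U" "holo2_on h' U" "U \<subseteq> closure {q\<in>U. h q * h' q \<noteq> 0}"
    "\<forall>q\<in>U. h q \<noteq> 0 \<longrightarrow> f q = g q / h q"
    "\<forall>q\<in>U. h' q \<noteq> 0 \<longrightarrow> f' q = g' q / h' q"
proof -
  obtain U g h where U: "open U" "p \<in> U" "U \<subseteq> HC" "holo2_on g U" "holo2_on h U"
    "U \<subseteq> closure {q\<in>U. h q \<noteq> 0}" "\<forall>q\<in>U. h q \<noteq> 0 \<longrightarrow> f q = g q / h q"
    using assms(1,3) by (rule mero2E)
  obtain V g' h' where V: "open V" "p \<in> V" "V \<subseteq> HC" "holo2_on g' V" "holo2_on h' V"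
    "V \<subseteq> closure {q\<in>V. h' q \<noteq> 0}" "\<forall>q\<in>V. h' q \<noteq> 0 \<longrightarrow> f' q = g' q / h' q"
    using assms(2,3) by (rule mero2E)
  let ?W = "U \<inter> V"
  have hol: "holo2_on g ?W" "holo2_on h ?W" "holo2_on g' ?W" "holo2_on h' ?W"
    using U V by (auto intro: holo2_on_subset)
  have "?W \<subseteq> closure (?W \<inter> {q\<in>U. h q \<noteq> 0})"
    by (rule dense_restrict[OF _ _ U(6)]) (use U(1) V(1) in auto)
  also have "?W \<inter> {q\<in>U. h q \<noteq> 0} = {q\<in>?W. h q \<noteq> 0}" by auto
  finally have 1: "?W \<subseteq> closure {q\<in>?W. h q \<noteq> 0}" .
  have "?W \<subseteq> closure (?W \<inter> {q\<in>V. h' q \<noteq> 0})"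
    by (rule dense_restrict[OF _ _ V(6)]) (use U(1) V(1) in auto)
  also have "?W \<inter> {q\<in>V. h' q \<noteq> 0} = {q\<in>?W. h' q \<noteq> 0}" by auto
  finally have 2: "?W \<subseteq> closure {q\<in>?W. h' q \<noteq> 0}" .
  have "?W \<subseteq> closure ({q\<in>?W. h q \<noteq> 0} \<inter> {q\<in>?W. h' q \<noteq> 0})"
    by (rule dense_open_Int[OF _ _ _ _ _ 1 2]) (use open_nonzero_set[OF _ hol(2)] open_nonzero_set[OF _ hol(4)] U(1) V(1) in auto)
  also have "{q\<in>?W. h q \<noteq> 0} \<inter> {q\<in>?W. h' q \<noteq> 0} = {q\<in>?W. h q * h' q \<noteq> 0}" by auto
  finally show thesis by (intro that[of ?W g h g' h']) (use U V hol in auto)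
qed

lemma mero2I:
  assumes "\<And>p. p \<in> HC \<Longrightarrow> \<exists>U g h. open U \<and> p \<in> U \<and> U \<subseteq> HC \<and> holo2_on g U \<and> holo2_on h U \<and>
     U \<subseteq> closure {q\<in>U. h q \<noteq> 0} \<and> (\<forall>q\<in>U. h q \<noteq> 0 \<longrightarrow> f q = g q / h q)"
  shows "mero2 f"
  unfolding mero2_def using assms by (rule ballI)

lemma holo2_imp_mero2: "holo2_on f HC \<Longrightarrow> mero2 f"
  by (rule mero2I, rule exI[of _ HC], rule exI[of _ f], rule exI[of _ "\<lambda>_. 1"])
     (auto simp: open_HC holo2_on_const closure_subset[THEN subsetD])

lemma mero2_const: "mero2 (\<lambda>_. c)"
  by (rule holo2_imp_mero2[OF holo2_on_const])

lemma mero2_add: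
  assumes "mero2 f" "mero2 f'" shows "mero2 (\<lambda>q. f q + f' q)"
proof (rule mero2I)
  fix p assume "p \<in> HC"
  from assms this obtain U g h g' h' where U: "open U" "p \<in> U" "U \<subseteq> HC" "holo2_on g U" "holo2_on h U"
    "holo2_on g' U" "holo2_on h' U" "U \<subseteq> closure {q\<in>U. h q * h' q \<noteq> 0}"
    "\<forall>q\<in>U. h q \<noteq> 0 \<longrightarrow> f q = g q / h q"
    "\<forall>q\<in>U. h' q \<noteq> 0 \<longrightarrow> f' q = g' q / h' q"
    by (rule mero2_local2)
  show "\<exists>U g h. open U \<and> p \<in> U \<and> U \<subseteq> HC \<and> holo2_on g U \<and> holo2_on h U \<and>
     U \<subseteq> closure {q\<in>U. h q \<noteq> 0} \<and> (\<forall>q\<in>U. h q \<noteq> 0 \<longrightarrow> f q + f' q = g q / h q)"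
    by (rule exI[of _ U], rule exI[of _ "\<lambda>q. g q * h' q + g' q * h q"],
        rule exI[of _ "\<lambda>q. h q * h' q"])
       (use U in \<open>auto intro!: holo2_on_add holo2_on_mult simp: add_frac_eq\<close>)
qed

lemma mero2_mult:
  assumes "mero2 f" "mero2 f'" shows "mero2 (\<lambda>q. f q * f' q)"
proof (rule mero2I)
  fix p assume "p \<in> HC"
  from assms this obtain U g h g' h' where U: "open U" "p \<in> U" "U \<subseteq> HC" "holo2_on g U" "holo2_on h U"
    "holo2_on g' U" "holo2_on h' U" "U \<subseteq> closure {q\<in>U. h q * h' q \<noteq> 0}"
    "\<forall>q\<in>U. h q \<noteq> 0 \<longrightarrow> f q = g q / h q"
    "\<forall>q\<in>U. h' q \<noteq> 0 \<longrightarrow> f' q = g' q / h' q"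
    by (rule mero2_local2)
  show "\<exists>U g h. open U \<and> p \<in> U \<and> U \<subseteq> HC \<and> holo2_on g U \<and> holo2_on h U \<and>
     U \<subseteq> closure {q\<in>U. h q \<noteq> 0} \<and> (\<forall>q\<in>U. h q \<noteq> 0 \<longrightarrow> f q * f' q = g q / h q)"
    by (rule exI[of _ U], rule exI[of _ "\<lambda>q. g q * g' q"], rule exI[of _ "\<lambda>q. h q * h' q"])
       (use U in \<open>auto intro!: holo2_on_mult\<close>)
qed

lemma holo2_identity:
  assumes "convex U" "open U" "holo2_on g U" "open W" "W \<noteq> {}" "W \<subseteq> U"
    and "\<And>q. q \<in> W \<Longrightarrow> g q = 0" and "q \<in> U"
  shows "g q = 0"
proof -
  obtain p where p: "p \<in> W" using assms by auto
  define l where "l = (\<lambda>s::complex. (fst p + s * (fst q - fst p), snd p + s * (snd q - snd p)))"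
  have cont: "continuous_on UNIV l" unfolding l_def by (intro continuous_intros)
  have l01: "l 0 = p" "l 1 = q" by (auto simp: l_def)
  define S where "S = l -` U"
  have oS: "open S" unfolding S_def using cont assms(2) by (simp add: open_vimage)
  have aff: "l (u *\<^sub>R x + v *\<^sub>R y) = u *\<^sub>R l x + v *\<^sub>R l y" if "u + v = 1" for x y and u v :: real
  proof -
    have *: "c = u *\<^sub>R c + v *\<^sub>R c" for c :: complex
      using that by (metis scaleR_add_left scaleR_one)
    have v: "v = 1 - u" using that by simp
    show ?thesis unfolding v
      by (simp add: l_def prod_eq_iff scaleR_conv_of_real algebra_simps)
  qed
  have cS: "convex S"
    unfolding convex_def S_def using aff assms(1) by (auto simp: convex_def)
  have hol: "(\<lambda>s. g (l s)) holomorphic_on S"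
    unfolding holomorphic_on_def
  proof
    fix s assume "s \<in> S"
    hence "l s \<in> U" by (simp add: S_def)
    then obtain a b where ab: "(g has_derivative (\<lambda>(h, k). a * h + b * k)) (at (l s))"
      using assms(3) unfolding holo2_on_def by blast
    have dl: "(l has_derivative (\<lambda>h. (h * (fst q - fst p), h * (snd q - snd p)))) (at s)"
      unfolding l_def by (auto intro!: derivative_eq_intros)
    have "((\<lambda>s. g (l s)) has_derivative (*) (a * (fst q - fst p) + b * (snd q - snd p))) (at s)"
      using has_derivative_compose[OF dl ab] by (rule has_derivative_eq_rhs) (auto simp: algebra_simps)
    hence "((\<lambda>s. g (l s)) has_field_derivative (a * (fst q - fst p) + b * (snd q - snd p))) (at s)"
      by (simp add: has_field_derivative_def)
    thus "(\<lambda>s. g (l s)) field_differentiable at s within S"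
      using field_differentiable_def field_differentiable_at_within by blast
  qed
  have "g (l 1) = 0"
  proof (rule analytic_continuation_open[where f = "\<lambda>s. g (l s)" and z = 1 and s = "l -` W" and s' = S and g = "\<lambda>_. 0"])
    show "open (l -` W)" using cont assms(4) by (simp add: open_vimage)
    show "l -` W \<noteq> {}" using p l01 by auto
    show "l -` W \<subseteq> S" using assms(6) by (auto simp: S_def)
    show "g (l s) = 0" if "s \<in> l -` W" for s using that assms(7) by simp
    show "1 \<in> S" using assms(8) l01 by (simp add: S_def)
    show "connected S" by (rule convex_connected[OF cS])
    show "(\<lambda>s. g (l s)) holomorphic_on S" by (rule hol)
  qed (use oS in auto)
  thus ?thesis by (simp add: l01)
qed

lemma mero2_nonzero_dichotomy:
  assumes "mero2 f"
  shows "mero2_eq f (\<lambda>_. 0) \<or> interior {q\<in>HC. f q = 0} = {}"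
proof (rule disjCI)
  define D where "D = interior {q\<in>HC. f q = 0}"
  have D: "open D" "D \<subseteq> HC" "\<And>q. q \<in> D \<Longrightarrow> f q = 0"
    using interior_subset[of "{q\<in>HC. f q = 0}"] by (auto simp: D_def)
  assume "interior {q\<in>HC. f q = 0} \<noteq> {}"
  hence "D \<noteq> {}" by (simp add: D_def)
  let ?Z = "HC \<inter> closure D"
  have "open ?Z"
  proof (subst open_subopen, intro ballI)
    fix p assume p: "p \<in> ?Z"
    hence "p \<in> HC" by auto
    from assms this obtain U g h where U: "open U" "convex U" "p \<in> U" "U \<subseteq> HC" "holo2_on g U" "holo2_on h U"
      "U \<subseteq> closure {q\<in>U. h q \<noteq> 0}" "\<forall>q\<in>U. h q \<noteq> 0 \<longrightarrow> f q = g q / h q"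
      by (rule mero2_ballE)
    let ?N = "{q\<in>U. h q \<noteq> 0}"
    have oN: "open ?N" by (rule open_nonzero_set) (use U in auto)
    have "D \<inter> U \<noteq> {}" using p U(1,3) closure_meets_open by blast
    then obtain r where r: "r \<in> D" "r \<in> U" by auto
    have "?N \<inter> (D \<inter> U) \<noteq> {}"
      by (rule closure_meets_open[of r]) (use U(1,7) r D(1) in auto)
    hence ne: "?N \<inter> D \<noteq> {}" by blast
    have "g q = 0" if "q \<in> ?N \<inter> D" for q using that U(8) D(3)[of q] by auto
    hence "g q = 0" if "q \<in> U" for q
      using holo2_identity[of U g "?N \<inter> D" q] U that ne oN D(1) by auto
    hence "?N \<subseteq> {q\<in>HC. f q = 0}" using U by auto
    hence "?N \<subseteq> D" unfolding D_def using oN by (simp add: interior_maximal)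
    hence "U \<subseteq> closure D" using U(7) closure_mono by blast
    thus "\<exists>T. open T \<and> p \<in> T \<and> T \<subseteq> ?Z" using U by blast
  qed
  moreover have "openin (top_of_set HC) ?Z = open ?Z"
    using open_HC by (auto simp: openin_open_eq)
  moreover have "closedin (top_of_set HC) ?Z" by (intro closedin_closed_Int closed_closure)
  moreover have "?Z \<noteq> {}" using \<open>D \<noteq> {}\<close> D(2) closure_subset by fastforce
  moreover have "connected HC" by (rule convex_connected[OF convex_HC])
  ultimately have "?Z = HC" unfolding connected_clopen by blast
  thus "mero2_eq f (\<lambda>_. 0)" unfolding mero2_eq_def using D by (intro exI[of _ D]) auto
qed

lemma mero2_inverse:
  assumes "mero2 f" shows "mero2 (\<lambda>q. inverse (f q))"
proof (cases "mero2_eq f (\<lambda>_. 0)")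
  case True
  then obtain D where D: "open D" "D \<subseteq> HC" "HC \<subseteq> closure D" "\<And>q. q \<in> D \<Longrightarrow> f q = 0"
    unfolding mero2_eq_def by auto
  show ?thesis
  proof (rule mero2I)
    fix p assume "p \<in> HC"
    from assms this obtain U g h where U: "open U" "convex U" "p \<in> U" "U \<subseteq> HC" "holo2_on g U" "holo2_on h U"
      "U \<subseteq> closure {q\<in>U. h q \<noteq> 0}" "\<forall>q\<in>U. h q \<noteq> 0 \<longrightarrow> f q = g q / h q"
      by (rule mero2_ballE)
    let ?N = "{q\<in>U. h q \<noteq> 0}"
    have oN: "open ?N" by (rule open_nonzero_set) (use U in auto)
    have UD: "U \<subseteq> closure (U \<inter> D)"
      by (rule dense_restrict[OF U(1) U(4) D(3)])
    have "U \<subseteq> closure (?N \<inter> (U \<inter> D))"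
      by (rule dense_open_Int[OF _ _ _ _ _ U(7) UD]) (use U D oN in auto)
    hence "?N \<inter> (U \<inter> D) \<noteq> {}" using U(3) by (metis closure_empty empty_iff subsetD)
    hence ne: "?N \<inter> D \<noteq> {}" by blast
    have "g q = 0" if "q \<in> ?N \<inter> D" for q using that U(8) D(4)[of q] by auto
    hence g0: "g q = 0" if "q \<in> U" for q
      using holo2_identity[of U g "?N \<inter> D" q] U that ne oN D(1) by auto
    show "\<exists>U g h. open U \<and> p \<in> U \<and> U \<subseteq> HC \<and> holo2_on g U \<and> holo2_on h U \<and>
       U \<subseteq> closure {q\<in>U. h q \<noteq> 0} \<and> (\<forall>q\<in>U. h q \<noteq> 0 \<longrightarrow> inverse (f q) = g q / h q)"
      by (rule exI[of _ U], rule exI[of _ g], rule exI[of _ h]) (use U g0 in auto)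
  qed
next
  case False
  with mero2_nonzero_dichotomy[OF assms] have int: "interior {q\<in>HC. f q = 0} = {}" by auto
  show ?thesis
  proof (rule mero2I)
    fix p assume "p \<in> HC"
    from assms this obtain U g h where U: "open U" "convex U" "p \<in> U" "U \<subseteq> HC" "holo2_on g U" "holo2_on h U"
      "U \<subseteq> closure {q\<in>U. h q \<noteq> 0}" "\<forall>q\<in>U. h q \<noteq> 0 \<longrightarrow> f q = g q / h q"
      by (rule mero2_ballE)
    let ?N = "{q\<in>U. h q \<noteq> 0}"
    have oN: "open ?N" by (rule open_nonzero_set) (use U in auto)
    have dense: "U \<subseteq> closure {q\<in>U. g q \<noteq> 0}"
    proof
      fix r assume r: "r \<in> U"
      show "r \<in> closure {q\<in>U. g q \<noteq> 0}"
        unfolding closure_iff_nhds_not_empty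
      proof (intro allI impI notI)
        fix A V assume V: "V \<subseteq> A" "open V" "r \<in> V" and "{q\<in>U. g q \<noteq> 0} \<inter> A = {}"
        hence g0: "g q = 0" if "q \<in> V" "q \<in> U" for q using that by auto
        have "?N \<inter> V \<subseteq> {q\<in>HC. f q = 0}" using g0 U by auto
        hence "?N \<inter> V = {}" using int oN V(2) interior_maximal[of "?N \<inter> V" "{q\<in>HC. f q = 0}"] by auto
        moreover have "r \<in> closure ?N" using r U(7) by auto
        ultimately show False using V(2,3) closure_meets_open by blast
      qed
    qed
    have "U \<subseteq> closure ({q\<in>U. g q \<noteq> 0} \<inter> ?N)"
      by (rule dense_open_Int[OF _ _ _ _ _ dense U(7)]) (use U oN in \<open>auto intro!: open_nonzero_set\<close>)
    also have "{q\<in>U. g q \<noteq> 0} \<inter> ?N = {q\<in>U. g q * h q \<noteq> 0}" by auto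
    finally have d2: "U \<subseteq> closure {q\<in>U. g q * h q \<noteq> 0}" .
    show "\<exists>U g h. open U \<and> p \<in> U \<and> U \<subseteq> HC \<and> holo2_on g U \<and> holo2_on h U \<and>
       U \<subseteq> closure {q\<in>U. h q \<noteq> 0} \<and> (\<forall>q\<in>U. h q \<noteq> 0 \<longrightarrow> inverse (f q) = g q / h q)"
      by (rule exI[of _ U], rule exI[of _ "\<lambda>q. h q * h q"], rule exI[of _ "\<lambda>q. g q * h q"])
         (use U d2 in \<open>auto intro!: holo2_on_mult\<close>)
  qed
qed

lemma mero2_shift:
  assumes "mero2 f" shows "mero2 (\<lambda>(\<tau>, \<theta>). f (\<tau>, \<theta> + of_int n * \<tau>))"
proof -
  define s where "s = (\<lambda>(\<tau>, \<theta>). (\<tau>, \<theta> + of_int n * \<tau>) :: complex \<times> complex)"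
  define s' where "s' = (\<lambda>(\<tau>, \<theta>). (\<tau>, \<theta> - of_int n * \<tau>) :: complex \<times> complex)"
  have inv: "s (s' q) = q" "s' (s q) = q" for q by (auto simp: s_def s'_def case_prod_unfold)
  have cont: "continuous_on UNIV s" "continuous_on UNIV s'"
    unfolding s_def s'_def case_prod_unfold by (intro continuous_intros)+
  have HCs: "s q \<in> HC \<longleftrightarrow> q \<in> HC" for q by (auto simp: s_def HC_def case_prod_unfold)
  have hol: "holo2_on (\<lambda>q. g (s q)) (s -` U)" if hg: "holo2_on g U" for g U
    unfolding holo2_on_def
  proof
    fix p assume "p \<in> s -` U"
    then obtain a b where ab: "(g has_derivative (\<lambda>(h, k). a * h + b * k)) (at (s p))"
      using hg unfolding holo2_on_def by blast
    have ds: "(s has_derivative (\<lambda>(h, k). (h, k + of_int n * h))) (at p)"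
      unfolding s_def case_prod_unfold by (auto intro!: derivative_eq_intros)
    have "((\<lambda>q. g (s q)) has_derivative (\<lambda>(h, k). (a + b * of_int n) * h + b * k)) (at p)"
      using has_derivative_compose[OF ds ab] by (simp add: case_prod_unfold algebra_simps)
    thus "\<exists>a b. ((\<lambda>q. g (s q)) has_derivative (\<lambda>(h, k). a * h + b * k)) (at p)" by blast
  qed
  have "mero2 (\<lambda>q. f (s q))"
  proof (rule mero2I)
    fix p assume "p \<in> HC"
    hence "s p \<in> HC" by (simp add: HCs)
    from assms this obtain U g h where U: "open U" "s p \<in> U" "U \<subseteq> HC" "holo2_on g U" "holo2_on h U"
      "U \<subseteq> closure {q\<in>U. h q \<noteq> 0}" "\<forall>q\<in>U. h q \<noteq> 0 \<longrightarrow> f q = g q / h q"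
      by (rule mero2E)
    have "s -` U \<subseteq> closure {q \<in> s -` U. h (s q) \<noteq> 0}"
    proof
      fix r assume r: "r \<in> s -` U"
      have "s r \<in> closure {q\<in>U. h q \<noteq> 0}" using r U by auto
      hence "s' (s r) \<in> s' ` closure {q\<in>U. h q \<noteq> 0}" by blast
      also have "\<dots> \<subseteq> closure (s' ` {q\<in>U. h q \<noteq> 0})"
        by (rule image_closure_subset) (use cont in \<open>auto intro: continuous_on_subset closure_subset[THEN subsetD]\<close>)
      also have "\<dots> \<subseteq> closure {q \<in> s -` U. h (s q) \<noteq> 0}" by (rule closure_mono) (auto simp: inv)
      finally show "r \<in> closure {q \<in> s -` U. h (s q) \<noteq> 0}" by (simp add: inv)
    qed
    moreover have "open (s -` U)" using cont U(1) by (simp add: open_vimage)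
    moreover have "s -` U \<subseteq> HC" using HCs U(3) by blast
    ultimately show "\<exists>U g h. open U \<and> p \<in> U \<and> U \<subseteq> HC \<and> holo2_on g U \<and> holo2_on h U \<and>
       U \<subseteq> closure {q\<in>U. h q \<noteq> 0} \<and> (\<forall>q\<in>U. h q \<noteq> 0 \<longrightarrow> f (s q) = g q / h q)"
      by (intro exI[of _ "s -` U"] exI[of _ "\<lambda>q. g (s q)"] exI[of _ "\<lambda>q. h (s q)"])
         (use U in \<open>auto intro!: hol\<close>)
  qed
  thus ?thesis by (simp add: s_def case_prod_unfold)
qed

lemma mero2_eqI: "(\<And>q. q \<in> HC \<Longrightarrow> f q = g q) \<Longrightarrow> mero2_eq f g"
  unfolding mero2_eq_def using open_HC closure_subset by blast

lemma mero2_eq_refl: "mero2_eq f f"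
  by (rule mero2_eqI) auto

lemma mero2_eq_sym: "mero2_eq f g \<Longrightarrow> mero2_eq g f"
  unfolding mero2_eq_def by metis

lemma mero2_eq_combine:
  assumes "mero2_eq f g" "mero2_eq f' g'" "\<And>q. f q = g q \<Longrightarrow> f' q = g' q \<Longrightarrow> k q = k' q"
  shows "mero2_eq k k'"
proof -
  obtain D where D: "open D" "D \<subseteq> HC" "HC \<subseteq> closure D" "\<forall>q\<in>D. f q = g q"
    using assms(1) unfolding mero2_eq_def by blast
  obtain E where E: "open E" "E \<subseteq> HC" "HC \<subseteq> closure E" "\<forall>q\<in>E. f' q = g' q"
    using assms(2) unfolding mero2_eq_def by blast
  have "HC \<subseteq> closure (D \<inter> E)" by (rule dense_open_Int) (use D E open_HC in auto)
  thus ?thesis unfolding mero2_eq_def using D E assms(3) by (intro exI[of _ "D \<inter> E"]) auto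
qed

lemma mero2_eq_map:
  "mero2_eq f g \<Longrightarrow> (\<And>q. f q = g q \<Longrightarrow> k q = k' q) \<Longrightarrow> mero2_eq k k'"
  by (rule mero2_eq_combine[of f g f g]) auto

lemma mero2_eq_trans: "mero2_eq f g \<Longrightarrow> mero2_eq g h \<Longrightarrow> mero2_eq f h"
  by (rule mero2_eq_combine[of f g g h]) auto

lemma mero2_eq_shift:
  assumes "mero2_eq f g"
  shows "mero2_eq (\<lambda>(\<tau>, \<theta>). f (\<tau>, \<theta> + of_int n * \<tau>)) (\<lambda>(\<tau>, \<theta>). g (\<tau>, \<theta> + of_int n * \<tau>))"
proof -
  define s where "s = (\<lambda>(\<tau>, \<theta>). (\<tau>, \<theta> + of_int n * \<tau>) :: complex \<times> complex)"
  define s' where "s' = (\<lambda>(\<tau>, \<theta>). (\<tau>, \<theta> - of_int n * \<tau>) :: complex \<times> complex)"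
  have inv: "s (s' q) = q" "s' (s q) = q" for q by (auto simp: s_def s'_def case_prod_unfold)
  have cont: "continuous_on UNIV s" "continuous_on UNIV s'"
    unfolding s_def s'_def case_prod_unfold by (intro continuous_intros)+
  have HCs: "s q \<in> HC \<longleftrightarrow> q \<in> HC" for q by (auto simp: s_def HC_def case_prod_unfold)
  obtain D where D: "open D" "D \<subseteq> HC" "HC \<subseteq> closure D" "\<forall>q\<in>D. f q = g q"
    using assms(1) unfolding mero2_eq_def by blast
  have "HC \<subseteq> closure (s -` D)"
  proof
    fix r assume "r \<in> HC"
    hence "s r \<in> closure D" using D(3) HCs by blast
    hence "s' (s r) \<in> s' ` closure D" by blast
    also have "\<dots> \<subseteq> closure (s' ` D)"
      by (rule image_closure_subset) (use cont in \<open>auto intro: continuous_on_subset closure_subset[THEN subsetD]\<close>)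
    also have "\<dots> \<subseteq> closure (s -` D)" by (rule closure_mono) (auto simp: inv)
    finally show "r \<in> closure (s -` D)" by (simp add: inv)
  qed
  moreover have "open (s -` D)" using cont D(1) by (simp add: open_vimage)
  moreover have "s -` D \<subseteq> HC" using HCs D(2) by blast
  ultimately have "mero2_eq (\<lambda>q. f (s q)) (\<lambda>q. g (s q))"
    unfolding mero2_eq_def using D(4) by (intro exI[of _ "s -` D"]) auto
  thus ?thesis by (simp add: s_def case_prod_unfold)
qed

lemma not_mero2_eq_0_1: "\<not> mero2_eq (\<lambda>_. 0) (\<lambda>_. 1)"
proof
  assume "mero2_eq (\<lambda>_. 0) (\<lambda>_. 1)"
  then obtain D where "HC \<subseteq> closure D" "\<forall>q\<in>D. (0::complex) = 1"
    unfolding mero2_eq_def by blast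
  moreover from this(2) have "D = {}" by (metis equals0I zero_neq_one)
  ultimately have "HC = {}" by simp
  moreover have "(\<i>, 0) \<in> HC" by (simp add: HC_def)
  ultimately show False by auto
qed

quotient_type mero = "complex \<times> complex \<Rightarrow> complex" / partial:
  "\<lambda>f g. mero2 f \<and> mero2 g \<and> mero2_eq f g"
proof (rule part_equivpI)
  show "\<exists>f. mero2 f \<and> mero2 f \<and> mero2_eq f f"
    using mero2_const[of 0] mero2_eq_refl by blast
  show "symp (\<lambda>f g. mero2 f \<and> mero2 g \<and> mero2_eq f g)"
    using mero2_eq_sym by (auto simp: symp_def)
  show "transp (\<lambda>f g. mero2 f \<and> mero2 g \<and> mero2_eq f g)"
    using mero2_eq_trans by (auto simp: transp_def)
qed

instantiation mero :: field
begin

lift_definition zero_mero :: mero is "\<lambda>_. 0" using mero2_const mero2_eq_refl by auto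
lift_definition one_mero :: mero is "\<lambda>_. 1" using mero2_const mero2_eq_refl by auto
lift_definition plus_mero :: "mero \<Rightarrow> mero \<Rightarrow> mero" is "\<lambda>f g q. f q + g q"
  by (auto intro: mero2_add elim: mero2_eq_combine)
lift_definition times_mero :: "mero \<Rightarrow> mero \<Rightarrow> mero" is "\<lambda>f g q. f q * g q"
  by (auto intro: mero2_mult elim: mero2_eq_combine)
lift_definition uminus_mero :: "mero \<Rightarrow> mero" is "\<lambda>f q. - f q"
  using mero2_mult[OF mero2_const[of "-1"]] by (auto elim: mero2_eq_map)
lift_definition inverse_mero :: "mero \<Rightarrow> mero" is "\<lambda>f q. inverse (f q)"
  by (auto intro: mero2_inverse elim: mero2_eq_map)
definition minus_mero :: "mero \<Rightarrow> mero \<Rightarrow> mero" where "minus_mero f g = f + - g"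
definition divide_mero :: "mero \<Rightarrow> mero \<Rightarrow> mero" where "divide_mero f g = f * inverse g"

lemma mero_inverse_aux:
  assumes "mero2 f" "\<not> mero2_eq f (\<lambda>_. 0)"
  shows "mero2_eq (\<lambda>q. inverse (f q) * f q) (\<lambda>_. 1)"
proof -
  have int: "interior {q\<in>HC. f q = 0} = {}" using mero2_nonzero_dichotomy assms by auto
  define D where "D = \<Union>{V. open V \<and> V \<subseteq> HC \<and> (\<forall>q\<in>V. f q \<noteq> 0)}"
  have "HC \<subseteq> closure D"
  proof
    fix p assume p: "p \<in> HC"
    show "p \<in> closure D" unfolding closure_iff_nhds_not_empty
    proof (intro allI impI)
      fix A V assume V: "V \<subseteq> A" "open V" "p \<in> V"
      obtain U g h where U: "open U" "convex U" "p \<in> U" "U \<subseteq> HC" "holo2_on g U" "holo2_on h U"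
        "U \<subseteq> closure {q\<in>U. h q \<noteq> 0}" "\<forall>q\<in>U. h q \<noteq> 0 \<longrightarrow> f q = g q / h q"
        using assms(1) p by (rule mero2_ballE)
      let ?N = "{q\<in>U. h q \<noteq> 0}"
      have oN: "open ?N" by (rule open_nonzero_set) (use U in auto)
      have "p \<in> closure ?N" using U by auto
      hence "?N \<inter> V \<noteq> {}" using V closure_meets_open by blast
      moreover have "\<not> ?N \<inter> V \<subseteq> {q\<in>HC. f q = 0}" if "?N \<inter> V \<noteq> {}"
        using that int oN V(2) interior_maximal[of "?N \<inter> V" "{q\<in>HC. f q = 0}"] by auto
      ultimately obtain r where r: "r \<in> ?N" "r \<in> V" "f r \<noteq> 0" using U(4) by blast
      have "open {q\<in>U. g q * h q \<noteq> 0}" by (rule open_nonzero_set) (use U in \<open>auto intro: holo2_on_mult\<close>)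
      moreover have "r \<in> {q\<in>U. g q * h q \<noteq> 0}" using r U(8) by auto
      moreover have "\<forall>q\<in>{q\<in>U. g q * h q \<noteq> 0}. f q \<noteq> 0" using U(8) by auto
      ultimately have "r \<in> D" unfolding D_def using U(4) by blast
      thus "D \<inter> A \<noteq> {}" using r V by auto
    qed
  qed
  moreover have "open D" "D \<subseteq> HC" "\<forall>q\<in>D. f q \<noteq> 0" unfolding D_def by auto
  ultimately show ?thesis unfolding mero2_eq_def by (intro exI[of _ D]) auto
qed

instance
proof
  fix a b c :: mero
  show "a + b + c = a + (b + c)"
    by transfer (auto intro: mero2_eqI mero2_add)
  show "a + b = b + a"
    by transfer (auto intro: mero2_eqI mero2_add)
  show "0 + a = a"
    by transfer (auto intro: mero2_eqI)
  show "- a + a = 0"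
    by transfer (auto intro: mero2_eqI mero2_const)
  show "a - b = a + - b" by (simp add: minus_mero_def)
  show "a * b * c = a * (b * c)"
    by transfer (auto intro: mero2_eqI mero2_mult simp: mult.assoc)
  show "a * b = b * a"
    by transfer (auto intro: mero2_eqI mero2_mult simp: mult.commute)
  show "1 * a = a"
    by transfer (auto intro: mero2_eqI)
  show "(a + b) * c = a * c + b * c"
    by transfer (auto intro!: mero2_eqI mero2_mult mero2_add simp: algebra_simps)
  show "(0 :: mero) \<noteq> 1"
    by transfer (use not_mero2_eq_0_1 in auto)
  show "inverse a * a = 1" if "a \<noteq> 0"
    using that by transfer (auto intro: mero_inverse_aux mero2_mult mero2_inverse mero2_const)
  show "a div b = a * inverse b" by (simp add: divide_mero_def)
  show "inverse (0 :: mero) = 0"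
    by transfer (auto intro: mero2_eqI mero2_const)
qed

end

lift_definition mero_const :: "complex \<Rightarrow> mero" is "\<lambda>c _. c"
  using mero2_const mero2_eq_refl by auto

lift_definition mero_shift :: "int \<Rightarrow> mero \<Rightarrow> mero" is "\<lambda>n f (\<tau>, \<theta>). f (\<tau>, \<theta> + of_int n * \<tau>)"
  using mero2_shift mero2_eq_shift by blast

lemma mero_shift_simps:
  "mero_shift n (f + g) = mero_shift n f + mero_shift n g"
  "mero_shift n (f * g) = mero_shift n f * mero_shift n g"
  "mero_shift n 0 = 0" "mero_shift n 1 = 1" "mero_shift 0 f = f"
  "mero_shift m (mero_shift n f) = mero_shift (m + n) f"
  "mero_shift n (mero_const c) = mero_const c"
proof -
  show "mero_shift n (f + g) = mero_shift n f + mero_shift n g"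
    by transfer (auto intro!: mero2_eqI mero2_shift mero2_add simp: mero2_add[THEN mero2_shift])
  show "mero_shift n (f * g) = mero_shift n f * mero_shift n g"
    by transfer (auto intro!: mero2_eqI mero2_shift mero2_mult)
  show "mero_shift n 0 = 0"
    by transfer (auto intro!: mero2_eqI simp: case_prod_unfold mero2_const)
  show "mero_shift n 1 = 1"
    by transfer (auto intro!: mero2_eqI simp: case_prod_unfold mero2_const)
  show "mero_shift 0 f = f"
    by transfer (auto intro!: mero2_eqI)
  show "mero_shift m (mero_shift n f) = mero_shift (m + n) f"
  proof transfer
    fix m n and f :: "complex \<times> complex \<Rightarrow> complex" assume f: "mero2 f \<and> mero2 f \<and> mero2_eq f f"
    show "mero2 (\<lambda>(\<tau>, \<theta>). case (\<tau>, \<theta> + of_int m * \<tau>) of (\<tau>, \<theta>) \<Rightarrow> f (\<tau>, \<theta> + of_int n * \<tau>)) \<and>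
       mero2 (\<lambda>(\<tau>, \<theta>). f (\<tau>, \<theta> + of_int (m + n) * \<tau>)) \<and>
       mero2_eq (\<lambda>(\<tau>, \<theta>). case (\<tau>, \<theta> + of_int m * \<tau>) of (\<tau>, \<theta>) \<Rightarrow> f (\<tau>, \<theta> + of_int n * \<tau>))
                (\<lambda>(\<tau>, \<theta>). f (\<tau>, \<theta> + of_int (m + n) * \<tau>))"
      using mero2_shift[of f "m + n"] mero2_shift[OF mero2_shift[of f n], of m] f
      by (auto intro!: mero2_eqI simp: algebra_simps)
  qed
  show "mero_shift n (mero_const c) = mero_const c"
    by transfer (auto intro!: mero2_eqI simp: case_prod_unfold mero2_const)
qed

section \<open>The extended quantum torus algebra\<close>

definition twisted_mult :: "(int \<Rightarrow>\<^sub>0 mero) \<Rightarrow> (int \<Rightarrow>\<^sub>0 mero) \<Rightarrow> (int \<Rightarrow>\<^sub>0 mero)" where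
  "twisted_mult a b = (\<Sum>i\<in>Poly_Mapping.keys a. \<Sum>j\<in>Poly_Mapping.keys b. Poly_Mapping.single (i + j)
     (Poly_Mapping.lookup a i * mero_shift i (Poly_Mapping.lookup b j)))"

lemma twisted_mult_superset:
  assumes "finite I" "finite J" "Poly_Mapping.keys a \<subseteq> I" "Poly_Mapping.keys b \<subseteq> J"
  shows "twisted_mult a b = (\<Sum>i\<in>I. \<Sum>j\<in>J. Poly_Mapping.single (i + j)
     (Poly_Mapping.lookup a i * mero_shift i (Poly_Mapping.lookup b j)))"
proof -
  have "twisted_mult a b = (\<Sum>i\<in>Poly_Mapping.keys a. \<Sum>j\<in>J. Poly_Mapping.single (i + j)
     (Poly_Mapping.lookup a i * mero_shift i (Poly_Mapping.lookup b j)))"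
    unfolding twisted_mult_def using assms
    by (intro sum.cong sum.mono_neutral_left) (auto simp: in_keys_iff mero_shift_simps)
  also have "\<dots> = (\<Sum>i\<in>I. \<Sum>j\<in>J. Poly_Mapping.single (i + j)
     (Poly_Mapping.lookup a i * mero_shift i (Poly_Mapping.lookup b j)))"
    using assms by (intro sum.mono_neutral_left) (auto simp: in_keys_iff)
  finally show ?thesis .
qed

lemma twisted_mult_add_left: "twisted_mult (a + b) c = twisted_mult a c + twisted_mult b c"
proof -
  let ?I = "Poly_Mapping.keys a \<union> Poly_Mapping.keys b" and ?J = "Poly_Mapping.keys c"
  have "Poly_Mapping.keys (a + b) \<subseteq> ?I" by (rule Poly_Mapping.keys_add)
  hence "twisted_mult (a + b) c = (\<Sum>i\<in>?I. \<Sum>j\<in>?J. Poly_Mapping.single (i + j)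
     (Poly_Mapping.lookup (a + b) i * mero_shift i (Poly_Mapping.lookup c j)))"
    by (intro twisted_mult_superset) auto
  also have "\<dots> = twisted_mult a c + twisted_mult b c"
    by (subst (1 2) twisted_mult_superset[of ?I ?J])
       (auto simp: lookup_add distrib_right single_add sum.distrib)
  finally show ?thesis .
qed

lemma twisted_mult_add_right: "twisted_mult c (a + b) = twisted_mult c a + twisted_mult c b"
proof -
  let ?I = "Poly_Mapping.keys a \<union> Poly_Mapping.keys b" and ?J = "Poly_Mapping.keys c"
  have "Poly_Mapping.keys (a + b) \<subseteq> ?I" by (rule Poly_Mapping.keys_add)
  hence "twisted_mult c (a + b) = (\<Sum>j\<in>?J. \<Sum>i\<in>?I. Poly_Mapping.single (j + i)
     (Poly_Mapping.lookup c j * mero_shift j (Poly_Mapping.lookup (a + b) i)))"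
    by (intro twisted_mult_superset) auto
  also have "\<dots> = twisted_mult c a + twisted_mult c b"
    by (subst (1 2) twisted_mult_superset[of ?J ?I])
       (auto simp: lookup_add distrib_left single_add sum.distrib mero_shift_simps)
  finally show ?thesis .
qed

lemma twisted_mult_zero: "twisted_mult 0 a = 0" "twisted_mult a 0 = 0"
  by (simp_all add: twisted_mult_def)

lemma twisted_mult_single:
  "twisted_mult (Poly_Mapping.single m f) (Poly_Mapping.single n g) =
   Poly_Mapping.single (m + n) (f * mero_shift m g)"
  by (subst twisted_mult_superset[of "{m}" "{n}"]) auto

lemma poly_mapping_add_induct:
  fixes a :: "'b \<Rightarrow>\<^sub>0 'c::comm_monoid_add"
  assumes "\<And>n f. P (Poly_Mapping.single n f)" "\<And>a b. P a \<Longrightarrow> P b \<Longrightarrow> P (a + b)"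
  shows "P a"
proof -
  have P0: "P 0" using assms(1)[of undefined 0] by simp
  have "P (\<Sum>i\<in>I. Poly_Mapping.single i (Poly_Mapping.lookup a i))" if "finite I" for I
    using that by (induction I rule: finite_induct) (auto intro: assms P0)
  hence "P (\<Sum>i\<in>Poly_Mapping.keys a. Poly_Mapping.single i (Poly_Mapping.lookup a i))" by simp
  also have "(\<Sum>i\<in>Poly_Mapping.keys a. Poly_Mapping.single i (Poly_Mapping.lookup a i)) = a"
    by (rule poly_mapping_eqI)
       (auto simp: lookup_sum lookup_single when_def in_keys_iff sum.If_cases)
  finally show ?thesis .
qed

lemma twisted_mult_assoc:
  "twisted_mult (twisted_mult a b) c = twisted_mult a (twisted_mult b c)"
proof (induction a rule: poly_mapping_add_induct)
  case (1 m f)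
  show ?case
  proof (induction b rule: poly_mapping_add_induct)
    case (1 n g)
    show ?case
      by (induction c rule: poly_mapping_add_induct)
         (simp_all add: twisted_mult_single twisted_mult_add_right mero_shift_simps mult.assoc add.assoc)
  qed (simp_all add: twisted_mult_add_left twisted_mult_add_right)
qed (simp_all add: twisted_mult_add_left)

lemma twisted_mult_one:
  "twisted_mult (Poly_Mapping.single 0 1) a = a" "twisted_mult a (Poly_Mapping.single 0 1) = a"
proof -
  show "twisted_mult (Poly_Mapping.single 0 1) a = a"
    by (induction a rule: poly_mapping_add_induct)
       (simp_all del: single_one add: twisted_mult_single twisted_mult_add_right mero_shift_simps)
  show "twisted_mult a (Poly_Mapping.single 0 1) = a"
    by (induction a rule: poly_mapping_add_induct)
       (simp_all del: single_one add: twisted_mult_single twisted_mult_add_left mero_shift_simps)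
qed

typedef qtorus = "UNIV :: (int \<Rightarrow>\<^sub>0 mero) set"
  morphisms qt_coeffs Qtorus by auto

setup_lifting type_definition_qtorus

instantiation qtorus :: ring_1
begin

lift_definition zero_qtorus :: qtorus is 0 .
lift_definition one_qtorus :: qtorus is "Poly_Mapping.single 0 1" .
lift_definition plus_qtorus :: "qtorus \<Rightarrow> qtorus \<Rightarrow> qtorus" is "(+)" .
lift_definition uminus_qtorus :: "qtorus \<Rightarrow> qtorus" is uminus .
lift_definition minus_qtorus :: "qtorus \<Rightarrow> qtorus \<Rightarrow> qtorus" is "(-)" .
lift_definition times_qtorus :: "qtorus \<Rightarrow> qtorus \<Rightarrow> qtorus" is twisted_mult .

instance
proof
  fix a b c :: qtorus
  show "a * b * c = a * (b * c)" by transfer (rule twisted_mult_assoc)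
  show "1 * a = a" by transfer (rule twisted_mult_one)
  show "a * 1 = a" by transfer (rule twisted_mult_one)
  show "(a + b) * c = a * c + b * c" by transfer (rule twisted_mult_add_left)
  show "a * (b + c) = a * b + a * c" by transfer (rule twisted_mult_add_right)
  show "(0 :: qtorus) \<noteq> 1" by transfer (metis lookup_single_eq lookup_zero zero_neq_one)
qed (transfer; simp)+

end

text \<open>The element \<open>f \<cdot> y\<^bsub>n\<alpha>\<^esub>\<close>, where \<open>\<alpha>\<close> stands for the coroot.\<close>

definition qmon :: "mero \<Rightarrow> int \<Rightarrow> qtorus" where
  "qmon f n = Qtorus (Poly_Mapping.single n f)"

lemma qmon_mult: "qmon f m * qmon g n = qmon (f * mero_shift m g) (m + n)"
  by (simp add: qmon_def times_qtorus.abs_eq twisted_mult_single)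

definition qt_y :: "int \<Rightarrow> qtorus" where
  "qt_y n = qmon 1 n"

definition qt_deg0 :: "qtorus set" where
  "qt_deg0 = range (\<lambda>f. qmon f 0)"

text \<open>Automorphisms as a unital algebra over the complex numbers; scalars act through the constant
  functions in degree 0, which are central.\<close>

definition qt_Aut :: "(qtorus \<Rightarrow> qtorus) set" where
  "qt_Aut = {\<Phi>. bij \<Phi> \<and> \<Phi> 1 = 1 \<and> (\<forall>a b. \<Phi> (a + b) = \<Phi> a + \<Phi> b) \<and>
     (\<forall>a b. \<Phi> (a * b) = \<Phi> a * \<Phi> b) \<and>
     (\<forall>c a. \<Phi> (qmon (mero_const c) 0 * a) = qmon (mero_const c) 0 * \<Phi> a)}"

definition qt_invertible :: "qtorus \<Rightarrow> bool" where
  "qt_invertible g \<longleftrightarrow> (\<exists>h. g * h = 1 \<and> h * g = 1)"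

definition qt_inv :: "qtorus \<Rightarrow> qtorus" where
  "qt_inv g = (THE h. g * h = 1 \<and> h * g = 1)"

definition Ad :: "qtorus \<Rightarrow> qtorus \<Rightarrow> qtorus" where
  "Ad g a = g * a * qt_inv g"

section \<open>Special functions\<close>

definition Lambda1 :: "complex \<Rightarrow> complex \<Rightarrow> complex" where
  "Lambda1 w \<eta> = Gamma (w + \<eta>) * exp w * (2 * of_real pi) powr (- 1 / 2) * w powr (1 / 2 - \<eta> - w)"

text \<open>Meromorphic continuations are normalised by \<open>nicely_meromorphic_on\<close>: the function is continuous
  away from its poles and takes the value 0 at the poles. This makes the continuation unique as a
  total function.\<close>

definition zeta2 :: "complex \<Rightarrow> complex \<Rightarrow> complex \<Rightarrow> complex \<Rightarrow> complex" where
  "zeta2 x a1 a2 = (THE Z. Z nicely_meromorphic_on UNIV \<and> (\<forall>s. Re s > 2 \<longrightarrow>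
     Z s = (\<Sum>\<^sub>\<infinity>(n1, n2)\<in>(UNIV :: (nat \<times> nat) set). (x + of_nat n1 * a1 + of_nat n2 * a2) powr (- s))))"

definition Gamma2_rhp :: "complex \<Rightarrow> complex \<Rightarrow> complex \<Rightarrow> complex" where
  "Gamma2_rhp x a1 a2 = (THE G. G nicely_meromorphic_on UNIV \<and>
     (\<forall>y. Re y > 0 \<longrightarrow> G y = exp (deriv (zeta2 y a1 a2) 0))) x"

definition B22 :: "complex \<Rightarrow> complex \<Rightarrow> complex \<Rightarrow> complex" where
  "B22 x a1 a2 = x\<^sup>2 / (a1 * a2) - (1 / a1 + 1 / a2) * x + 1 / 6 * (a2 / a1 + a1 / a2) + 1 / 2"

text \<open>Outside the region of parameters with positive real parts the analytic continuation in the
  parameters is given by rotating both of them by the mean \<open>m\<close> of their arguments. This is meaningful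
  for nonzero \<open>a1\<close>, \<open>a2\<close> off the negative real axis whose principal arguments differ by less than
  \<open>\<pi>\<close>.\<close>

definition Gamma2 :: "complex \<Rightarrow> complex \<Rightarrow> complex \<Rightarrow> complex" where
  "Gamma2 x a1 a2 =
    (if Re a1 > 0 \<and> Re a2 > 0 then Gamma2_rhp x a1 a2
     else let m = complex_of_real ((Arg a1 + Arg a2) / 2); l = exp (- \<i> * m)
          in exp (- \<i> * m / 2 * B22 x a1 a2) * Gamma2_rhp (l * x) (l * a1) (l * a2))"

definition F2 :: "complex \<Rightarrow> complex \<Rightarrow> complex \<Rightarrow> complex \<Rightarrow> complex" where
  "F2 w \<eta> a1 a2 = Gamma2 (w + \<eta>) a1 a2 * exp (1 / 2 * B22 (w + \<eta>) a1 a2 * Ln w) *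
     exp (- (3 * w\<^sup>2 / (4 * a1 * a2)) - \<eta> * w / (a1 * a2) + w * (a1 + a2) / (2 * a1 * a2))"

section \<open>The automorphisms and their candidate generators\<close>

text \<open>Throughout, \<open>\<sigma>\<close> is the sign, \<open>1\<close> or \<open>-1\<close>.\<close>

definition ray :: "int \<Rightarrow> complex \<Rightarrow> complex set" where
  "ray \<sigma> z = {of_int \<sigma> * of_real r * z |r::real. r > 0}"

definition Lambda_fun :: "int \<Rightarrow> complex \<Rightarrow> complex \<Rightarrow> complex \<times> complex \<Rightarrow> complex" where
  "Lambda_fun \<sigma> z t = (\<lambda>(\<tau>, \<theta>).
     Lambda1 (of_int \<sigma> * (z / (2 * of_real pi * \<i> * t))) (1 / 2 - of_int \<sigma> * (\<theta> + \<tau> / 2)))"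

definition F_fun :: "int \<Rightarrow> complex \<Rightarrow> complex \<Rightarrow> complex \<times> complex \<Rightarrow> complex" where
  "F_fun \<sigma> z t = (\<lambda>(\<tau>, \<theta>).
     F2 (of_int \<sigma> * (z / (2 * of_real pi * \<i> * t))) ((1 + \<tau>) / 2 - of_int \<sigma> * \<theta>) 1 \<tau>)"

text \<open>\<open>abs_mero f\<close> is the class of \<open>f\<close> in the field of meromorphic functions; it is meaningful only
  if \<open>mero2 f\<close> holds.\<close>

definition is_Psi :: "int \<Rightarrow> complex \<Rightarrow> complex \<Rightarrow> (qtorus \<Rightarrow> qtorus) \<Rightarrow> bool" where
  "is_Psi \<sigma> z t \<Phi> \<longleftrightarrow> \<Phi> \<in> qt_Aut \<and> (\<forall>a\<in>qt_deg0. \<Phi> a = a) \<and>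
     \<Phi> (qt_y 1) = qmon (abs_mero (Lambda_fun \<sigma> z t) powi \<sigma>) 0 * qt_y 1"

definition Psi :: "int \<Rightarrow> complex \<Rightarrow> complex \<Rightarrow> qtorus \<Rightarrow> qtorus" where
  "Psi \<sigma> z t = (THE \<Phi>. is_Psi \<sigma> z t \<Phi>)"

definition psi :: "int \<Rightarrow> complex \<Rightarrow> complex \<Rightarrow> qtorus" where
  "psi \<sigma> z t = qmon (inverse (abs_mero (F_fun \<sigma> z t))) 0"

end

(* Write B = B_{2,2}. The mixed difference operator (1 - exp (a1 D)) (1 - exp (a2 D)) is inverted by a
   formal power series in D; truncating it gives a two-dimensional Euler-Maclaurin summation of
   u^{-s} over the cone generated by a1, a2, which continues the double zeta function to the whole
   plane. Its s-derivative at 0 is log Gamma_2 (x) = q (x) - sum rho (x + m a1 + n a2), where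
   q (u) = -B(u)/2 log u + 3 u^2 / (4 a1 a2) - (a1 + a2) u / (2 a1 a2) and
   rho = (mixed difference of q) + log. For parameters 1, tau this series converges for x and tau in
   the upper half-plane, jointly holomorphically. Summing over one row and comparing with Euler's limit
   gives Gamma_2 (x) = Gamma_2 (x + tau) Gamma (x) / sqrt (2 pi), Stirling's constant being read off from
   the duplication of factorials; this continues 1 / Gamma_2 to all x. Rotating the parameters by
   exp (-i m) changes log by -i m, hence log Gamma_2 by i m B / 2, which is the factor in the definition
   of the continuation in the parameters. The functional equation turns F (w, eta) / F (w, eta + tau)
   into Lambda (w, eta), which is the statement about the automorphisms. *)

theory Submission
  imports Defs
begin

section \<open>Euler--Maclaurin summation over a planar lattice cone\<close>

text \<open>The definition reaches \<open>Gamma2\<close> through parameters of positive real part,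
  with a rotation when Re tau <= 0, while the field of meromorphic functions demands joint
  dependence on tau and theta, also across Re tau = 0. The logarithmic series is therefore studied
  twice: in the right half-plane, where it is the derivative of the double zeta function, and for x
  and tau in the upper half-plane, where the sign of Re tau is invisible. The two meet on an open
  overlap, and the identity theorem spreads the agreement. Order 2 of the expansion suffices at s =
  0: the remainder then decays like the inverse cube of the distance, which is summable over a
  planar lattice. Convergence of a single row already shows that Stirling's quotient has a nonzero
  limit c; the duplication quotient tends to c^2 / c = c, so knowing its limit is enough. Only 1 /
  Gamma_2 is continued, because it is entire in x; its inverse then takes the value 0 at the poles,
  as the normalization requires.\<close>

definition em_series :: "complex \<Rightarrow> complex \<Rightarrow> complex fps" where
  "em_series a1 a2 = Abs_fps (\<lambda>j. ((a1 + a2) ^ (j + 2) - a1 ^ (j + 2) - a2 ^ (j + 2)) / fact (j + 2))"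

text \<open>Up to the factor k! these are the double Bernoulli numbers B_{2,k}(0|a1,a2), generated
  by X^2 / ((exp (a1 X) - 1) (exp (a2 X) - 1)).\<close>

definition em_coeff :: "complex \<Rightarrow> complex \<Rightarrow> nat \<Rightarrow> complex" where
  "em_coeff a1 a2 k = fps_nth (inverse (em_series a1 a2)) k"

definition diff2 :: "complex \<Rightarrow> complex \<Rightarrow> (complex \<Rightarrow> complex) \<Rightarrow> complex \<Rightarrow> complex" where
  "diff2 a1 a2 f u = f u - f (u + a1) - f (u + a2) + f (u + a1 + a2)"

text \<open>Collects the Taylor errors: the term of index k has already been differentiated k times,
  so its expansion stops at the power K + 3 - k of the step.\<close>

definition em_const :: "nat \<Rightarrow> complex \<Rightarrow> complex \<Rightarrow> real" where
  "em_const K a1 a2 = (\<Sum>k\<le>K. norm (em_coeff a1 a2 k) *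
     (norm a1 ^ (K + 3 - k) + norm a2 ^ (K + 3 - k) + norm (a1 + a2) ^ (K + 3 - k)))"

lemma em_series_0: "fps_nth (em_series a1 a2) 0 = a1 * a2"
  by (simp add: em_series_def power2_eq_square algebra_simps)

lemma em_coeff_convolution:
  assumes "a1 \<noteq> 0" "a2 \<noteq> 0"
  shows "(\<Sum>k\<le>m. em_coeff a1 a2 k * fps_nth (em_series a1 a2) (m - k)) = (if m = 0 then 1 else 0)"
proof -
  have "inverse (em_series a1 a2) * em_series a1 a2 = 1"
    using assms by (intro inverse_mult_eq_1) (simp add: em_series_0)
  hence "fps_nth (inverse (em_series a1 a2) * em_series a1 a2) m = fps_nth 1 m" by simp
  thus ?thesis by (simp add: fps_mult_nth em_coeff_def atLeast0AtMost)
qed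

lemma em_coeff_values:
  assumes "a1 \<noteq> 0" "a2 \<noteq> 0"
  shows "em_coeff a1 a2 0 = 1 / (a1 * a2)"
    and "em_coeff a1 a2 1 = - (a1 + a2) / (2 * a1 * a2)"
    and "em_coeff a1 a2 2 = (a1 / a2 + a2 / a1) / 12 + 1 / 4"
proof -
  have E: "fps_nth (em_series a1 a2) 1 = a1 * a2 * (a1 + a2) / 2"
    "fps_nth (em_series a1 a2) 2 = a1 * a2 * (2 * a1\<^sup>2 + 3 * a1 * a2 + 2 * a2\<^sup>2) / 12"
    by (simp_all add: em_series_def fact_numeral field_simps eval_nat_numeral)
  show c0: "em_coeff a1 a2 0 = 1 / (a1 * a2)"
    using em_coeff_convolution[OF assms, of 0] assms by (simp add: em_series_0 field_simps)
  show c1: "em_coeff a1 a2 1 = - (a1 + a2) / (2 * a1 * a2)"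
  proof -
    have "em_coeff a1 a2 1 * (a1 * a2) = - (a1 + a2) / 2"
    proof -
      have "1 / (a1 * a2) * (a1 * a2 * (a1 + a2) / 2) + em_coeff a1 a2 1 * (a1 * a2) = 0"
        using em_coeff_convolution[OF assms, of 1] by (simp add: em_series_0 flip: c0 E(1))
      hence "em_coeff a1 a2 1 * (a1 * a2) = - (1 / (a1 * a2) * (a1 * a2 * (a1 + a2) / 2))"
        by (simp only: add_eq_0_iff)
      also have "\<dots> = - (a1 + a2) / 2" using assms by (simp add: add_divide_distrib)
      finally show ?thesis .
    qed
    thus ?thesis using assms by (simp add: field_simps)
  qed
  have "em_coeff a1 a2 2 * (a1 * a2) =
     - (em_coeff a1 a2 0 * fps_nth (em_series a1 a2) 2 + em_coeff a1 a2 1 * fps_nth (em_series a1 a2) 1)"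
    using em_coeff_convolution[OF assms, of 2]
    by (simp add: em_series_0 eval_nat_numeral add_eq_0_iff2 algebra_simps)
  also have "\<dots> = ((a1 / a2 + a2 / a1) / 12 + 1 / 4) * (a1 * a2)"
    unfolding c0 c1 E using assms by (simp add: field_simps) (simp add: power2_eq_square algebra_simps)
  finally show "em_coeff a1 a2 2 = (a1 / a2 + a2 / a1) / 12 + 1 / 4"
    using assms by simp
qed

text \<open>The Taylor terms of degree 0 and 1 cancel in the mixed difference, so the expansion
  starts with the second derivative. Three one-variable remainders are left, estimated along
  segments that convexity keeps in T.\<close>

lemma diff2_taylor:
  fixes f :: "nat \<Rightarrow> complex \<Rightarrow> complex"
  assumes T: "convex T" "u \<in> T" "u + a1 \<in> T" "u + a2 \<in> T" "u + a1 + a2 \<in> T"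
    and f: "\<And>i v. v \<in> T \<Longrightarrow> i \<le> n + 2 \<Longrightarrow> (f i has_field_derivative f (Suc i) v) (at v within T)"
    and B: "\<And>v. v \<in> T \<Longrightarrow> norm (f (n + 3) v) \<le> B"
  shows "norm (diff2 a1 a2 (f 0) u - (\<Sum>j\<le>n. f (j + 2) u * fps_nth (em_series a1 a2) j))
    \<le> B * (norm a1 ^ (n + 3) + norm a2 ^ (n + 3) + norm (a1 + a2) ^ (n + 3))"
proof -
  define R where "R = (\<lambda>a. f 0 (u + a) - (\<Sum>i\<le>n + 2. f i u * a ^ i / fact i))"
  have R: "norm (R a) \<le> B * norm a ^ (n + 3)" if "u + a \<in> T" for a
  proof -
    have "norm (R a) \<le> B * norm a ^ Suc (n + 2) / fact (n + 2)"
      using complex_Taylor[of T "n + 2" f B u "u + a"] T(1,2) f B that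
      by (simp add: R_def eval_nat_numeral)
    also have "\<dots> \<le> B * norm a ^ Suc (n + 2) / 1"
      using order_trans[OF norm_ge_zero B[OF T(2)]] fact_ge_1[where 'a = real, of "n + 2"]
      by (intro divide_left_mono) auto
    finally show ?thesis by (simp add: eval_nat_numeral)
  qed
  have shift: "(\<Sum>i\<le>n + 2. g i) = g 0 + g 1 + (\<Sum>j\<le>n. g (j + 2))" for g :: "nat \<Rightarrow> complex"
    by (simp add: sum.atMost_Suc_shift eval_nat_numeral del: sum.atMost_Suc)
  have "diff2 a1 a2 (f 0) u - (\<Sum>j\<le>n. f (j + 2) u * fps_nth (em_series a1 a2) j)
      = R (a1 + a2) - R a1 - R a2"
    unfolding R_def shift diff2_def em_series_def
    by (simp add: sum.distrib sum_subtractf algebra_simps diff_divide_distrib add_divide_distrib)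
  also have "norm \<dots> \<le> norm (R (a1 + a2)) + norm (R a1) + norm (R a2)"
    by (metis (no_types, opaque_lifting) norm_triangle_ineq4 add_right_mono order_trans)
  also have "\<dots> \<le> B * (norm a1 ^ (n + 3) + norm a2 ^ (n + 3) + norm (a1 + a2) ^ (n + 3))"
    using R[of a1] R[of a2] R[of "a1 + a2"] T by (simp add: algebra_simps)
  finally show ?thesis .
qed

text \<open>Two-dimensional Euler--Maclaurin: the coefficients invert the symbol
  \<open>(1 - exp (a1 X)) * (1 - exp (a2 X)) / X\<^sup>2\<close> of the mixed difference operator.\<close>

lemma diff2_euler_maclaurin:
  fixes f :: "nat \<Rightarrow> complex \<Rightarrow> complex"
  assumes T: "convex T" "u \<in> T" "u + a1 \<in> T" "u + a2 \<in> T" "u + a1 + a2 \<in> T"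
    and a: "a1 \<noteq> 0" "a2 \<noteq> 0"
    and f: "\<And>k v. v \<in> T \<Longrightarrow> k \<le> K + 2 \<Longrightarrow> (f k has_field_derivative f (Suc k) v) (at v within T)"
    and B: "\<And>v. v \<in> T \<Longrightarrow> norm (f (K + 3) v) \<le> B"
  shows "norm ((\<Sum>k\<le>K. em_coeff a1 a2 k * diff2 a1 a2 (f k) u) - f 2 u) \<le> B * em_const K a1 a2"
proof -
  let ?c = "em_coeff a1 a2" and ?E = "fps_nth (em_series a1 a2)"
  define S where "S = (\<lambda>k. \<Sum>j\<le>K - k. f (k + j + 2) u * ?E j)"
  have "(\<Sum>k\<le>K. ?c k * S k) = (\<Sum>k\<le>K. \<Sum>j\<le>K - k. ?c k * f (k + j + 2) u * ?E j)"
    by (simp add: S_def sum_distrib_left mult.assoc)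
  also have "\<dots> = (\<Sum>(k, j)\<in>{(k, j). k + j \<le> K}. ?c k * f (k + j + 2) u * ?E j)"
    by (subst sum.Sigma) (auto intro!: sum.cong)
  \<comment> \<open>Grouping by total order m = k + j produces a Cauchy product of mutually inverse
    series, of which only m = 0 survives.\<close>
  also have "\<dots> = (\<Sum>m\<le>K. \<Sum>k\<le>m. ?c k * f (k + (m - k) + 2) u * ?E (m - k))"
    by (rule sum.triangle_reindex_eq)
  also have "\<dots> = (\<Sum>m\<le>K. f (m + 2) u * (\<Sum>k\<le>m. ?c k * ?E (m - k)))"
    by (intro sum.cong refl) (simp add: sum_distrib_left mult_ac)
  also have "\<dots> = f 2 u"
    unfolding em_coeff_convolution[OF a] by (simp add: if_distrib[of "(*) _"] sum.delta' numeral_2_eq_2 cong: if_cong)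
  finally have main: "(\<Sum>k\<le>K. ?c k * S k) = f 2 u" .
  have "norm (diff2 a1 a2 (f k) u - S k)
      \<le> B * (norm a1 ^ (K + 3 - k) + norm a2 ^ (K + 3 - k) + norm (a1 + a2) ^ (K + 3 - k))" if "k \<le> K" for k
    using diff2_taylor[OF T, of "K - k" "\<lambda>i. f (k + i)" B] f B that
    by (simp add: S_def add.assoc Suc_diff_le numeral_3_eq_3 eval_nat_numeral)
  hence "norm (\<Sum>k\<le>K. ?c k * (diff2 a1 a2 (f k) u - S k)) \<le> (\<Sum>k\<le>K. norm (?c k) *
     (B * (norm a1 ^ (K + 3 - k) + norm a2 ^ (K + 3 - k) + norm (a1 + a2) ^ (K + 3 - k))))"
    by (intro sum_norm_le) (auto simp: norm_mult intro!: mult_left_mono)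
  also have "\<dots> = B * em_const K a1 a2"
    by (simp add: em_const_def sum_distrib_left mult_ac)
  finally show ?thesis
    by (simp add: right_diff_distrib sum_subtractf main)
qed

section \<open>Sums over the lattice cone\<close>

text \<open>From (1 + m) (1 + n) <= (1 + m + n)^2 the sum is dominated by a product of two
  one-dimensional sums with exponent r / 2 > 1.\<close>

lemma summable_on_lattice_powr:
  fixes r :: real
  assumes "r > 2"
  shows "(\<lambda>(m, n). (1 + real m + real n) powr - r) summable_on (UNIV :: (nat \<times> nat) set)"
proof -
  define g where "g = (\<lambda>n. (1 + real n) powr - (r / 2))"
  have "summable (\<lambda>n. real (Suc n) powr - (r / 2))"
    using assms by (subst summable_Suc_iff) (simp add: summable_real_powr_iff)
  hence "summable g" by (simp add: g_def)
  hence g: "g summable_on UNIV"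
    by (intro summable_nonneg_imp_summable_on) (simp_all add: g_def)
  have "(\<lambda>(m, n). g m * g n) summable_on Sigma UNIV (\<lambda>_. UNIV)"
  proof (rule summable_on_SigmaI)
    show "((\<lambda>n. case (m, n) of (m, n) \<Rightarrow> g m * g n) has_sum g m * infsum g UNIV) UNIV" for m
      using g by (auto intro: has_sum_cmult_right has_sum_infsum)
    show "(\<lambda>m. g m * infsum g UNIV) summable_on UNIV"
      using g by (rule summable_on_cmult_left)
  qed (simp add: g_def)
  hence "(\<lambda>(m, n). g m * g n) summable_on UNIV" by simp
  thus ?thesis
  proof (rule summable_on_comparison_test)
    fix p :: "nat \<times> nat"
    obtain m n where p: "p = (m, n)" by (cases p)
    have "(1 + real m + real n) powr - r = ((1 + real m + real n) powr 2) powr - (r / 2)"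
      unfolding powr_powr by simp
    also have "\<dots> \<le> ((1 + real m) * (1 + real n)) powr - (r / 2)"
    proof (rule powr_mono2')
      show "(1 + real m) * (1 + real n) \<le> (1 + real m + real n) powr 2"
        by (simp add: power2_eq_square algebra_simps)
    qed (use assms in auto)
    also have "\<dots> = g m * g n" by (simp add: g_def powr_mult)
    finally show "(case p of (m, n) \<Rightarrow> (1 + real m + real n) powr - r) \<le> (case p of (m, n) \<Rightarrow> g m * g n)"
      by (simp add: p)
  qed auto
qed

text \<open>Every finite set of lattice points lies in a square, so an unconditional sum may be
  evaluated along squares, where mixed differences telescope.\<close>

lemma filterlim_squares: "filterlim (\<lambda>N. {..<N} \<times> {..<N}) (finite_subsets_at_top UNIV) sequentially"
  unfolding filterlim_finite_subsets_at_top
proof (intro allI impI)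
  fix X :: "(nat \<times> nat) set" assume "finite X \<and> X \<subseteq> UNIV"
  then obtain M where M: "\<forall>i\<in>fst ` X \<union> snd ` X. i < M"
    using finite_nat_bounded[of "fst ` X \<union> snd ` X"] by auto
  show "\<forall>\<^sub>F N in sequentially. finite ({..<N} \<times> {..<N}) \<and> X \<subseteq> {..<N} \<times> {..<N} \<and> {..<N} \<times> {..<N} \<subseteq> UNIV"
    using eventually_ge_at_top[of M]
  proof eventually_elim
    case (elim N)
    have "m < N \<and> n < N" if "(m, n) \<in> X" for m n
      using M elim imageI[OF that, of fst] imageI[OF that, of snd]
      by (metis UnI1 UnI2 fst_conv snd_conv order_less_le_trans)
    thus ?case by auto
  qed
qed

lemma sum_diff2_squares:
  "(\<Sum>(m, n)\<in>{..<N} \<times> {..<N}. diff2 a1 a2 P (x + of_nat m * a1 + of_nat n * a2)) =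
    P x - P (x + of_nat N * a1) - P (x + of_nat N * a2) + P (x + of_nat N * a1 + of_nat N * a2)"
proof -
  define A where "A = (\<lambda>m n. P (x + of_nat m * a1 + of_nat n * a2))"
  have "(\<Sum>n<N. diff2 a1 a2 P (x + of_nat m * a1 + of_nat n * a2)) =
      (A m 0 - A m N) - (A (Suc m) 0 - A (Suc m) N)" for m
  proof -
    have "diff2 a1 a2 P (x + of_nat m * a1 + of_nat n * a2) =
      (A m n - A m (Suc n)) - (A (Suc m) n - A (Suc m) (Suc n))" for n
      by (simp add: diff2_def A_def algebra_simps)
    thus ?thesis by (simp only: sum_subtractf[of "\<lambda>n. A m n - A m (Suc n)"] sum_lessThan_telescope')
  qed
  hence "(\<Sum>(m, n)\<in>{..<N} \<times> {..<N}. diff2 a1 a2 P (x + of_nat m * a1 + of_nat n * a2)) =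
     (\<Sum>m<N. (A m 0 - A m N) - (A (Suc m) 0 - A (Suc m) N))"
    by (simp flip: sum.cartesian_product)
  also have "\<dots> = (\<Sum>m<N. A m 0 - A (Suc m) 0) - (\<Sum>m<N. A m N - A (Suc m) N)"
    by (simp add: algebra_simps flip: sum_subtractf)
  also have "\<dots> = (A 0 0 - A N 0) - (A 0 N - A N N)"
    by (simp only: sum_lessThan_telescope'[of "\<lambda>m. A m 0"] sum_lessThan_telescope'[of "\<lambda>m. A m N"])
  finally show ?thesis by (simp add: A_def)
qed

text \<open>Of the four corners left by telescoping, three escape to infinity in the directions a1,
  a2 and a1 + a2; decay of P there leaves only the corner x.\<close>

lemma has_sum_diff2_lattice:
  assumes "(\<lambda>(m, n). diff2 a1 a2 P (x + of_nat m * a1 + of_nat n * a2)) summable_on UNIV"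
    and "(\<lambda>N. P (x + of_nat N * a1)) \<longlonglongrightarrow> 0" "(\<lambda>N. P (x + of_nat N * a2)) \<longlonglongrightarrow> 0"
    and "(\<lambda>N. P (x + of_nat N * a1 + of_nat N * a2)) \<longlonglongrightarrow> 0"
  shows "((\<lambda>(m, n). diff2 a1 a2 P (x + of_nat m * a1 + of_nat n * a2)) has_sum P x) UNIV"
proof -
  let ?f = "\<lambda>(m, n). diff2 a1 a2 P (x + of_nat m * a1 + of_nat n * a2)"
  have hs: "(?f has_sum infsum ?f UNIV) UNIV" using assms(1) by (rule has_sum_infsum)
  hence "(\<lambda>N. sum ?f ({..<N} \<times> {..<N})) \<longlonglongrightarrow> infsum ?f UNIV"
    unfolding has_sum_def by (rule filterlim_compose[OF _ filterlim_squares])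
  moreover have "(\<lambda>N. P x - P (x + of_nat N * a1) - P (x + of_nat N * a2)
      + P (x + of_nat N * a1 + of_nat N * a2)) \<longlonglongrightarrow> P x - 0 - 0 + 0"
    by (intro tendsto_intros assms)
  ultimately have "infsum ?f UNIV = P x"
    unfolding sum_diff2_squares using LIMSEQ_unique by fastforce
  with hs show ?thesis by simp
qed

section \<open>Holomorphic functions of two variables\<close>

text \<open>Along a complex line the limit is holomorphic, and its derivative there is the limit of
  linear maps in the direction; Cauchy's estimate makes the linearization error uniformly
  quadratic.\<close>

lemma holo2_on_uniform_limit:
  fixes f :: "'i \<Rightarrow> complex \<times> complex \<Rightarrow> complex"
  assumes F: "F \<noteq> bot"
    and loc: "\<And>p. p \<in> U \<Longrightarrow> \<exists>r>0. (\<forall>\<^sub>F n in F. holo2_on (f n) (ball p r)) \<and> uniform_limit (ball p r) f g F"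
  shows "holo2_on g U"
  unfolding holo2_on_def
proof
  fix p assume "p \<in> U"
  from loc[OF this] obtain r where r: "r > 0" "\<forall>\<^sub>F n in F. holo2_on (f n) (ball p r)"
    "uniform_limit (ball p r) f g F" by blast
  \<comment> \<open>\<open>l v\<close> parametrizes the complex line through p in direction
    v.\<close>
  define l where "l = (\<lambda>v s. p + (s * fst v, s * snd v) :: complex \<times> complex)"
  have norm_s: "norm (s * fst v, s * snd v) = norm s * norm v" for s and v :: "complex \<times> complex"
    by (simp add: norm_Pair norm_prod_def norm_mult power_mult_distrib real_sqrt_mult flip: distrib_left)
  have l_ball: "l v s \<in> ball p t" if "norm v = 1" "norm s < t" for v s t
  proof -
    have "dist p (l v s) = norm s * norm v" unfolding norm_s[symmetric] l_def by (simp add: dist_norm norm_Pair)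
    thus ?thesis using that by simp
  qed
  obtain N where N: "holo2_on (f N) (ball p r)" "\<And>q. q \<in> ball p r \<Longrightarrow> dist (f N q) (g q) < 1"
    using eventually_happens'[OF F eventually_conj[OF r(2) uniform_limitD[OF r(3), of 1]]] by auto
  have "isCont (f N) p"
    using holo2_on_continuous[OF N(1)] r(1) by (simp add: continuous_on_eq_continuous_at)
  \<comment> \<open>A single approximant \<open>f N\<close>, continuous at p and within distance 1
    of g, bounds g near p; this bound feeds Cauchy's inequality.\<close>
  then obtain d where d: "d > 0" "\<And>q. dist q p < d \<Longrightarrow> dist (f N q) (f N p) < 1"
    unfolding continuous_at_eps_delta by (metis zero_less_one)
  define t where "t = min r d"
  have t: "t > 0" "t \<le> r" "t \<le> d" using r(1) d(1) by (auto simp: t_def)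
  define B where "B = norm (f N p) + 2"
  have B: "norm (g q) \<le> B" if "q \<in> ball p t" for q
  proof -
    have "dist (f N q) (g q) < 1" "dist (f N q) (f N p) < 1"
      using N(2)[of q] d(2)[of q] that t by (auto simp: dist_commute)
    moreover have "norm (g q) \<le> norm (f N p) + dist (f N q) (g q) + dist (f N q) (f N p)"
      by norm
    ultimately show ?thesis by (simp add: B_def)
  qed
  have "\<forall>\<^sub>F n in F. \<forall>q\<in>ball p r. \<exists>a b. (f n has_derivative (\<lambda>(h, k). a * h + b * k)) (at q)"
    using r(2) by (simp add: holo2_on_def)
  \<comment> \<open>Choosing the coefficients by \<open>SOME\<close> makes the partial derivatives
    functions of n and q, so that their limits can be taken.\<close>
  hence ev: "\<forall>\<^sub>F n in F. \<forall>q\<in>ball p r. (f n has_derivative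
     (\<lambda>(h, k). fst (SOME ab. (f n has_derivative (\<lambda>(h, k). fst ab * h + snd ab * k)) (at q)) * h
       + snd (SOME ab. (f n has_derivative (\<lambda>(h, k). fst ab * h + snd ab * k)) (at q)) * k)) (at q)"
  proof eventually_elim
    case (elim n)
    show ?case
    proof
      fix q assume "q \<in> ball p r"
      with elim obtain a b where "(f n has_derivative (\<lambda>(h, k). a * h + b * k)) (at q)" by blast
      thus "(f n has_derivative
         (\<lambda>(h, k). fst (SOME ab. (f n has_derivative (\<lambda>(h, k). fst ab * h + snd ab * k)) (at q)) * h
           + snd (SOME ab. (f n has_derivative (\<lambda>(h, k). fst ab * h + snd ab * k)) (at q)) * k)) (at q)"
        by (intro someI[of "\<lambda>ab. (f n has_derivative (\<lambda>(h, k). fst ab * h + snd ab * k)) (at q)" "(a, b)"]) simp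
    qed
  qed
  then obtain a b where ab: "\<forall>\<^sub>F n in F. \<forall>q\<in>ball p r. (f n has_derivative (\<lambda>(h, k). a n q * h + b n q * k)) (at q)"
    by (rule that)
  have slice: "\<exists>G. (\<forall>s\<in>ball 0 (t / 2). ((\<lambda>s. g (l v s)) has_field_derivative G s) (at s)) \<and>
      ((\<lambda>n. a n p * fst v + b n p * snd v) \<longlongrightarrow> G 0) F" if v: "norm v = 1" for v
  proof -
    have dl: "(l v has_derivative (\<lambda>s. (s * fst v, s * snd v))) (at s)" for s
      unfolding l_def by (auto intro!: derivative_eq_intros)
    have ev2: "\<forall>\<^sub>F n in F. continuous_on (cball 0 (t / 2)) (\<lambda>s. f n (l v s)) \<and>
        (\<forall>s\<in>ball 0 (t / 2). ((\<lambda>s. f n (l v s)) has_field_derivative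
           (a n (l v s) * fst v + b n (l v s) * snd v)) (at s))"
      using ab
    proof eventually_elim
      case (elim n)
      have *: "((\<lambda>s. f n (l v s)) has_field_derivative (a n (l v s) * fst v + b n (l v s) * snd v)) (at s)"
        if "norm s < r" for s
      proof -
        have "(f n has_derivative (\<lambda>(h, k). a n (l v s) * h + b n (l v s) * k)) (at (l v s))"
          using elim l_ball[OF v that] by blast
        from has_derivative_compose[OF dl this] show ?thesis
          unfolding has_field_derivative_def by (rule has_derivative_eq_rhs) (auto simp: algebra_simps)
      qed
      show ?case
        using * t by (auto intro!: continuous_at_imp_continuous_on DERIV_isCont[OF *])
    qed
    have ul: "uniform_limit (cball 0 (t / 2)) (\<lambda>n s. f n (l v s)) (\<lambda>s. g (l v s)) F"
    proof (rule uniform_limitI)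
      fix e :: real assume "e > 0"
      from uniform_limitD[OF r(3) this] show "\<forall>\<^sub>F n in F. \<forall>s\<in>cball 0 (t / 2). dist (f n (l v s)) (g (l v s)) < e"
        by eventually_elim (use l_ball[OF v, of _ r] t in auto)
    qed
    obtain G where G: "\<And>s. s \<in> ball 0 (t / 2) \<Longrightarrow> ((\<lambda>s. g (l v s)) has_field_derivative G s) (at s) \<and>
        ((\<lambda>n. a n (l v s) * fst v + b n (l v s) * snd v) \<longlongrightarrow> G s) F"
      using has_complex_derivative_uniform_limit[OF ev2 ul F] t by auto
    moreover have "l v 0 = p" by (simp add: l_def flip: zero_prod_def)
    ultimately show ?thesis using t by (intro exI[of _ G]) (force dest: G[of 0])
  qed
  obtain A where A: "((\<lambda>n. a n p) \<longlongrightarrow> A) F"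
    using slice[of "(1, 0)"] by auto
  obtain A' where A': "((\<lambda>n. b n p) \<longlongrightarrow> A') F"
    using slice[of "(0, 1)"] by auto
  \<comment> \<open>Cauchy's estimate for second derivatives on circles of radius t / 8; it is the
    same for all directions v.\<close>
  define C where "C = fact 2 * B / (t / 8) ^ 2"
  have est: "norm (g q - g p - (A * fst (q - p) + A' * snd (q - p))) \<le> C * norm (q - p) ^ 2"
    if q: "norm (q - p) < t / 8" for q
  proof (cases "q = p")
    case False
    define s where "s = norm (q - p)"
    define v where "v = (q - p) /\<^sub>R s"
    have s: "0 < s" "s < t / 8" using False q by (auto simp: s_def)
    have v: "norm v = 1" using s by (simp add: v_def s_def)
    obtain G where G: "\<forall>s\<in>ball 0 (t / 2). ((\<lambda>s. g (l v s)) has_field_derivative G s) (at s)"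
      "((\<lambda>n. a n p * fst v + b n p * snd v) \<longlongrightarrow> G 0) F" using slice[OF v] by auto
    have "((\<lambda>n. a n p * fst v + b n p * snd v) \<longlongrightarrow> A * fst v + A' * snd v) F"
      by (intro tendsto_intros A A')
    \<comment> \<open>Uniqueness of limits makes the directional derivative linear in v, with the
      same A and A' for every direction.\<close>
    hence G0: "G 0 = A * fst v + A' * snd v" using tendsto_unique F G(2) by blast
    define h where "h = (\<lambda>s. g (l v s))"
    have hol: "h holomorphic_on ball 0 (t / 2)"
      using G(1) by (auto simp: h_def holomorphic_on_open field_differentiable_def)
    have l0: "l v 0 = p" by (simp add: l_def flip: zero_prod_def)
    have ls: "l v s = q" using s by (simp add: l_def v_def prod_eq_iff scaleR_conv_of_real flip: mult.assoc)
    have "norm ((deriv ^^ 0) h s - (\<Sum>i\<le>1. (deriv ^^ i) h 0 * (complex_of_real s - 0) ^ i / fact i))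
        \<le> C * norm (complex_of_real s - 0) ^ Suc 1 / fact 1"
    proof (rule complex_Taylor[of "cball 0 (t / 8)"])
      show "((deriv ^^ i) h has_field_derivative (deriv ^^ Suc i) h x) (at x within cball 0 (t / 8))"
        if "x \<in> cball 0 (t / 8)" for i x
      proof -
        have "(deriv ^^ i) h holomorphic_on ball 0 (t / 2)" by (intro holomorphic_higher_deriv hol) auto
        hence "((deriv ^^ i) h has_field_derivative deriv ((deriv ^^ i) h) x) (at x)"
          using that t by (intro holomorphic_derivI) auto
        thus ?thesis by (simp add: has_field_derivative_at_within)
      qed
      show "norm ((deriv ^^ Suc 1) h x) \<le> C" if x: "x \<in> cball 0 (t / 8)" for x
      proof -
        have sub: "cball x (t / 8) \<subseteq> ball 0 (t / 2)"
        proof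
          fix y assume "y \<in> cball x (t / 8)"
          hence "norm y \<le> t / 8 + t / 8" using x by (simp add: dist_norm) norm
          thus "y \<in> ball 0 (t / 2)" using t by simp
        qed
        have "norm ((deriv ^^ 2) h x) \<le> fact 2 * B / (t / 8) ^ 2"
        proof (rule Cauchy_inequality)
          show "h holomorphic_on ball x (t / 8)" "continuous_on (cball x (t / 8)) h"
            by (rule holomorphic_on_subset[OF hol order_trans[OF ball_subset_cball sub]])
               (rule continuous_on_subset[OF holomorphic_on_imp_continuous_on[OF hol] sub])
          show "norm (h y) \<le> B" if "norm (x - y) = t / 8" for y
          proof -
            have "y \<in> ball 0 (t / 2)" using sub that by (auto simp: dist_norm)
            thus ?thesis unfolding h_def using l_ball[OF v, of y t] t by (intro B) auto
          qed
        qed (use t in auto)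
        thus ?thesis by (simp add: C_def eval_nat_numeral)
      qed
    qed (use s in auto)
    moreover have "deriv h 0 = G 0" using G(1) t by (intro DERIV_imp_deriv) (auto simp: h_def)
    ultimately have "norm (h s - h 0 - s * G 0) \<le> C * s\<^sup>2"
      using s by (simp add: power2_eq_square algebra_simps)
    moreover have "s * G 0 = A * fst (q - p) + A' * snd (q - p)"
      using s by (simp add: G0 v_def scaleR_conv_of_real field_simps)
    ultimately show ?thesis by (simp add: h_def l0 ls flip: s_def)
  qed simp
  have "(g has_derivative (\<lambda>(h, k). A * h + A' * k)) (at p)"
    unfolding has_derivative_at_alt
  proof (intro conjI allI impI)
    show "bounded_linear (\<lambda>(h, k). A * h + A' * k)"
      unfolding case_prod_unfold by (intro bounded_linear_intros)
    fix e :: real assume e: "e > 0"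
    have C: "C \<ge> 0" using order_trans[OF norm_ge_zero B[of p]] t by (auto simp: C_def)
    define d where "d = min (t / 8) (e / (C + 1))"
    show "\<exists>d>0. \<forall>q. norm (q - p) < d \<longrightarrow>
        norm (g q - g p - (case q - p of (h, k) \<Rightarrow> A * h + A' * k)) \<le> e * norm (q - p)"
    proof (intro exI[of _ d] conjI allI impI)
      show "d > 0" using t e C by (simp add: d_def)
      fix q assume q: "norm (q - p) < d"
      have "norm (g q - g p - (A * fst (q - p) + A' * snd (q - p))) \<le> C * norm (q - p) ^ 2"
        using q by (intro est) (simp add: d_def)
      also have "\<dots> = (C * norm (q - p)) * norm (q - p)" by (simp add: power2_eq_square)
      also have "C * norm (q - p) \<le> (C + 1) * (e / (C + 1))"
        using q C by (intro mult_mono) (auto simp: d_def)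
      also have "\<dots> = e" using C by simp
      finally show "norm (g q - g p - (case q - p of (h, k) \<Rightarrow> A * h + A' * k)) \<le> e * norm (q - p)"
        by (simp add: case_prod_unfold mult_right_mono)
    qed
  qed
  thus "\<exists>a b. (g has_derivative (\<lambda>(h, k). a * h + b * k)) (at p)" by blast
qed

section \<open>Continuation of the double zeta function\<close>

definition lattice_point :: "complex \<Rightarrow> complex \<Rightarrow> complex \<Rightarrow> nat \<times> nat \<Rightarrow> complex" where
  "lattice_point x a1 a2 = (\<lambda>(m, n). x + of_nat m * a1 + of_nat n * a2)"

text \<open>The k-th derivative of u^(2 - s). Starting two integrations above u^(-s) makes the
  summand, up to (2 - s) (1 - s), the second derivative that Euler-Maclaurin produces.\<close>

definition powr_tower :: "complex \<Rightarrow> nat \<Rightarrow> complex \<Rightarrow> complex" where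
  "powr_tower s k u = (\<Prod>j<k. 2 - s - of_nat j) * u powr (2 - s - of_nat k)"

definition zeta_rem :: "nat \<Rightarrow> complex \<Rightarrow> complex \<Rightarrow> complex \<Rightarrow> complex \<Rightarrow> complex" where
  "zeta_rem K a1 a2 s u = (\<Sum>k\<le>K. em_coeff a1 a2 k * diff2 a1 a2 (powr_tower s k) u) - powr_tower s 2 u"

text \<open>Represents (2 - s) (1 - s) times the double zeta function, so the poles at 1 and 2 are
  cleared. Its half-plane Re s > 1 - K grows with the truncation order.\<close>

definition zeta_ext :: "nat \<Rightarrow> complex \<Rightarrow> complex \<Rightarrow> complex \<Rightarrow> complex \<Rightarrow> complex" where
  "zeta_ext K x a1 a2 s = (\<Sum>k\<le>K. em_coeff a1 a2 k * powr_tower s k x) -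
     (\<Sum>\<^sub>\<infinity>p. zeta_rem K a1 a2 s (lattice_point x a1 a2 p))"

lemma notin_nonpos_Reals_Re: "Re z > 0 \<Longrightarrow> z \<notin> \<real>\<^sub>\<le>\<^sub>0"
  using complex_nonpos_Reals_iff by auto

lemma powr_tower_deriv:
  assumes "u \<notin> \<real>\<^sub>\<le>\<^sub>0"
  shows "(powr_tower s k has_field_derivative powr_tower s (Suc k) u) (at u)"
  unfolding powr_tower_def
  by (rule derivative_eq_intros has_field_derivative_powr assms refl)+ (simp add: algebra_simps)

lemma powr_tower_2: "powr_tower s 2 u = (2 - s) * (1 - s) * u powr (- s)"
  by (simp add: powr_tower_def eval_nat_numeral)

text \<open>The argument of u is at most pi in absolute value, which bounds the effect of the
  imaginary part of the exponent uniformly in u.\<close>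

lemma norm_powr_bound:
  assumes "r > 0" "Re u \<ge> r" "Re e \<le> 0"
  shows "norm (u powr e) \<le> exp (pi * \<bar>Im e\<bar>) * r powr Re e"
proof -
  have "\<bar>Arg u\<bar> \<le> pi" using mpi_less_Arg[of u] Arg_le_pi[of u] by linarith
  hence "\<bar>Im e * Arg u\<bar> \<le> \<bar>Im e\<bar> * pi" by (simp add: abs_mult mult_left_mono)
  hence "- Im e * Arg u \<le> \<bar>Im e\<bar> * pi" by linarith
  moreover have "norm u powr Re e \<le> r powr Re e"
    using assms complex_Re_le_cmod[of u] by (intro powr_mono2') auto
  ultimately show ?thesis
    by (simp add: norm_powr_complex mult.commute mult_mono)
qed

lemma norm_powr_tower:
  assumes "r > 0" "Re u \<ge> r" "2 - Re s - real k \<le> 0"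
  shows "norm (powr_tower s k u) \<le>
    norm (\<Prod>j<k. 2 - s - of_nat j) * exp (pi * \<bar>Im s\<bar>) * r powr (2 - Re s - real k)"
  using norm_powr_bound[OF assms(1,2), of "2 - s - of_nat k"] assms(3)
  unfolding powr_tower_def norm_mult mult.assoc by (intro mult_left_mono) auto

lemma powr_tower_holomorphic: "u \<noteq> 0 \<Longrightarrow> (\<lambda>s. powr_tower s k u) holomorphic_on A"
  unfolding powr_tower_def by (intro holomorphic_intros)

section \<open>The Euler-Maclaurin remainder of a power in the right half-plane\<close>

context
  fixes a1 a2 :: complex
  assumes a1: "Re a1 > 0" and a2: "Re a2 > 0"
begin

text \<open>The half-plane Re v >= r is convex and stable under adding a1 and a2; derivative K + 3
  of u^(2 - s) has exponent -(1 + K + s), and this sets the decay.\<close>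

lemma zeta_rem_bound:
  assumes "r > 0" "Re u \<ge> r" "1 + real K + Re s \<ge> 0"
  shows "norm (zeta_rem K a1 a2 s u) \<le>
    norm (\<Prod>j<K + 3. 2 - s - of_nat j) * exp (pi * \<bar>Im s\<bar>) * em_const K a1 a2 * r powr - (1 + real K + Re s)"
proof -
  let ?T = "{v. Re v \<ge> r}"
  have T: "convex ?T" by (rule convex_halfspace_Re_ge)
  have "norm ((\<Sum>k\<le>K. em_coeff a1 a2 k * diff2 a1 a2 (powr_tower s k) u) - powr_tower s 2 u) \<le>
     (norm (\<Prod>j<K + 3. 2 - s - of_nat j) * exp (pi * \<bar>Im s\<bar>) * r powr (2 - Re s - real (K + 3))) * em_const K a1 a2"
  proof (rule diff2_euler_maclaurin[OF T])
    show "norm (powr_tower s (K + 3) v) \<le>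
       norm (\<Prod>j<K + 3. 2 - s - of_nat j) * exp (pi * \<bar>Im s\<bar>) * r powr (2 - Re s - real (K + 3))"
      if "v \<in> ?T" for v using that assms by (intro norm_powr_tower) auto
    show "(powr_tower s k has_field_derivative powr_tower s (Suc k) v) (at v within ?T)" if "v \<in> ?T" for k v
      using that assms
      by (intro has_field_derivative_at_within[OF powr_tower_deriv] notin_nonpos_Reals_Re) auto
  qed (use assms a1 a2 in auto)
  also have "2 - Re s - real (K + 3) = - (1 + real K + Re s)" by simp
  finally show ?thesis by (simp add: zeta_rem_def mult_ac)
qed

lemma zeta_rem_holomorphic:
  assumes "Re u > 0" shows "(\<lambda>s. zeta_rem K a1 a2 s u) holomorphic_on A"
proof -
  have "u \<noteq> 0" "u + a1 \<noteq> 0" "u + a2 \<noteq> 0" "u + a1 + a2 \<noteq> 0"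
    using assms a1 a2 by (auto simp: complex_eq_iff)
  thus ?thesis unfolding zeta_rem_def diff2_def
    by (intro holomorphic_intros powr_tower_holomorphic)
qed

end

section \<open>Summing the remainders over the lattice cone\<close>

context
  fixes x a1 a2 :: complex
  assumes x: "Re x > 0" and a1: "Re a1 > 0" and a2: "Re a2 > 0"
begin

text \<open>A common lower bound for the real parts of x, a1 and a2 gives linear growth along the
  cone; the cap 1 makes its powers antitone in the exponent.\<close>

definition lattice_gap :: real where "lattice_gap = min 1 (min (Re x) (min (Re a1) (Re a2)))"

lemma lattice_gap: "0 < lattice_gap" "lattice_gap \<le> 1"
  using x a1 a2 by (auto simp: lattice_gap_def)

lemma Re_lattice_point:
  "Re (lattice_point x a1 a2 (m, n)) \<ge> lattice_gap * (1 + real m + real n)"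
proof -
  have "lattice_gap * 1 \<le> Re x" "real m * lattice_gap \<le> real m * Re a1"
    "real n * lattice_gap \<le> real n * Re a2"
    by (auto simp: lattice_gap_def intro!: mult_left_mono)
  thus ?thesis by (simp add: lattice_point_def algebra_simps)
qed

lemma zeta_rem_uniform_bound:
  assumes "cball s0 d \<subseteq> {s. Re s > 1 - real K}" "d \<ge> 0"
  obtains M where "M summable_on (UNIV :: (nat \<times> nat) set)"
    "\<And>p s. s \<in> cball s0 d \<Longrightarrow> norm (zeta_rem K a1 a2 s (lattice_point x a1 a2 p)) \<le> M p"
proof -
  define e where "e = (\<lambda>s. 1 + real K + Re s)"
  define D where "D = (\<lambda>s. norm (\<Prod>j<K + 3. 2 - s - of_nat j) * exp (pi * \<bar>Im s\<bar>) * em_const K a1 a2)"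
  have "continuous_on (cball s0 d) D" unfolding D_def by (intro continuous_intros)
  hence "compact (D ` cball s0 d)" by (intro compact_continuous_image compact_cball)
  hence "bounded (D ` cball s0 d)" by (rule compact_imp_bounded)
  then obtain B where B: "\<And>s. s \<in> cball s0 d \<Longrightarrow> norm (D s) \<le> B"
    unfolding bounded_iff by blast
  \<comment> \<open>\<open>e0\<close> and \<open>e1\<close> are the extreme values of 1 + K + Re s
    on the disc: the smaller one controls decay in the lattice, the larger one the power of
    \<open>lattice_gap\<close>.\<close>
  define e0 where "e0 = 1 + real K + Re s0 - d"
  define e1 where "e1 = 1 + real K + Re s0 + d"
  have "s0 - of_real d \<in> cball s0 d" using assms(2) by (simp add: dist_norm)
  hence "s0 - of_real d \<in> {s. Re s > 1 - real K}" using assms(1) by blast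
  hence e0: "e0 > 2" by (simp add: e0_def)
  have e: "e0 \<le> e s" "e s \<le> e1" if "s \<in> cball s0 d" for s
    using that abs_Re_le_cmod[of "s0 - s"] by (auto simp: e_def e0_def e1_def dist_norm)
  define g where "g = (\<lambda>(m, n). (1 + real m + real n) powr - e0)"
  have g: "g summable_on UNIV"
    unfolding g_def by (rule summable_on_lattice_powr[OF e0])
  show thesis
  proof (rule that[of "\<lambda>p. (B * lattice_gap powr - e1) * g p"])
    show "(\<lambda>p. (B * lattice_gap powr - e1) * g p) summable_on UNIV" using g by (rule summable_on_cmult_right)
    fix p :: "nat \<times> nat" and s assume s: "s \<in> cball s0 d"
    obtain m n where p: "p = (m, n)" by (cases p)
    have N: "1 + real m + real n \<ge> 1" by simp
    have "norm (zeta_rem K a1 a2 s (lattice_point x a1 a2 p)) \<le> D s * (lattice_gap * (1 + real m + real n)) powr - e s"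
      unfolding D_def e_def p using Re_lattice_point lattice_gap(1) N e[OF s] e0
      by (intro zeta_rem_bound a1 a2) (auto simp: e_def)
    also have "\<dots> = D s * (lattice_gap powr - e s * (1 + real m + real n) powr - e s)"
      using lattice_gap(1) by (simp add: powr_mult)
    also have "\<dots> \<le> B * (lattice_gap powr - e1 * (1 + real m + real n) powr - e0)"
      using B[OF s] lattice_gap N e[OF s]
      by (intro mult_mono powr_mono powr_mono') (auto intro: order_trans[OF norm_ge_zero])
    finally show "norm (zeta_rem K a1 a2 s (lattice_point x a1 a2 p)) \<le> (B * lattice_gap powr - e1) * g p"
      by (simp add: p g_def mult_ac)
  qed
qed

lemma zeta_rem_uniform_limit:
  assumes "cball s0 d \<subseteq> {s. Re s > 1 - real K}" "d \<ge> 0"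
  shows "uniform_limit (cball s0 d) (\<lambda>X s. \<Sum>p\<in>X. zeta_rem K a1 a2 s (lattice_point x a1 a2 p))
    (\<lambda>s. \<Sum>\<^sub>\<infinity>p. zeta_rem K a1 a2 s (lattice_point x a1 a2 p)) (finite_subsets_at_top UNIV)"
proof -
  obtain M where M: "M summable_on (UNIV :: (nat \<times> nat) set)"
    "\<And>p s. s \<in> cball s0 d \<Longrightarrow> norm (zeta_rem K a1 a2 s (lattice_point x a1 a2 p)) \<le> M p"
    using zeta_rem_uniform_bound[OF assms] by metis
  show ?thesis by (rule Weierstrass_m_test_general[OF _ M(1)]) (use M(2) in auto)
qed

lemma zeta_rem_summable:
  assumes "Re s > 1 - real K"
  shows "(\<lambda>p. zeta_rem K a1 a2 s (lattice_point x a1 a2 p)) summable_on UNIV"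
proof -
  have "cball s 0 \<subseteq> {s. Re s > 1 - real K}" using assms by simp
  then obtain M where M: "M summable_on (UNIV :: (nat \<times> nat) set)"
    "\<And>p t. t \<in> cball s 0 \<Longrightarrow> norm (zeta_rem K a1 a2 t (lattice_point x a1 a2 p)) \<le> M p"
    using zeta_rem_uniform_bound[of s 0 K] by (metis order_refl)
  show ?thesis
    by (rule abs_summable_summable[OF summable_on_comparison_test[OF M(1)]]) (use M(2)[of s] in auto)
qed

lemma Re_lattice_point_pos: "Re (lattice_point x a1 a2 p) > 0"
proof (cases p)
  case (Pair m n)
  have "0 < lattice_gap * (1 + real m + real n)" using lattice_gap(1) by (intro mult_pos_pos) auto
  thus ?thesis unfolding Pair using Re_lattice_point[of m n] by linarith
qed

lemma zeta_ext_holomorphic: "zeta_ext K x a1 a2 holomorphic_on {s. Re s > 1 - real K}"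
proof -
  let ?S = "{s. Re s > 1 - real K}"
  let ?g = "\<lambda>s. \<Sum>\<^sub>\<infinity>p. zeta_rem K a1 a2 s (lattice_point x a1 a2 p)"
  have op: "open ?S" by (rule open_halfspace_Re_gt)
  have "?g field_differentiable (at s)" if s: "s \<in> ?S" for s
  proof -
    obtain d where d: "d > 0" "cball s d \<subseteq> ?S" using op s open_contains_cball by blast
    have "?g holomorphic_on ball s d"
    proof (rule holomorphic_uniform_limit)
      show "uniform_limit (cball s d) (\<lambda>X s. \<Sum>p\<in>X. zeta_rem K a1 a2 s (lattice_point x a1 a2 p)) ?g
         (finite_subsets_at_top UNIV)" using d by (intro zeta_rem_uniform_limit) auto
      show "\<forall>\<^sub>F X in finite_subsets_at_top UNIV.
          continuous_on (cball s d) (\<lambda>s. \<Sum>p\<in>X. zeta_rem K a1 a2 s (lattice_point x a1 a2 p)) \<and>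
          (\<lambda>s. \<Sum>p\<in>X. zeta_rem K a1 a2 s (lattice_point x a1 a2 p)) holomorphic_on ball s d"
        by (intro always_eventually allI conjI holomorphic_on_imp_continuous_on holomorphic_intros
            zeta_rem_holomorphic[OF a1 a2] Re_lattice_point_pos)
    qed auto
    thus ?thesis using d(1) by (auto simp: holomorphic_on_def at_within_ball)
  qed
  hence "?g holomorphic_on ?S"
    by (auto simp: holomorphic_on_def intro: field_differentiable_at_within)
  moreover have "x \<noteq> 0" using x by auto
  ultimately show ?thesis unfolding zeta_ext_def[abs_def]
    by (intro holomorphic_intros powr_tower_holomorphic)
qed

text \<open>The Euler-Maclaurin sum P has the remainder plus the summand as its mixed difference,
  and for Re s > 2 all its powers decay at infinity; summation over the cone thus telescopes to P
  x.\<close>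

lemma zeta_ext_eq:
  assumes s: "Re s > 2"
  shows "zeta_ext K x a1 a2 s = (2 - s) * (1 - s) * (\<Sum>\<^sub>\<infinity>p. lattice_point x a1 a2 p powr - s)"
proof -
  define P where "P = (\<lambda>u. \<Sum>k\<le>K. em_coeff a1 a2 k * powr_tower s k u)"
  let ?lp = "lattice_point x a1 a2"
  have sp: "(\<lambda>p. ?lp p powr - s) summable_on UNIV"
  proof (rule abs_summable_summable, rule summable_on_comparison_test)
    show "(\<lambda>p. exp (pi * \<bar>Im s\<bar>) * lattice_gap powr - Re s * (case p of (m, n) \<Rightarrow> (1 + real m + real n) powr - Re s))
       summable_on (UNIV :: (nat \<times> nat) set)"
      by (intro summable_on_cmult_right summable_on_lattice_powr s)
    fix p :: "nat \<times> nat"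
    obtain m n where p: "p = (m, n)" by (cases p)
    have "norm (?lp p powr - s) \<le> exp (pi * \<bar>Im (- s)\<bar>) * (lattice_gap * (1 + real m + real n)) powr Re (- s)"
      unfolding p using Re_lattice_point lattice_gap(1) s by (intro norm_powr_bound) auto
    also have "\<dots> = exp (pi * \<bar>Im s\<bar>) * lattice_gap powr - Re s * (case p of (m, n) \<Rightarrow> (1 + real m + real n) powr - Re s)"
      using lattice_gap(1) by (simp add: p powr_mult)
    finally show "norm (?lp p powr - s) \<le> \<dots>" .
  qed auto
  have zs: "(\<lambda>p. zeta_rem K a1 a2 s (?lp p)) summable_on UNIV"
    using s by (intro zeta_rem_summable) auto
  have dP: "diff2 a1 a2 P u = zeta_rem K a1 a2 s u + (2 - s) * (1 - s) * u powr - s" for u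
    by (simp add: P_def zeta_rem_def diff2_def powr_tower_2 algebra_simps sum.distrib sum_subtractf)
  have hs: "((\<lambda>p. diff2 a1 a2 P (?lp p)) has_sum
     ((\<Sum>\<^sub>\<infinity>p. zeta_rem K a1 a2 s (?lp p)) + (2 - s) * (1 - s) * (\<Sum>\<^sub>\<infinity>p. ?lp p powr - s))) UNIV"
    unfolding dP by (intro has_sum_add has_sum_cmult_right has_sum_infsum zs sp)
  have lim: "(\<lambda>N. P (x + of_nat N * b)) \<longlonglongrightarrow> 0" if b: "Re b > 0" for b
  proof -
    have "(\<lambda>N. powr_tower s k (x + of_nat N * b)) \<longlonglongrightarrow> 0" for k
    proof (rule Lim_null_comparison)
      have "filterlim (\<lambda>N. Re x + real N * Re b) at_top sequentially"
        using b by real_asymp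
      hence "((\<lambda>N. (Re x + real N * Re b) powr (2 - Re s - real k)) \<longlongrightarrow> 0) sequentially"
        using s by (intro tendsto_neg_powr) auto
      thus "(\<lambda>N. norm (\<Prod>j<k. 2 - s - of_nat j) * exp (pi * \<bar>Im s\<bar>) * (Re x + real N * Re b) powr (2 - Re s - real k)) \<longlonglongrightarrow> 0"
        by (rule tendsto_mult_right_zero)
      show "\<forall>\<^sub>F N in sequentially. norm (powr_tower s k (x + of_nat N * b)) \<le>
         norm (\<Prod>j<k. 2 - s - of_nat j) * exp (pi * \<bar>Im s\<bar>) * (Re x + real N * Re b) powr (2 - Re s - real k)"
        using x b s by (intro always_eventually allI norm_powr_tower) (auto intro: add_pos_nonneg)
    qed
    hence "(\<lambda>N. P (x + of_nat N * b)) \<longlonglongrightarrow> (\<Sum>k\<le>K. em_coeff a1 a2 k * 0)"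
      unfolding P_def by (intro tendsto_intros)
    thus ?thesis by simp
  qed
  have "((\<lambda>p. diff2 a1 a2 P (?lp p)) has_sum P x) UNIV"
    using has_sum_diff2_lattice[of a1 a2 P x] lim[OF a1] lim[OF a2] lim[of "a1 + a2"] a1 a2
      has_sum_imp_summable[OF hs] by (simp add: lattice_point_def case_prod_unfold algebra_simps)
  with hs have "P x = (\<Sum>\<^sub>\<infinity>p. zeta_rem K a1 a2 s (?lp p)) + (2 - s) * (1 - s) * (\<Sum>\<^sub>\<infinity>p. ?lp p powr - s)"
    using has_sum_unique by blast
  thus ?thesis by (simp add: zeta_ext_def P_def)
qed

text \<open>Both truncations equal the same convergent series for Re s > 2; the identity theorem
  does the rest.\<close>

lemma zeta_ext_agree:
  assumes "Re s > 1 - real K" "Re s > 1 - real K'"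
  shows "zeta_ext K x a1 a2 s = zeta_ext K' x a1 a2 s"
proof -
  let ?S = "{s. Re s > max (1 - real K) (1 - real K')}" and ?W = "{s. Re s > 2}"
  have 1: "zeta_ext K x a1 a2 holomorphic_on ?S" "zeta_ext K' x a1 a2 holomorphic_on ?S"
    by (rule holomorphic_on_subset[OF zeta_ext_holomorphic]; auto)+
  have "3 \<in> ?W" by simp
  hence ne: "?W \<noteq> {}" by blast
  have sub: "?W \<subseteq> ?S" by auto
  show ?thesis
  proof (rule analytic_continuation_open[OF _ _ ne _ sub 1])
    show "connected ?S" by (intro convex_connected convex_halfspace_Re_gt)
  qed (use assms in \<open>auto simp: zeta_ext_eq open_halfspace_Re_gt simp del: max_less_iff_conj\<close>)
qed

end

text \<open>The identity theorem gives equality on punctured neighbourhoods; the normalization then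
  fixes the value at the centre, 0 at a pole and the limit elsewhere. This evaluates the definite
  descriptions in \<open>zeta2\<close> and \<open>Gamma2_rhp\<close>.\<close>

lemma nicely_meromorphic_unique:
  assumes f: "f nicely_meromorphic_on UNIV" and g: "g nicely_meromorphic_on UNIV"
    and W: "open W" "W \<noteq> {}" "\<And>z. z \<in> W \<Longrightarrow> f z = g z"
  shows "f = g"
proof
  fix z
  define h where "h = remove_sings (\<lambda>z. f z - g z)"
  have m: "(\<lambda>z. f z - g z) meromorphic_on UNIV"
    using f g by (auto simp: nicely_meromorphic_on_def intro!: meromorphic_intros)
  hence h: "h nicely_meromorphic_on UNIV" unfolding h_def by (rule remove_sings_nicely_meromorphic)
  obtain w where w: "w \<in> W" using W by auto
  have "\<forall>\<^sub>F v in nhds w. v \<in> W" using W(1) w by (rule eventually_nhds_in_open)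
  hence "\<forall>\<^sub>F v in at w. v \<in> W" by (auto simp: eventually_at_filter elim: eventually_mono)
  moreover have "\<forall>\<^sub>F v in at w. h v = f v - g v" unfolding h_def
    by (intro eventually_remove_sings_eq_at meromorphic_on_isolated_singularity meromorphic_on_subset[OF m]) auto
  ultimately have "\<forall>\<^sub>F v in at w. h v = 0" by eventually_elim (use W(3) in auto)
  hence "\<exists>\<^sub>F v in at w. h v = 0" by (rule eventually_frequently[rotated]) auto
  hence h0: "h v = 0" for v
    using frequently_eq_meromorphic_imp_constant[OF _ h, of 0 w] by auto
  have "\<forall>\<^sub>F v in at z. h v = f v - g v" unfolding h_def
    by (intro eventually_remove_sings_eq_at meromorphic_on_isolated_singularity meromorphic_on_subset[OF m]) auto
  hence ev: "\<forall>\<^sub>F v in at z. f v = g v" by eventually_elim (simp add: h0)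
  have fz: "(is_pole f z \<and> f z = 0) \<or> (f \<longlongrightarrow> f z) (at z)" and gz: "(is_pole g z \<and> g z = 0) \<or> (g \<longlongrightarrow> g z) (at z)"
    using f g by (auto simp: nicely_meromorphic_on_def)
  have ip: "is_pole f z \<longleftrightarrow> is_pole g z" using ev by (rule is_pole_cong) auto
  show "f z = g z"
  proof (cases "is_pole f z")
    case True
    hence "\<not> (f \<longlongrightarrow> f z) (at z)" "\<not> (g \<longlongrightarrow> g z) (at z)"
      using ip unfolding is_pole_def by (metis at_neq_bot not_tendsto_and_filterlim_at_infinity)+
    thus ?thesis using fz gz by simp
  next
    case False
    hence "(f \<longlongrightarrow> f z) (at z)" "(g \<longlongrightarrow> g z) (at z)" using fz gz ip by auto
    moreover from this(1) have "(g \<longlongrightarrow> f z) (at z)" using ev by (rule Lim_transform_eventually)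
    ultimately show ?thesis using tendsto_unique at_neq_bot by blast
  qed
qed

section \<open>The logarithm of the double gamma function\<close>

text \<open>For k <= 2 this is the derivative at s = 0 of \<open>powr_tower s k u\<close> over (2 -
  s) (1 - s); the 3 / 4 is that of 1 / ((2 - s) (1 - s)). Later entries continue by differentiation
  in u.\<close>

definition log_tower :: "nat \<Rightarrow> complex \<Rightarrow> complex" where
  "log_tower k u = (if k = 0 then u\<^sup>2 * (3 / 4 - Ln u / 2) else if k = 1 then u * (1 - Ln u)
     else if k = 2 then - Ln u else (- 1) ^ k * fact (k - 3) / u ^ (k - 2))"

text \<open>This and \<open>log_rem\<close> are the functions q and rho of the overview.\<close>

definition log_poly :: "complex \<Rightarrow> complex \<Rightarrow> complex \<Rightarrow> complex" where
  "log_poly a1 a2 u = (\<Sum>k\<le>2. em_coeff a1 a2 k * log_tower k u)"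

definition log_rem :: "complex \<Rightarrow> complex \<Rightarrow> complex \<Rightarrow> complex" where
  "log_rem a1 a2 u = (\<Sum>k\<le>2. em_coeff a1 a2 k * diff2 a1 a2 (log_tower k) u) - log_tower 2 u"

definition log_Gamma2 :: "complex \<Rightarrow> complex \<Rightarrow> complex \<Rightarrow> complex" where
  "log_Gamma2 x a1 a2 = log_poly a1 a2 x - (\<Sum>\<^sub>\<infinity>p. log_rem a1 a2 (lattice_point x a1 a2 p))"

lemma log_tower_numeral:
  "log_tower 0 u = u\<^sup>2 * (3 / 4 - Ln u / 2)" "log_tower (Suc 0) u = u * (1 - Ln u)" "log_tower 2 u = - Ln u"
  by (simp_all add: log_tower_def)

lemma log_tower_deriv:
  assumes "u \<notin> \<real>\<^sub>\<le>\<^sub>0" "k \<le> 4"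
  shows "(log_tower k has_field_derivative log_tower (Suc k) u) (at u)"
proof -
  have u: "u \<noteq> 0" using assms by auto
  consider "k = 0" | "k = 1" | "k = 2" | "k = 3" | "k = 4" using assms(2) by linarith
  thus ?thesis
  proof cases
    case 1
    show ?thesis unfolding 1 log_tower_def
      by (auto intro!: derivative_eq_intros simp: assms u) (simp add: field_simps u power2_eq_square)
  next
    case 2
    show ?thesis unfolding 2 log_tower_def
      by (auto intro!: derivative_eq_intros simp: assms u)
  next
    case 3
    show ?thesis unfolding 3 log_tower_def
      by (auto intro!: derivative_eq_intros simp: assms u eval_nat_numeral) (simp add: field_simps u)
  next
  case 4
    show ?thesis unfolding 4 log_tower_def
      by (auto intro!: derivative_eq_intros simp: u eval_nat_numeral)
  next
    case 5
    show ?thesis unfolding 5 log_tower_def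
      by (auto intro!: derivative_eq_intros simp: u eval_nat_numeral)
  qed
qed

lemma powr_tower_deriv_0:
  assumes "u \<noteq> 0" "k \<le> 2"
  shows "((\<lambda>s. powr_tower s k u / ((2 - s) * (1 - s))) has_field_derivative log_tower k u) (at 0)"
proof -
  have P [derivative_intros]: "((\<lambda>s. u powr (c - s)) has_field_derivative - Ln u * u powr c) (at 0)" for c
    by (rule DERIV_chain2[OF has_field_derivative_powr_right, THEN DERIV_cong])
       (auto intro!: derivative_eq_intros simp: assms)
  have P0: "((\<lambda>s. u powr (- s)) has_field_derivative - Ln u) (at 0)"
    using P[of 0] assms by simp
  have B: "((\<lambda>s. (2 - s) * (1 - s)) has_field_derivative - 3) (at (0 :: complex))"
    by (auto intro!: derivative_eq_intros)
  consider "k = 0" | "k = 1" | "k = 2" using assms by linarith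
  thus ?thesis
  proof cases
    case 1
    show ?thesis unfolding 1 log_tower_def powr_tower_def
      by (auto intro!: derivative_eq_intros simp: assms) (simp add: field_simps power2_eq_square)
  next
    case 2
    have A: "((\<lambda>s. (2 - s) * u powr (1 - s)) has_field_derivative - u - 2 * (Ln u * u)) (at 0)"
      using P[of 1] by (auto intro!: derivative_eq_intros simp: assms)
    have C: "(\<lambda>s. powr_tower s 1 u / ((2 - s) * (1 - s))) = (\<lambda>s. (2 - s) * u powr (1 - s) / ((2 - s) * (1 - s)))"
      by (simp add: powr_tower_def)
    show ?thesis unfolding 2 C
      by (rule DERIV_cong[OF DERIV_divide[OF A B]]) (use assms in \<open>auto simp: log_tower_def field_simps\<close>)
  next
    case 3
    have A: "((\<lambda>s. (2 - s) * (1 - s) * u powr - s) has_field_derivative - 3 - 2 * Ln u) (at 0)"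
      using P0 by (auto intro!: derivative_eq_intros simp: assms)
    show ?thesis unfolding 3 powr_tower_2
      by (rule DERIV_cong[OF DERIV_divide[OF A B]]) (use assms in \<open>auto simp: log_tower_def field_simps\<close>)
  qed
qed

context
  fixes x a1 a2 :: complex
  assumes x: "Re x > 0" and a1: "Re a1 > 0" and a2: "Re a2 > 0"
begin

text \<open>The truncations glue to an entire function E; dividing by (2 - s) (1 - s) and removing
  singularities gives a continuation in the normalized form that the definition asks for.\<close>

lemma zeta2_eq_zeta_ext:
  assumes "Re s > 1 - real K" "s \<noteq> 1" "s \<noteq> 2"
  shows "zeta2 x a1 a2 s = zeta_ext K x a1 a2 s / ((2 - s) * (1 - s))"
proof -
  define E where "E = (\<lambda>s. zeta_ext (SOME K. Re s > 1 - real K) x a1 a2 s)"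
  have E: "E s = zeta_ext K x a1 a2 s" if "Re s > 1 - real K" for s K
  proof -
    have "Re s > 1 - real (SOME K. Re s > 1 - real K)" using that by (rule someI)
    thus ?thesis unfolding E_def by (rule zeta_ext_agree[OF x a1 a2 _ that])
  qed
  have holE: "E holomorphic_on UNIV"
    unfolding holomorphic_on_def
  proof
    fix s
    obtain K :: nat where K: "real K > 1 - Re s" using reals_Archimedean2 by blast
    let ?S = "{s. Re s > 1 - real K}"
    have "E holomorphic_on ?S"
      using zeta_ext_holomorphic[OF x a1 a2] by (rule holomorphic_transform) (simp add: E)
    moreover have "open ?S" "s \<in> ?S" using K by (auto simp: open_halfspace_Re_gt)
    ultimately show "E field_differentiable (at s within UNIV)"
      using holomorphic_on_imp_differentiable_at by blast
  qed
  define Z where "Z = remove_sings (\<lambda>s. E s / ((2 - s) * (1 - s)))"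
  have an: "E analytic_on A" for A using holE analytic_on_holomorphic by blast
  have nm: "Z nicely_meromorphic_on UNIV" unfolding Z_def
    by (intro remove_sings_nicely_meromorphic meromorphic_intros analytic_on_imp_meromorphic_on an)
  have Z: "Z s = E s / ((2 - s) * (1 - s))" if "s \<noteq> 1" "s \<noteq> 2" for s
    unfolding Z_def using that by (intro remove_sings_at_analytic analytic_intros an) auto
  let ?P = "\<lambda>Z. Z nicely_meromorphic_on UNIV \<and> (\<forall>s. Re s > 2 \<longrightarrow>
     Z s = (\<Sum>\<^sub>\<infinity>(n1, n2)\<in>(UNIV :: (nat \<times> nat) set). (x + of_nat n1 * a1 + of_nat n2 * a2) powr (- s)))"
  have PZ: "?P Z"
  proof (intro conjI allI impI nm)
    fix s :: complex assume s: "Re s > 2"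
    have "s \<noteq> 1" "s \<noteq> 2" using s by auto
    moreover have "E s = zeta_ext 0 x a1 a2 s" using s by (intro E) auto
    ultimately show "Z s = (\<Sum>\<^sub>\<infinity>(n1, n2). (x + of_nat n1 * a1 + of_nat n2 * a2) powr (- s))"
      by (simp add: Z zeta_ext_eq[OF x a1 a2 s] lattice_point_def case_prod_unfold)
  qed
  moreover have "W = Z" if "?P W" for W
  proof (rule nicely_meromorphic_unique[of _ _ "{s. Re s > 2}"])
    have "3 \<in> {s. Re s > 2}" by simp
    thus "{s. Re s > 2} \<noteq> {}" by blast
  qed (use that PZ in \<open>auto simp: open_halfspace_Re_gt\<close>)
  ultimately have "zeta2 x a1 a2 = Z" unfolding zeta2_def by (rule the_equality)
  thus ?thesis using Z E assms by simp
qed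

text \<open>On the disc of radius 1 / 2 the order K = 2 converges and 1 and 2 are avoided, so the
  finite partial sums converge uniformly and can be differentiated term by term.\<close>

lemma deriv_zeta2:
  "deriv (zeta2 x a1 a2) 0 = log_Gamma2 x a1 a2"
proof -
  let ?lp = "lattice_point x a1 a2"
  let ?F = "finite_subsets_at_top (UNIV :: (nat \<times> nat) set)"
  let ?C = "cball (0 :: complex) (1 / 2)" and ?D = "ball (0 :: complex) (1 / 2)"
  define Q where "Q = (\<lambda>s. (2 - s) * (1 - s) :: complex)"
  define g where "g = (\<lambda>X s. ((\<Sum>k\<le>2. em_coeff a1 a2 k * powr_tower s k x) - (\<Sum>p\<in>X. zeta_rem 2 a1 a2 s (?lp p))) / Q s)"
  define W where "W = (\<lambda>s. zeta_ext 2 x a1 a2 s / Q s)"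
  have CR: "Re s > - 1" "s \<noteq> 1" "s \<noteq> 2" if "s \<in> ?C" for s
    using that abs_Re_le_cmod[of s] by auto
  have Q0: "Q s \<noteq> 0" if "s \<in> ?C" for s using CR(2,3)[OF that] by (auto simp: Q_def)
  have "continuous_on ?C (\<lambda>s. inverse (Q s))"
    using Q0 by (auto intro!: continuous_intros simp: Q_def)
  hence "compact ((\<lambda>s. inverse (Q s)) ` ?C)" by (intro compact_continuous_image compact_cball)
  \<comment> \<open>A product of uniform limits converges uniformly when both limits are
    bounded.\<close>
  hence bQ: "bounded ((\<lambda>s. inverse (Q s)) ` ?C)" by (rule compact_imp_bounded)
  have x0: "x \<noteq> 0" using x by auto
  have "uniform_limit ?C (\<lambda>X s. \<Sum>p\<in>X. zeta_rem 2 a1 a2 s (?lp p)) (\<lambda>s. \<Sum>\<^sub>\<infinity>p. zeta_rem 2 a1 a2 s (?lp p)) ?F"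
    using CR(1) by (intro zeta_rem_uniform_limit x a1 a2) auto
  hence "uniform_limit ?C (\<lambda>X s. (\<Sum>k\<le>2. em_coeff a1 a2 k * powr_tower s k x) - (\<Sum>p\<in>X. zeta_rem 2 a1 a2 s (?lp p)))
      (\<lambda>s. (\<Sum>k\<le>2. em_coeff a1 a2 k * powr_tower s k x) - (\<Sum>\<^sub>\<infinity>p. zeta_rem 2 a1 a2 s (?lp p))) ?F"
    by (intro uniform_limit_minus uniform_limit_const)
  hence "uniform_limit ?C (\<lambda>X s. (\<Sum>k\<le>2. em_coeff a1 a2 k * powr_tower s k x) - (\<Sum>p\<in>X. zeta_rem 2 a1 a2 s (?lp p)))
      (zeta_ext 2 x a1 a2) ?F"
    by (simp only: zeta_ext_def[abs_def])
  moreover have "zeta_ext 2 x a1 a2 holomorphic_on {s. Re s > 1 - real 2}"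
    by (rule zeta_ext_holomorphic[OF x a1 a2])
  hence "continuous_on ?C (zeta_ext 2 x a1 a2)"
    using CR(1) by (intro holomorphic_on_imp_continuous_on[OF holomorphic_on_subset]) auto
  hence "bounded (zeta_ext 2 x a1 a2 ` ?C)" by (intro compact_imp_bounded compact_continuous_image compact_cball)
  ultimately have "uniform_limit ?C (\<lambda>X s. ((\<Sum>k\<le>2. em_coeff a1 a2 k * powr_tower s k x) - (\<Sum>p\<in>X. zeta_rem 2 a1 a2 s (?lp p))) * inverse (Q s))
      (\<lambda>s. zeta_ext 2 x a1 a2 s * inverse (Q s)) ?F"
    by (intro uniform_lim_mult uniform_limit_const bQ)
  hence ul: "uniform_limit ?C g W ?F"
    by (simp only: g_def[abs_def] W_def[abs_def] field_class.field_divide_inverse[of _ "Q _"])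
  have lp: "Re (?lp p) > 0" for p by (rule Re_lattice_point_pos[OF x a1 a2])
  have nz: "?lp p \<noteq> 0" "?lp p + a1 \<noteq> 0" "?lp p + a2 \<noteq> 0" "?lp p + a1 + a2 \<noteq> 0" for p
    using lp[of p] a1 a2 by (auto simp: complex_eq_iff)
  have holQ: "Q holomorphic_on ?C" unfolding Q_def by (intro holomorphic_intros)
  have hol: "g X holomorphic_on ?C" for X
    unfolding g_def using Q0
    by (intro holomorphic_intros powr_tower_holomorphic[OF x0] zeta_rem_holomorphic[OF a1 a2] lp holQ)
       auto
  have hold: "(g X has_field_derivative deriv (g X) s) (at s)" if "s \<in> ?D" for X s
    using that by (intro holomorphic_derivI[OF holomorphic_on_subset[OF hol ball_subset_cball]]) auto
  obtain G where G: "\<And>s. s \<in> ?D \<Longrightarrow> (W has_field_derivative G s) (at s) \<and> ((\<lambda>X. deriv (g X) s) \<longlongrightarrow> G s) ?F"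
  proof (rule has_complex_derivative_uniform_limit[of 0 "1/2" g "\<lambda>X. deriv (g X)" ?F W])
    show "\<forall>\<^sub>F X in ?F. continuous_on ?C (g X) \<and> (\<forall>w\<in>?D. (g X has_field_derivative deriv (g X) w) (at w))"
      using hol hold by (intro always_eventually) (auto intro: holomorphic_on_imp_continuous_on)
  qed (use ul in auto)
  have dg: "deriv (g X) 0 = log_poly a1 a2 x - (\<Sum>p\<in>X. log_rem a1 a2 (?lp p))" for X
  proof (rule DERIV_imp_deriv)
    define T where "T = (\<lambda>k u s. powr_tower s k u / Q s)"
    have T: "(T k u has_field_derivative log_tower k u) (at 0)" if "u \<noteq> 0" "k \<le> 2" for k u
      using powr_tower_deriv_0[OF that] by (simp add: T_def Q_def)
    have g_eq: "g X = (\<lambda>s. (\<Sum>k\<le>2. em_coeff a1 a2 k * T k x s) - (\<Sum>p\<in>X. (\<Sum>k\<le>2. em_coeff a1 a2 k *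
       (T k (?lp p) s - T k (?lp p + a1) s - T k (?lp p + a2) s + T k (?lp p + a1 + a2) s)) - T 2 (?lp p) s))"
      by (simp add: fun_eq_iff g_def T_def zeta_rem_def diff2_def diff_divide_distrib add_divide_distrib sum_divide_distrib
          sum_subtractf sum.distrib algebra_simps)
    show "(g X has_field_derivative log_poly a1 a2 x - (\<Sum>p\<in>X. log_rem a1 a2 (?lp p))) (at 0)"
      unfolding g_eq log_poly_def log_rem_def diff2_def
      by (intro DERIV_diff DERIV_sum DERIV_add DERIV_cmult T nz x0) auto
  qed
  have lim: "((\<lambda>X. log_poly a1 a2 x - (\<Sum>p\<in>X. log_rem a1 a2 (?lp p))) \<longlongrightarrow> G 0) ?F"
    using G[of 0] by (simp add: dg)
  hence "((\<lambda>X. log_poly a1 a2 x - (log_poly a1 a2 x - (\<Sum>p\<in>X. log_rem a1 a2 (?lp p)))) \<longlongrightarrow> log_poly a1 a2 x - G 0) ?F"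
    by (intro tendsto_intros)
  \<comment> \<open>Convergence of the derivatives gives the summability of \<open>log_rem\<close>
    along with its value.\<close>
  hence hs: "((\<lambda>p. log_rem a1 a2 (?lp p)) has_sum (log_poly a1 a2 x - G 0)) UNIV"
    by (simp add: has_sum_def)
  have "G 0 = log_Gamma2 x a1 a2" using infsumI[OF hs] by (simp add: log_Gamma2_def)
  moreover have "deriv (zeta2 x a1 a2) 0 = deriv W 0"
  proof (rule deriv_cong_ev)
    have "\<forall>\<^sub>F s in nhds 0. s \<in> ?D" by (rule eventually_nhds_in_open) auto
    thus "\<forall>\<^sub>F s in nhds 0. zeta2 x a1 a2 s = W s"
    proof eventually_elim
      case (elim s)
      hence "s \<in> ?C" by auto
      thus ?case using CR[of s] by (simp add: W_def Q_def zeta2_eq_zeta_ext[of 2])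
    qed
  qed simp
  moreover have "deriv W 0 = G 0" using G[of 0] by (intro DERIV_imp_deriv) auto
  ultimately show "deriv (zeta2 x a1 a2) 0 = log_Gamma2 x a1 a2" by simp
qed

end

section \<open>Joint holomorphy in the argument and the parameter\<close>

lemma holo2_on_compose:
  assumes "f holomorphic_on S" "open S" "holo2_on g U" "\<And>p. p \<in> U \<Longrightarrow> g p \<in> S"
  shows "holo2_on (\<lambda>p. f (g p)) U"
  unfolding holo2_on_def
proof
  fix p assume p: "p \<in> U"
  then obtain a b where g: "(g has_derivative (\<lambda>(h, k). a * h + b * k)) (at p)"
    using assms(3) unfolding holo2_on_def by blast
  have "(f has_derivative (*) (deriv f (g p))) (at (g p))"
    using holomorphic_derivI[OF assms(1,2) assms(4)[OF p]] by (simp add: has_field_derivative_def)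
  from has_derivative_compose[OF g this]
  have "((\<lambda>p. f (g p)) has_derivative (\<lambda>(h, k). (deriv f (g p) * a) * h + (deriv f (g p) * b) * k)) (at p)"
    by (rule has_derivative_eq_rhs) (auto simp: algebra_simps)
  thus "\<exists>a b. ((\<lambda>p. f (g p)) has_derivative (\<lambda>(h, k). a * h + b * k)) (at p)" by blast
qed

lemma holo2_on_fst: "holo2_on fst U"
  unfolding holo2_on_def
proof
  fix p :: "complex \<times> complex"
  have "(fst has_derivative (\<lambda>(h, k). 1 * h + 0 * k)) (at p)"
    by (rule has_derivative_eq_rhs[OF has_derivative_fst[OF has_derivative_ident]]) (auto simp: case_prod_unfold)
  thus "\<exists>a b. (fst has_derivative (\<lambda>(h, k). a * h + b * k)) (at p)" by blast
qed

lemma holo2_on_snd: "holo2_on snd U"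
  unfolding holo2_on_def
proof
  fix p :: "complex \<times> complex"
  have "(snd has_derivative (\<lambda>(h, k). 0 * h + 1 * k)) (at p)"
    by (rule has_derivative_eq_rhs[OF has_derivative_snd[OF has_derivative_ident]]) (auto simp: case_prod_unfold)
  thus "\<exists>a b. (snd has_derivative (\<lambda>(h, k). a * h + b * k)) (at p)" by blast
qed

lemma holo2_on_uminus: "holo2_on f U \<Longrightarrow> holo2_on (\<lambda>q. - f q) U"
  using holo2_on_mult[OF holo2_on_const[of "- 1"]] by simp

lemma holo2_on_diff: "holo2_on f U \<Longrightarrow> holo2_on g U \<Longrightarrow> holo2_on (\<lambda>q. f q - g q) U"
  using holo2_on_add[OF _ holo2_on_uminus] by simp

lemma holo2_on_sum: "(\<And>i. i \<in> I \<Longrightarrow> holo2_on (f i) U) \<Longrightarrow> holo2_on (\<lambda>q. \<Sum>i\<in>I. f i q) U"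
  by (induction I rule: infinite_finite_induct) (auto intro: holo2_on_add holo2_on_const)

lemma holo2_on_prod: "(\<And>i. i \<in> I \<Longrightarrow> holo2_on (f i) U) \<Longrightarrow> holo2_on (\<lambda>q. \<Prod>i\<in>I. f i q) U"
  by (induction I rule: infinite_finite_induct) (auto intro: holo2_on_mult holo2_on_const)

lemmas holo2_intros = holo2_on_const holo2_on_fst holo2_on_snd holo2_on_add holo2_on_diff holo2_on_uminus
  holo2_on_mult holo2_on_sum holo2_on_prod

text \<open>On this set every x + m + n tau has positive imaginary part, so the principal logarithm
  is holomorphic along the cone whatever the sign of Re tau.\<close>

definition HH :: "(complex \<times> complex) set" where
  "HH = {(\<tau>, x). Im \<tau> > 0 \<and> Im x > 0}"

lemma open_HH: "open HH"
proof -
  have HH: "HH = {\<tau>. Im \<tau> > 0} \<times> {x. Im x > 0}" by (auto simp: HH_def)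
  show ?thesis unfolding HH by (intro open_Times open_halfspace_Im_gt)
qed

lemma notin_nonpos_Reals_Im: "Im z > 0 \<Longrightarrow> z \<notin> \<real>\<^sub>\<le>\<^sub>0"
  using complex_nonpos_Reals_iff by auto

lemma log_rem_bound:
  assumes "\<epsilon> \<ge> 0" "\<rho> > 0" "Im u > 0" "Im u + \<epsilon> * Re u \<ge> \<rho>"
    and a1: "a1 \<noteq> 0" "Im a1 \<ge> 0" "Im a1 + \<epsilon> * Re a1 \<ge> 0"
    and a2: "a2 \<noteq> 0" "Im a2 \<ge> 0" "Im a2 + \<epsilon> * Re a2 \<ge> 0"
  shows "norm (log_rem a1 a2 u) \<le> 2 * ((1 + \<epsilon>) / \<rho>) ^ 3 * em_const 2 a1 a2"
proof -
  \<comment> \<open>Conjugation flips the sign of Im v, so the inner product is Im v + eps Re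
    v.\<close>
  define T where "T = {v. Im v > 0} \<inter> {v. (\<epsilon> - \<i>) \<bullet> cnj v \<ge> \<rho>}"
  have T_iff: "v \<in> T \<longleftrightarrow> Im v > 0 \<and> Im v + \<epsilon> * Re v \<ge> \<rho>" for v
    by (auto simp: T_def inner_complex_def)
  have convT: "convex T"
  proof -
    have "{v. (\<epsilon> - \<i>) \<bullet> cnj v \<ge> \<rho>} = {v. inner (complex_of_real \<epsilon> + \<i>) v \<ge> \<rho>}"
      by (auto simp: inner_complex_def)
    thus ?thesis unfolding T_def by (simp add: convex_Int convex_halfspace_Im_gt convex_halfspace_ge)
  qed
  have "norm ((\<Sum>k\<le>2. em_coeff a1 a2 k * diff2 a1 a2 (log_tower k) u) - log_tower 2 u)
      \<le> 2 * ((1 + \<epsilon>) / \<rho>) ^ 3 * em_const 2 a1 a2"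
  proof (rule diff2_euler_maclaurin[OF convT])
    show "u \<in> T" "u + a1 \<in> T" "u + a2 \<in> T" "u + a1 + a2 \<in> T"
      using assms by (auto simp: T_iff algebra_simps)
    show "(log_tower k has_field_derivative log_tower (Suc k) v) (at v within T)" if "v \<in> T" "k \<le> 2 + 2" for k v
      using that by (intro has_field_derivative_at_within[OF log_tower_deriv] notin_nonpos_Reals_Im) (auto simp: T_iff)
    show "norm (log_tower (2 + 3) v) \<le> 2 * ((1 + \<epsilon>) / \<rho>) ^ 3" if v: "v \<in> T" for v
    proof -
      have "\<rho> \<le> Im v + \<epsilon> * Re v" using v by (simp add: T_iff)
      also have "\<dots> \<le> norm v + \<epsilon> * norm v"
        using assms(1) abs_Im_le_cmod[of v] complex_Re_le_cmod[of v] by (intro add_mono mult_left_mono) auto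
      finally have r: "\<rho> \<le> (1 + \<epsilon>) * norm v" by (simp add: algebra_simps)
      hence nv: "norm v > 0" using assms(1,2) by (cases "v = 0") auto
      have "1 / norm v \<le> (1 + \<epsilon>) / \<rho>" using r nv assms(2) by (simp add: field_simps)
      hence "(1 / norm v) ^ 3 \<le> ((1 + \<epsilon>) / \<rho>) ^ 3" by (rule power_mono) simp
      moreover have "norm (log_tower (2 + 3) v) = 2 * (1 / norm v) ^ 3"
        by (simp add: log_tower_def norm_divide norm_mult norm_power power_divide eval_nat_numeral)
      ultimately show ?thesis by simp
    qed
  qed (use a1 a2 in auto)
  thus ?thesis by (simp add: log_rem_def)
qed

lemma em_coeff_holomorphic:
  assumes "k \<le> 2" shows "(\<lambda>\<tau>. em_coeff 1 \<tau> k) holomorphic_on - {0}"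
proof -
  consider "k = 0" | "k = 1" | "k = 2" using assms by linarith
  thus ?thesis
  proof cases
    case 1
    have "(\<lambda>\<tau>. 1 / (1 * \<tau>)) holomorphic_on - {0}" by (intro holomorphic_intros) auto
    thus ?thesis unfolding 1 by (rule holomorphic_transform) (simp add: em_coeff_values)
  next
    case 2
    have "(\<lambda>\<tau>. - (1 + \<tau>) / (2 * 1 * \<tau>)) holomorphic_on - {0}" by (intro holomorphic_intros) auto
    thus ?thesis unfolding 2 by (rule holomorphic_transform) (simp add: em_coeff_values del: One_nat_def)
  next
    case 3
    have "(\<lambda>\<tau>. (1 / \<tau> + \<tau> / 1) / 12 + 1 / 4) holomorphic_on - {0}" by (intro holomorphic_intros) auto
    thus ?thesis unfolding 3 by (rule holomorphic_transform) (simp add: em_coeff_values)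
  qed
qed

lemma log_tower_holomorphic: "k \<le> 4 \<Longrightarrow> log_tower k holomorphic_on {v. Im v > 0}"
  unfolding holomorphic_on_def field_differentiable_def
  using has_field_derivative_at_within[OF log_tower_deriv] notin_nonpos_Reals_Im by blast

lemma holo2_log_tower:
  assumes "holo2_on g HH" "\<And>p. p \<in> HH \<Longrightarrow> Im (g p) > 0" "k \<le> 2"
  shows "holo2_on (\<lambda>p. log_tower k (g p)) HH"
  by (rule holo2_on_compose[OF log_tower_holomorphic open_halfspace_Im_gt assms(1)]) (use assms in auto)

lemma holo2_em_coeff: "k \<le> 2 \<Longrightarrow> holo2_on (\<lambda>p. em_coeff 1 (fst p) k) HH"
  by (rule holo2_on_compose[OF em_coeff_holomorphic _ holo2_on_fst]) (auto simp: HH_def)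

lemma holo2_log_rem: "holo2_on (\<lambda>p. log_rem 1 (fst p) (lattice_point (snd p) 1 (fst p) i)) HH"
proof -
  obtain m n where i: "i = (m, n)" by (cases i)
  show ?thesis
    unfolding log_rem_def diff2_def lattice_point_def i prod.case
    by (intro holo2_intros holo2_em_coeff holo2_log_tower) (auto simp: HH_def intro!: add_pos_nonneg)
qed

text \<open>The positive functional \<open>Im v + \<epsilon> Re v\<close> bounds \<open>x + m + n \<tau>\<close> from below by a multiple of \<open>1 + m + n\<close>,
  although the imaginary part alone does not see \<open>m\<close>.\<close>

lemma log_rem_local_bound:
  assumes "p0 \<in> HH"
  obtains r M where "r > 0" "cball p0 r \<subseteq> HH" "M summable_on (UNIV :: (nat \<times> nat) set)"
    "\<And>i p. p \<in> cball p0 r \<Longrightarrow> norm (log_rem 1 (fst p) (lattice_point (snd p) 1 (fst p) i)) \<le> M i"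
proof -
  obtain \<tau>0 x0 where p0: "p0 = (\<tau>0, x0)" by (cases p0)
  have I: "Im \<tau>0 > 0" "Im x0 > 0" using assms by (auto simp: HH_def p0)
  \<comment> \<open>With eps (1 + |Re v|) <= Im v the term eps Re v cannot outweigh Im v, for v =
    tau0 and for v = x0.\<close>
  define \<epsilon> where "\<epsilon> = min (Im \<tau>0 / (1 + \<bar>Re \<tau>0\<bar>)) (Im x0 / (1 + \<bar>Re x0\<bar>)) / 2"
  have e: "\<epsilon> > 0" using I by (auto simp: \<epsilon>_def)
  have "2 * \<epsilon> \<le> Im \<tau>0 / (1 + \<bar>Re \<tau>0\<bar>)" "2 * \<epsilon> \<le> Im x0 / (1 + \<bar>Re x0\<bar>)" by (auto simp: \<epsilon>_def)
  hence e_le: "\<epsilon> \<le> Im \<tau>0 / (1 + \<bar>Re \<tau>0\<bar>)" "\<epsilon> \<le> Im x0 / (1 + \<bar>Re x0\<bar>)" using e by linarith+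
  have l: "Im v + \<epsilon> * Re v > 0" if "Im v > 0" "\<epsilon> \<le> Im v / (1 + \<bar>Re v\<bar>)" for v
  proof -
    have "\<epsilon> * (1 + \<bar>Re v\<bar>) \<le> Im v" using that by (simp add: field_simps)
    moreover have "\<epsilon> * \<bar>Re v\<bar> < \<epsilon> * (1 + \<bar>Re v\<bar>)" using e by simp
    moreover have "- (\<epsilon> * \<bar>Re v\<bar>) \<le> \<epsilon> * Re v" using e abs_le_D2[of "Re v" "\<bar>Re v\<bar>"]
      by (metis abs_ge_minus_self minus_le_iff mult_left_mono mult_minus_right less_imp_le)
    ultimately show ?thesis by linarith
  qed
  have l0: "Im \<tau>0 + \<epsilon> * Re \<tau>0 > 0" "Im x0 + \<epsilon> * Re x0 > 0"
    using l[of \<tau>0] l[of x0] I e_le by auto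
  \<comment> \<open>The step 1 contributes eps to the functional, the step tau0 and the start x0 the
    other two values; halving these leaves room for a neighbourhood.\<close>
  define c where "c = min \<epsilon> (min (Im \<tau>0 + \<epsilon> * Re \<tau>0) (Im x0 + \<epsilon> * Re x0) / 2)"
  have c: "c > 0" using l0 e by (simp add: c_def)
  have "2 * c \<le> Im \<tau>0 + \<epsilon> * Re \<tau>0" "2 * c \<le> Im x0 + \<epsilon> * Re x0" by (auto simp: c_def min_def)
  hence c_less: "c < Im \<tau>0 + \<epsilon> * Re \<tau>0" "c < Im x0 + \<epsilon> * Re x0" using c by linarith+
  define V where "V = HH \<inter> ({p. Im (fst p) + \<epsilon> * Re (fst p) > c} \<inter> {p. Im (snd p) + \<epsilon> * Re (snd p) > c})"
  have "open V" unfolding V_def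
    by (intro open_Int open_HH open_Collect_less continuous_intros)
  moreover have "p0 \<in> V" using assms c_less by (auto simp: V_def p0)
  ultimately obtain r where r: "r > 0" "cball p0 r \<subseteq> V" using open_contains_cball by blast
  have "continuous_on (cball p0 r) (\<lambda>p. em_const 2 1 (fst p))"
    unfolding em_const_def
  proof (intro continuous_intros)
    fix k :: nat assume "k \<in> {..2}"
    hence "continuous_on HH (\<lambda>p. em_coeff 1 (fst p) k)" by (intro holo2_on_continuous holo2_em_coeff) auto
    thus "continuous_on (cball p0 r) (\<lambda>p. em_coeff 1 (fst p) k)"
      by (rule continuous_on_subset) (use r in \<open>auto simp: V_def\<close>)
  qed
  hence "bounded ((\<lambda>p. em_const 2 1 (fst p)) ` cball p0 r)"
    by (intro compact_imp_bounded compact_continuous_image compact_cball)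
  then obtain B where B: "\<And>p. p \<in> cball p0 r \<Longrightarrow> norm (em_const 2 1 (fst p)) \<le> B"
    unfolding bounded_iff by blast
  show thesis
  proof (rule that[of r "\<lambda>i. 2 * ((1 + \<epsilon>) / c) ^ 3 * B * (case i of (m, n) \<Rightarrow> (1 + real m + real n) powr - 3)"])
    show "(\<lambda>i. 2 * ((1 + \<epsilon>) / c) ^ 3 * B * (case i of (m, n) \<Rightarrow> (1 + real m + real n) powr - 3))
      summable_on (UNIV :: (nat \<times> nat) set)"
      by (intro summable_on_cmult_right summable_on_lattice_powr) simp
    show "r > 0" "cball p0 r \<subseteq> HH" using r by (auto simp: V_def)
    fix i :: "nat \<times> nat" and p assume p: "p \<in> cball p0 r"
    obtain m n where i: "i = (m, n)" by (cases i)
    obtain \<tau> x where px: "p = (\<tau>, x)" by (cases p)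
    define N where "N = 1 + real m + real n"
    have N: "N > 0" by (simp add: N_def)
    have pV: "(\<tau>, x) \<in> V" using p r px by auto
    have J: "Im \<tau> > 0" "Im x > 0" "Im \<tau> + \<epsilon> * Re \<tau> \<ge> c" "Im x + \<epsilon> * Re x \<ge> c"
      using pV by (auto simp: V_def HH_def)
    have "real n * c \<le> real n * (Im \<tau> + \<epsilon> * Re \<tau>)" "real m * c \<le> real m * \<epsilon>"
      using J by (auto simp: c_def intro!: mult_left_mono)
    hence lb: "Im (lattice_point x 1 \<tau> i) + \<epsilon> * Re (lattice_point x 1 \<tau> i) \<ge> c * N"
      using J(4) by (simp add: lattice_point_def i N_def algebra_simps)
    have "norm (log_rem 1 \<tau> (lattice_point x 1 \<tau> i)) \<le> 2 * ((1 + \<epsilon>) / (c * N)) ^ 3 * em_const 2 1 \<tau>"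
    proof (rule log_rem_bound)
      show "Im (lattice_point x 1 \<tau> i) > 0"
        using J by (auto simp: lattice_point_def i intro!: add_pos_nonneg)
      show "c * N > 0" using c N by simp
      show "c * N \<le> Im (lattice_point x 1 \<tau> i) + \<epsilon> * Re (lattice_point x 1 \<tau> i)" by (rule lb)
    qed (use e c J in auto)
    also have "\<dots> \<le> 2 * ((1 + \<epsilon>) / (c * N)) ^ 3 * B"
      using B[OF p] e c N by (intro mult_left_mono) (auto simp: px)
    also have "\<dots> = 2 * ((1 + \<epsilon>) / c) ^ 3 * B * N powr - 3"
      using N by (simp add: powr_minus powr_numeral field_simps)
    finally show "norm (log_rem 1 (fst p) (lattice_point (snd p) 1 (fst p) i)) \<le>
       2 * ((1 + \<epsilon>) / c) ^ 3 * B * (case i of (m, n) \<Rightarrow> (1 + real m + real n) powr - 3)"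
      by (simp add: px i N_def)
  qed
qed

lemma log_rem_summable_Im:
  assumes "Im \<tau> > 0" "Im x > 0"
  shows "(\<lambda>i. log_rem 1 \<tau> (lattice_point x 1 \<tau> i)) summable_on UNIV"
proof -
  have "(\<tau>, x) \<in> HH" using assms by (simp add: HH_def)
  from log_rem_local_bound[OF this] obtain r M where M: "r > 0" "M summable_on (UNIV :: (nat \<times> nat) set)"
    "\<And>i p. p \<in> cball (\<tau>, x) r \<Longrightarrow> norm (log_rem 1 (fst p) (lattice_point (snd p) 1 (fst p) i)) \<le> M i" by metis
  show ?thesis
    by (rule abs_summable_summable[OF summable_on_comparison_test[OF M(2)]])
       (use M(3)[of "(\<tau>, x)"] M(1) in auto)
qed

lemma holo2_log_Gamma2: "holo2_on (\<lambda>p. log_Gamma2 (snd p) 1 (fst p)) HH"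
proof -
  let ?g = "\<lambda>p. \<Sum>\<^sub>\<infinity>i. log_rem 1 (fst p) (lattice_point (snd p) 1 (fst p) i)"
  have "holo2_on ?g HH"
  proof (rule holo2_on_uniform_limit)
    fix p0 assume "p0 \<in> HH"
    from log_rem_local_bound[OF this] obtain r M where M: "r > 0" "cball p0 r \<subseteq> HH" "M summable_on (UNIV :: (nat \<times> nat) set)"
      "\<And>i p. p \<in> cball p0 r \<Longrightarrow> norm (log_rem 1 (fst p) (lattice_point (snd p) 1 (fst p) i)) \<le> M i" by metis
    show "\<exists>r>0. (\<forall>\<^sub>F X in finite_subsets_at_top UNIV. holo2_on (\<lambda>p. \<Sum>i\<in>X. log_rem 1 (fst p) (lattice_point (snd p) 1 (fst p) i)) (ball p0 r)) \<and>
       uniform_limit (ball p0 r) (\<lambda>X p. \<Sum>i\<in>X. log_rem 1 (fst p) (lattice_point (snd p) 1 (fst p) i)) ?g (finite_subsets_at_top UNIV)"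
    proof (intro exI[of _ r] conjI always_eventually allI Weierstrass_m_test_general[OF _ M(3)])
      show "holo2_on (\<lambda>p. \<Sum>i\<in>X. log_rem 1 (fst p) (lattice_point (snd p) 1 (fst p) i)) (ball p0 r)" for X
        by (intro holo2_on_sum holo2_on_subset[OF holo2_log_rem]) (use M(2) in auto)
    qed (use M in auto)
  qed auto
  moreover have "holo2_on (\<lambda>p. log_poly 1 (fst p) (snd p)) HH"
    unfolding log_poly_def by (intro holo2_intros holo2_em_coeff holo2_log_tower) (auto simp: HH_def)
  ultimately show ?thesis unfolding log_Gamma2_def by (intro holo2_on_diff)
qed

section \<open>The functional equation\<close>

text \<open>The quotient of n^(n + 1/2) e^(-n) by n!, which tends to Stirling's constant.\<close>

definition stirling_quot :: "nat \<Rightarrow> real" where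
  "stirling_quot n = exp ((real n + 1 / 2) * ln (real n) - real n) / fact n"

text \<open>The expression is the central binomial coefficient times sqrt n / (4^n sqrt 2), a form
  of Wallis' product; Euler's limit for Gamma (1/2) = sqrt pi evaluates it.\<close>

lemma stirling_quot_duplication: "(\<lambda>n. stirling_quot n ^ 2 / stirling_quot (2 * n)) \<longlonglongrightarrow> 1 / sqrt (2 * pi)"
proof (rule Lim_transform_eventually)
  \<comment> \<open>The factor n / (n + 1/2), which tends to 1, compensates for the Pochhammer
    product in \<open>Gamma_series\<close> having n + 1 factors.\<close>
  have "(\<lambda>n. (real n / (real n + 1 / 2)) / (sqrt 2 * Gamma_series (1 / 2 :: real) n)) \<longlonglongrightarrow> 1 / (sqrt 2 * Gamma (1 / 2 :: real))"
    by (intro tendsto_intros) (real_asymp | simp add: Gamma_one_half_real)+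
  thus "(\<lambda>n. (real n / (real n + 1 / 2)) / (sqrt 2 * Gamma_series (1 / 2 :: real) n)) \<longlonglongrightarrow> 1 / sqrt (2 * pi)"
    by (simp add: Gamma_one_half_real real_sqrt_mult)
  show "\<forall>\<^sub>F n in sequentially. (real n / (real n + 1 / 2)) / (sqrt 2 * Gamma_series (1 / 2 :: real) n) =
      stirling_quot n ^ 2 / stirling_quot (2 * n)"
    using eventually_gt_at_top[of 0]
  proof eventually_elim
    case (elim n)
    have p: "pochhammer (1 / 2 :: real) n \<noteq> 0" using pochhammer_pos[of "1/2 :: real" n] by simp
    have e: "exp ((real n + 1 / 2) * ln (real n) - real n) ^ 2 =
      exp ((real (2 * n) + 1 / 2) * ln (real (2 * n)) - real (2 * n)) * (exp (ln (real n) / 2) / (2 ^ (2 * n) * sqrt 2))"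
    proof -
      have "2 ^ (2 * n) * sqrt 2 = exp ((2 * real n + 1 / 2) * ln 2)"
        by (simp add: ln_sqrt exp_add distrib_right flip: powr_realpow powr_half_sqrt) (simp add: powr_def mult_ac)
      thus ?thesis using elim by (simp add: ln_mult algebra_simps flip: exp_add exp_diff exp_double)
    qed
    have "stirling_quot n ^ 2 / stirling_quot (2 * n) = exp (ln (real n) / 2) / (2 ^ (2 * n) * sqrt 2) * (fact (2 * n) / fact n ^ 2)"
      unfolding stirling_quot_def power_divide e by simp
    also have "\<dots> = exp (ln (real n) / 2) / sqrt 2 * pochhammer (1 / 2) n / fact n"
      unfolding fact_double by (simp add: power2_eq_square)
    also have "\<dots> = (real n / (real n + 1 / 2)) / (sqrt 2 * Gamma_series (1 / 2 :: real) n)"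
    proof -
      define e where "e = exp (ln (real n) / 2)"
      define h where "h = real n + 1 / 2"
      have e: "real n = e * e" "e \<noteq> 0" using elim by (simp_all add: e_def flip: exp_add)
      have h: "h \<noteq> 0" by (simp add: h_def)
      have G: "Gamma_series (1 / 2 :: real) n = fact n * e / (pochhammer (1 / 2) n * h)"
        by (simp add: Gamma_series_def pochhammer_Suc e_def h_def add.commute)
      have "(real n / h) / (sqrt 2 * Gamma_series (1 / 2 :: real) n) = real n * pochhammer (1 / 2) n / (sqrt 2 * fact n * e)"
        unfolding G using p h by (simp add: field_simps)
      also have "\<dots> = e / sqrt 2 * pochhammer (1 / 2) n / fact n"
        using e(2) by (simp add: e(1))
      finally show ?thesis by (simp add: e_def h_def)
    qed
    finally show ?case by simp
  qed
qed

text \<open>Outside the row n = 0 the cone at x is the cone at x + tau, so the difference of the two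
  lattice sums isolates one row.\<close>

lemma log_rem_row:
  assumes "Im \<tau> > 0" "Im x > 0"
  shows "(\<lambda>m. log_rem 1 \<tau> (x + of_nat m)) sums
    (log_Gamma2 (x + \<tau>) 1 \<tau> - log_Gamma2 x 1 \<tau> + log_poly 1 \<tau> x - log_poly 1 \<tau> (x + \<tau>))"
proof -
  let ?f = "\<lambda>y i. log_rem 1 \<tau> (lattice_point y 1 \<tau> i)"
  let ?A = "range (\<lambda>m. (m, 0) :: nat \<times> nat)" and ?B = "range (\<lambda>(m, n). (m, Suc n) :: nat \<times> nat)"
  have U: "UNIV = ?A \<union> ?B"
  proof -
    have "(m, n) \<in> ?A \<union> ?B" for m n by (cases n) force+
    thus ?thesis by auto
  qed
  have s: "?f x summable_on A" for A
    by (rule summable_on_subset_banach[OF log_rem_summable_Im[OF assms]]) auto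
  have "infsum (?f x) (?A \<union> ?B) = infsum (?f x) ?A + infsum (?f x) ?B"
    by (rule infsum_Un_disjoint[OF s s]) auto
  hence "infsum (?f x) UNIV = infsum (?f x) ?A + infsum (?f x) ?B"
    by (simp only: U[symmetric])
  also have "infsum (?f x) ?B = infsum (?f (x + \<tau>)) UNIV"
    by (subst infsum_reindex) (auto simp: inj_on_def o_def lattice_point_def case_prod_unfold algebra_simps)
  finally have A: "infsum (?f x) ?A = infsum (?f x) UNIV - infsum (?f (x + \<tau>)) UNIV" by simp
  have "(?f x has_sum infsum (?f x) ?A) ?A" using s by (rule has_sum_infsum)
  hence "((?f x \<circ> (\<lambda>m. (m, 0))) has_sum infsum (?f x) ?A) UNIV"
    by (subst (asm) has_sum_reindex) (auto simp: inj_on_def)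
  hence "(\<lambda>m. log_rem 1 \<tau> (x + of_nat m)) sums infsum (?f x) ?A"
    by (intro has_sum_imp_sums) (simp add: o_def lattice_point_def)
  thus ?thesis by (simp add: A log_Gamma2_def algebra_simps)
qed

text \<open>Since \<open>log_rem\<close> is a mixed difference plus a logarithm, the row telescopes
  in direction 1 up to the sum of logarithms.\<close>

lemma log_rem_row_partial:
  "(\<Sum>m<N. log_rem 1 \<tau> (x + of_nat m)) =
    (log_poly 1 \<tau> x - log_poly 1 \<tau> (x + \<tau>)) - (log_poly 1 \<tau> (x + of_nat N) - log_poly 1 \<tau> (x + of_nat N + \<tau>))
      + (\<Sum>m<N. Ln (x + of_nat m))"
proof -
  define D where "D = (\<lambda>m. log_poly 1 \<tau> (x + of_nat m) - log_poly 1 \<tau> (x + of_nat m + \<tau>))"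
  have "log_rem 1 \<tau> (x + of_nat m) = (D m - D (Suc m)) + Ln (x + of_nat m)" for m
    by (simp add: D_def log_rem_def log_poly_def diff2_def log_tower_numeral algebra_simps sum_subtractf sum.distrib)
  hence "(\<Sum>m<N. log_rem 1 \<tau> (x + of_nat m)) = (\<Sum>m<N. D m - D (Suc m)) + (\<Sum>m<N. Ln (x + of_nat m))"
    by (simp add: sum.distrib)
  also have "(\<Sum>m<N. D m - D (Suc m)) = D 0 - D N" by (rule sum_lessThan_telescope')
  finally show ?thesis by (simp add: D_def)
qed

text \<open>Taylor expansion in the fixed step tau: every remainder involves entry 3 of the tower,
  which is -1 / v and tends to 0 along the row.\<close>

lemma log_tower_taylor_tendsto:
  assumes "Im \<tau> > 0" "Im x > 0" "k \<le> 2"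
  shows "(\<lambda>N. log_tower k (x + of_nat N + \<tau>) - (\<Sum>i\<le>2 - k. log_tower (k + i) (x + of_nat N) * \<tau> ^ i / fact i)) \<longlonglongrightarrow> 0"
proof (rule Lim_null_comparison)
  \<comment> \<open>Every point of the segment from x + N to x + N + tau has norm at least N -
    R.\<close>
  define R where "R = norm x + norm \<tau>"
  show "(\<lambda>N. 1 / (real N - R) * norm \<tau> ^ Suc (2 - k) / fact (2 - k)) \<longlonglongrightarrow> 0"
  proof -
    have "(\<lambda>N. 1 / (real N - R)) \<longlonglongrightarrow> 0" by real_asymp
    hence "(\<lambda>N. 1 / (real N - R) * (norm \<tau> ^ Suc (2 - k) / fact (2 - k))) \<longlonglongrightarrow> 0"
      by (rule tendsto_mult_left_zero)
    thus ?thesis by simp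
  qed
  obtain N0 :: nat where N0: "real N0 > R" using reals_Archimedean2 by blast
  show "\<forall>\<^sub>F N in sequentially. norm (log_tower k (x + of_nat N + \<tau>) -
     (\<Sum>i\<le>2 - k. log_tower (k + i) (x + of_nat N) * \<tau> ^ i / fact i)) \<le> 1 / (real N - R) * norm \<tau> ^ Suc (2 - k) / fact (2 - k)"
    using eventually_ge_at_top[of N0]
  proof eventually_elim
    case (elim N)
    define u where "u = x + of_nat N"
    let ?S = "closed_segment u (u + \<tau>)"
    have seg: "Im v > 0 \<and> norm v \<ge> real N - R" if v: "v \<in> ?S" for v
    proof -
      obtain t where t': "0 \<le> t" "t \<le> 1" "v = (1 - t) *\<^sub>R u + t *\<^sub>R (u + \<tau>)"
        using v unfolding in_segment by blast
      have "(1 - t) *\<^sub>R u + t *\<^sub>R (u + \<tau>) = u + of_real t * \<tau>"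
        by (simp add: scaleR_conv_of_real algebra_simps)
      with t' have t: "0 \<le> t" "t \<le> 1" "v = u + of_real t * \<tau>" by auto
      have "norm (of_real t * \<tau>) \<le> 1 * norm \<tau>" using t unfolding norm_mult by (intro mult_right_mono) auto
      moreover have "of_nat N = v - x - of_real t * \<tau>" by (simp add: t u_def)
      hence "norm (of_nat N :: complex) \<le> norm v + norm x + norm (of_real t * \<tau>)"
        by (metis norm_triangle_ineq4 order_trans add_right_mono)
      ultimately have "norm v \<ge> real N - R" by (simp add: R_def)
      thus ?thesis using t assms by (auto simp: u_def intro!: add_pos_nonneg)
    qed
    have "norm ((\<lambda>i. log_tower (k + i)) 0 (u + \<tau>) - (\<Sum>i\<le>2 - k. (\<lambda>i. log_tower (k + i)) i u * (u + \<tau> - u) ^ i / fact i))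
        \<le> 1 / (real N - R) * norm (u + \<tau> - u) ^ Suc (2 - k) / fact (2 - k)"
    proof (rule complex_Taylor[of ?S])
      show "(log_tower (k + i) has_field_derivative log_tower (k + Suc i) v) (at v within ?S)"
        if "v \<in> ?S" "i \<le> 2 - k" for i v
        using log_tower_deriv[OF notin_nonpos_Reals_Im, of v "k + i"] seg[OF that(1)] that(2) assms(3)
        by (auto intro: has_field_derivative_at_within)
      show "norm (log_tower (k + Suc (2 - k)) v) \<le> 1 / (real N - R)" if "v \<in> ?S" for v
      proof -
        have "norm (log_tower (k + Suc (2 - k)) v) = 1 / norm v" using assms(3) by (simp add: log_tower_def norm_divide)
        also have "\<dots> \<le> 1 / (real N - R)" using seg[OF that] elim N0 by (intro divide_left_mono mult_pos_pos) auto
        finally show ?thesis .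
      qed
    qed auto
    thus ?case by (simp add: u_def)
  qed
qed

text \<open>The Taylor terms combine to \<open>log_tower 1 u - log_tower 2 u / 2\<close>: the
  second-order contribution tau / 2 cancels against part of the coefficient -(1 + tau) / 2. What
  remains is Stirling's approximation to log Gamma without its constant, free of tau.\<close>

lemma log_poly_diff_tendsto:
  assumes "Im \<tau> > 0" "Im x > 0"
  shows "(\<lambda>N. (log_poly 1 \<tau> (x + of_nat N) - log_poly 1 \<tau> (x + of_nat N + \<tau>)) -
     ((x + of_nat N - 1 / 2) * Ln (x + of_nat N) - (x + of_nat N))) \<longlonglongrightarrow> 0"
proof -
  have t: "\<tau> \<noteq> 0" using assms by auto
  define E where "E = (\<lambda>k N. log_tower k (x + of_nat N + \<tau>) - (\<Sum>i\<le>2 - k. log_tower (k + i) (x + of_nat N) * \<tau> ^ i / fact i))"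
  have "(\<lambda>N. - (\<Sum>k\<le>2. em_coeff 1 \<tau> k * E k N)) \<longlonglongrightarrow> - (\<Sum>k\<le>2. em_coeff 1 \<tau> k * 0)"
    unfolding E_def using assms by (intro tendsto_intros log_tower_taylor_tendsto) auto
  moreover have "- (\<Sum>k\<le>2. em_coeff 1 \<tau> k * E k N) = (log_poly 1 \<tau> (x + of_nat N) - log_poly 1 \<tau> (x + of_nat N + \<tau>)) -
     ((x + of_nat N - 1 / 2) * Ln (x + of_nat N) - (x + of_nat N))" for N
  proof -
    define u where "u = x + of_nat N"
    have c: "em_coeff 1 \<tau> 0 = 1 / \<tau>" "em_coeff 1 \<tau> (Suc 0) = - (1 + \<tau>) / (2 * \<tau>)"
      using em_coeff_values[of 1 \<tau>] t by simp_all
    have "- (\<Sum>k\<le>2. em_coeff 1 \<tau> k * E k N) = (log_poly 1 \<tau> u - log_poly 1 \<tau> (u + \<tau>))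
       + (em_coeff 1 \<tau> 0 * (log_tower 1 u * \<tau> + log_tower 2 u * \<tau>\<^sup>2 / 2) + em_coeff 1 \<tau> 1 * log_tower 2 u * \<tau>)"
      by (simp add: E_def log_poly_def u_def eval_nat_numeral algebra_simps)
    also have "em_coeff 1 \<tau> 0 * (log_tower 1 u * \<tau> + log_tower 2 u * \<tau>\<^sup>2 / 2) + em_coeff 1 \<tau> 1 * log_tower 2 u * \<tau>
       = log_tower 1 u - log_tower 2 u / 2"
      using t by (simp add: c field_simps power2_eq_square)
    also have "\<dots> = - ((u - 1 / 2) * Ln u - u)" by (simp add: log_tower_numeral algebra_simps)
    finally show ?thesis by (simp add: u_def)
  qed
  ultimately show ?thesis by simp
qed

text \<open>Exponentiating turns the sum of logarithms into a Pochhammer product, so that no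
  branches have to be compared.\<close>

lemma log_Gamma2_diff_limit:
  assumes "Im \<tau> > 0" "Im x > 0"
  shows "(\<lambda>N. exp ((x + of_nat N - 1 / 2) * Ln (x + of_nat N) - (x + of_nat N)) / pochhammer x N)
    \<longlonglongrightarrow> exp (log_Gamma2 x 1 \<tau> - log_Gamma2 (x + \<tau>) 1 \<tau>)"
proof -
  define D where "D = (\<lambda>N. log_poly 1 \<tau> (x + of_nat N) - log_poly 1 \<tau> (x + of_nat N + \<tau>))"
  define g where "g = (\<lambda>N. (x + of_nat N - 1 / 2) * Ln (x + of_nat N) - (x + of_nat N))"
  let ?q = "log_poly 1 \<tau> x - log_poly 1 \<tau> (x + \<tau>)"
  have "(\<lambda>N. ?q - D N + (\<Sum>m<N. Ln (x + of_nat m))) \<longlonglongrightarrow>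
     log_Gamma2 (x + \<tau>) 1 \<tau> - log_Gamma2 x 1 \<tau> + log_poly 1 \<tau> x - log_poly 1 \<tau> (x + \<tau>)"
    using log_rem_row[OF assms] unfolding sums_def log_rem_row_partial D_def .
  from tendsto_diff[OF tendsto_const[of ?q] tendsto_add[OF this log_poly_diff_tendsto[OF assms]]]
  have "(\<lambda>N. g N - (\<Sum>m<N. Ln (x + of_nat m))) \<longlonglongrightarrow> log_Gamma2 x 1 \<tau> - log_Gamma2 (x + \<tau>) 1 \<tau>"
    by (simp add: D_def g_def algebra_simps)
  hence "(\<lambda>N. exp (g N - (\<Sum>m<N. Ln (x + of_nat m)))) \<longlonglongrightarrow> exp (log_Gamma2 x 1 \<tau> - log_Gamma2 (x + \<tau>) 1 \<tau>)"
    by (rule tendsto_exp)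
  moreover have "exp (\<Sum>m<N. Ln (x + of_nat m)) = pochhammer x N" for N
  proof -
    have "x + of_nat m \<noteq> 0" for m using assms by (auto simp: complex_eq_iff)
    thus ?thesis by (simp add: exp_sum pochhammer_prod atLeast0LessThan)
  qed
  ultimately show ?thesis by (simp add: exp_diff g_def)
qed

text \<open>Split log (x + N) into log N + log (1 + x / N); the term N log (1 + x / N) tends to x
  and cancels the -x.\<close>

lemma stirling_shift_tendsto:
  assumes "Im x > 0"
  shows "(\<lambda>N. (x + of_nat N + 1 / 2) * Ln (x + of_nat N) - (x + of_nat N)
     - x * of_real (ln (real N)) - of_real ((real N + 1 / 2) * ln (real N) - real N)) \<longlonglongrightarrow> 0"
proof (rule Lim_transform_eventually)
  have z: "(\<lambda>N. x / of_nat N) \<longlonglongrightarrow> 0" by (rule lim_const_over_n)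
  have "(\<lambda>N. Ln (1 + x / of_nat N)) \<longlonglongrightarrow> Ln (1 + 0)" by (intro tendsto_intros z) auto
  hence L: "(\<lambda>N. Ln (1 + x / of_nat N)) \<longlonglongrightarrow> 0" by simp
  have "((\<lambda>h. Ln (1 + h)) has_field_derivative 1) (at 0)"
    by (auto intro!: derivative_eq_intros)
  hence "((\<lambda>h. Ln (1 + h) / h) \<longlongrightarrow> 1) (at 0)" by (simp add: DERIV_def)
  moreover have x0: "x \<noteq> 0" using assms by auto
  hence "filterlim (\<lambda>N. x / of_nat N) (at 0) sequentially"
    using z eventually_gt_at_top[of 0] by (auto simp: filterlim_at elim!: eventually_mono)
  ultimately have "(\<lambda>N. Ln (1 + x / of_nat N) / (x / of_nat N)) \<longlonglongrightarrow> 1" by (rule filterlim_compose)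
  hence "(\<lambda>N. x * (Ln (1 + x / of_nat N) / (x / of_nat N)) + (x + 1 / 2) * Ln (1 + x / of_nat N) - x) \<longlonglongrightarrow> x * 1 + (x + 1 / 2) * 0 - x"
    by (rule tendsto_diff[OF tendsto_add[OF tendsto_mult[OF tendsto_const] tendsto_mult[OF tendsto_const L]] tendsto_const])
  thus "(\<lambda>N. x * (Ln (1 + x / of_nat N) / (x / of_nat N)) + (x + 1 / 2) * Ln (1 + x / of_nat N) - x) \<longlonglongrightarrow> 0" by simp
  show "\<forall>\<^sub>F N in sequentially. x * (Ln (1 + x / of_nat N) / (x / of_nat N)) + (x + 1 / 2) * Ln (1 + x / of_nat N) - x =
     (x + of_nat N + 1 / 2) * Ln (x + of_nat N) - (x + of_nat N)
     - x * of_real (ln (real N)) - of_real ((real N + 1 / 2) * ln (real N) - real N)"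
    using eventually_gt_at_top[of 0]
  proof eventually_elim
    case (elim N)
    have nz: "1 + x / of_nat N \<noteq> 0" using assms elim by (auto simp: complex_eq_iff)
    have "x + of_nat N = of_real (real N) * (1 + x / of_nat N)" using elim by (simp add: field_simps)
    hence "Ln (x + of_nat N) = of_real (ln (real N)) + Ln (1 + x / of_nat N)"
      using Ln_times_of_real[of "real N" "1 + x / of_nat N"] nz elim by simp
    thus ?case using x0 elim by (simp add: field_simps)
  qed
qed

text \<open>Dividing the row limit by Euler's limit for Gamma x leaves
  \<open>stirling_quot N\<close>, which therefore converges to M / Gamma x; duplication identifies
  this nonzero limit.\<close>

lemma exp_log_Gamma2_shift:
  assumes "Im \<tau> > 0" "Im x > 0"
  shows "exp (log_Gamma2 x 1 \<tau>) = exp (log_Gamma2 (x + \<tau>) 1 \<tau>) * (Gamma x / of_real (sqrt (2 * pi)))"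
proof -
  define M where "M = exp (log_Gamma2 x 1 \<tau> - log_Gamma2 (x + \<tau>) 1 \<tau>)"
  define A where "A = (\<lambda>N. exp ((x + of_nat N - 1 / 2) * Ln (x + of_nat N) - (x + of_nat N)) / pochhammer x N)"
  define d where "d = (\<lambda>N. (x + of_nat N + 1 / 2) * Ln (x + of_nat N) - (x + of_nat N)
     - x * of_real (ln (real N)) - of_real ((real N + 1 / 2) * ln (real N) - real N))"
  have xi: "x \<notin> \<int>\<^sub>\<le>\<^sub>0" using assms by (auto elim!: nonpos_Ints_cases)
  have G: "Gamma x \<noteq> 0" using xi by (simp add: Gamma_eq_zero_iff)
  have xn: "x + of_nat N \<noteq> 0" for N using assms by (auto simp: complex_eq_iff)
  have "(\<lambda>N. A N / Gamma_series x N * exp (- d N)) \<longlonglongrightarrow> M / Gamma x * exp (- 0)"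
    unfolding A_def M_def d_def
    by (intro tendsto_intros log_Gamma2_diff_limit assms stirling_shift_tendsto G)
  moreover have "\<forall>\<^sub>F N in sequentially. A N / Gamma_series x N * exp (- d N) = of_real (stirling_quot N)"
    using eventually_gt_at_top[of 0]
  proof eventually_elim
    case (elim N)
    have p: "pochhammer x N \<noteq> 0" using xn by (auto simp: pochhammer_prod)
    define u where "u = x + of_nat N"
    \<comment> \<open>\<open>Gamma_series\<close> has one more Pochhammer factor than A; the surplus
      factor u raises the exponent u - 1/2 to u + 1/2.\<close>
    have eu: "exp ((u - 1 / 2) * Ln u - u) * u = exp ((u + 1 / 2) * Ln u - u)"
    proof -
      have "exp ((u + 1 / 2) * Ln u - u) = exp ((u - 1 / 2) * Ln u - u) * exp (Ln u)"
        by (simp add: algebra_simps flip: exp_add)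
      thus ?thesis using xn[of N] by (simp add: u_def)
    qed
    have "A N / Gamma_series x N = exp ((u - 1 / 2) * Ln u - u) * u / (fact N * exp (x * of_real (ln (real N))))"
      using p xn[of N] by (simp add: A_def Gamma_series_def pochhammer_Suc u_def field_simps)
    also have "exp ((u - 1 / 2) * Ln u - u) * u = exp (d N) * exp (of_real ((real N + 1 / 2) * ln (real N) - real N)) * exp (x * of_real (ln (real N)))"
    proof -
      have "(u + 1 / 2) * Ln u - u = d N + of_real ((real N + 1 / 2) * ln (real N) - real N) + x * of_real (ln (real N))"
        by (simp add: d_def u_def)
      thus ?thesis unfolding eu by (simp only: exp_add)
    qed
    also have "\<dots> / (fact N * exp (x * of_real (ln (real N)))) = exp (d N) * (exp (of_real ((real N + 1 / 2) * ln (real N) - real N)) / fact N)"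
      by simp
    also have "exp (of_real ((real N + 1 / 2) * ln (real N) - real N)) / fact N = complex_of_real (stirling_quot N)"
      by (simp only: stirling_quot_def of_real_divide exp_of_real of_real_fact)
    finally show ?case by (simp add: exp_minus)
  qed
  ultimately have st: "(\<lambda>N. complex_of_real (stirling_quot N)) \<longlonglongrightarrow> M / Gamma x"
    by (auto intro: Lim_transform_eventually)
  have c0: "M / Gamma x \<noteq> 0" using G by (simp add: M_def)
  have "filterlim (\<lambda>n. 2 * n) sequentially sequentially"
    by (rule filterlim_subseq) (auto simp: strict_mono_def)
  from filterlim_compose[OF st this]
  have "(\<lambda>N. complex_of_real (stirling_quot N) ^ 2 / complex_of_real (stirling_quot (2 * N))) \<longlonglongrightarrow> (M / Gamma x) ^ 2 / (M / Gamma x)"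
    by (intro tendsto_intros st c0)
  moreover have "(\<lambda>N. complex_of_real (stirling_quot N ^ 2 / stirling_quot (2 * N))) \<longlonglongrightarrow> of_real (1 / sqrt (2 * pi))"
    by (intro tendsto_of_real stirling_quot_duplication)
  ultimately have "(M / Gamma x) ^ 2 / (M / Gamma x) = of_real (1 / sqrt (2 * pi))"
    using LIMSEQ_unique by (simp del: of_real_divide add: of_real_divide[symmetric] flip: of_real_power)
  hence "M / Gamma x = of_real (1 / sqrt (2 * pi))" using c0 by (simp add: power2_eq_square)
  hence "M = Gamma x / of_real (sqrt (2 * pi))" using G by (simp add: field_simps)
  thus ?thesis by (simp add: M_def exp_diff field_simps)
qed

section \<open>The reciprocal double gamma function\<close>

text \<open>The functional equation for 1 / Gamma_2 iterated K times, with K large enough to bring x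
  + K tau into the upper half-plane. \<open>rGamma\<close> is entire, so no poles arise.\<close>

definition rGamma2_trunc :: "nat \<Rightarrow> complex \<Rightarrow> complex \<Rightarrow> complex" where
  "rGamma2_trunc K \<tau> x = (\<Prod>k<K. of_real (sqrt (2 * pi)) * rGamma (x + of_nat k * \<tau>)) *
     exp (- log_Gamma2 (x + of_nat K * \<tau>) 1 \<tau>)"

definition rGamma2 :: "complex \<Rightarrow> complex \<Rightarrow> complex" where
  "rGamma2 \<tau> x = rGamma2_trunc (SOME K. Im (x + of_nat K * \<tau>) > 0) \<tau> x"

lemma rGamma2_trunc_Suc:
  assumes "Im \<tau> > 0" "Im (x + of_nat K * \<tau>) > 0"
  shows "rGamma2_trunc (Suc K) \<tau> x = rGamma2_trunc K \<tau> x"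
proof -
  define y where "y = x + of_nat K * \<tau>"
  have "exp (log_Gamma2 y 1 \<tau>) = exp (log_Gamma2 (y + \<tau>) 1 \<tau>) * (Gamma y / of_real (sqrt (2 * pi)))"
    using assms by (intro exp_log_Gamma2_shift) (auto simp: y_def)
  hence "inverse (exp (log_Gamma2 y 1 \<tau>)) = inverse (exp (log_Gamma2 (y + \<tau>) 1 \<tau>) * (Gamma y / of_real (sqrt (2 * pi))))"
    by simp
  hence "exp (- log_Gamma2 y 1 \<tau>) = of_real (sqrt (2 * pi)) * rGamma y * exp (- log_Gamma2 (y + \<tau>) 1 \<tau>)"
    by (simp add: exp_minus rGamma_inverse_Gamma divide_inverse mult_ac)
  moreover have "x + of_nat (Suc K) * \<tau> = y + \<tau>" by (simp add: y_def algebra_simps)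
  ultimately show ?thesis by (simp add: rGamma2_trunc_def flip: y_def)
qed

lemma rGamma2_trunc_agree:
  assumes "Im \<tau> > 0" "Im (x + of_nat K * \<tau>) > 0" "Im (x + of_nat K' * \<tau>) > 0"
  shows "rGamma2_trunc K \<tau> x = rGamma2_trunc K' \<tau> x"
proof -
  have add: "rGamma2_trunc (K + n) \<tau> x = rGamma2_trunc K \<tau> x" if "Im (x + of_nat K * \<tau>) > 0" for K n
  proof (induction n)
    case (Suc n)
    have "0 \<le> real n * Im \<tau>" using assms(1) by simp
    moreover have "Im (x + of_nat (K + n) * \<tau>) = Im (x + of_nat K * \<tau>) + real n * Im \<tau>"
      by (simp add: algebra_simps)
    ultimately have "Im (x + of_nat (K + n) * \<tau>) > 0" using that by linarith
    thus ?case using rGamma2_trunc_Suc[OF assms(1), of x "K + n"] Suc by simp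
  qed simp
  show ?thesis
    using add[OF assms(2), of K'] add[OF assms(3), of K] by (simp add: add.commute)
qed

lemma ex_Im_pos: "Im \<tau> > 0 \<Longrightarrow> \<exists>K. Im (x + of_nat K * \<tau>) > 0"
proof -
  assume "Im \<tau> > 0"
  then obtain n :: nat where "- Im x < of_nat n * Im \<tau>" using ex_less_of_nat_mult by blast
  thus ?thesis by (intro exI[of _ n]) simp
qed

lemma rGamma2_eq_trunc:
  assumes "Im \<tau> > 0" "Im (x + of_nat K * \<tau>) > 0"
  shows "rGamma2 \<tau> x = rGamma2_trunc K \<tau> x"
proof -
  have "Im (x + of_nat (SOME K. Im (x + of_nat K * \<tau>) > 0) * \<tau>) > 0"
    using assms(2) by (rule someI)
  thus ?thesis unfolding rGamma2_def by (rule rGamma2_trunc_agree[OF assms(1) _ assms(2)])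
qed

lemma rGamma2_upper: "Im \<tau> > 0 \<Longrightarrow> Im x > 0 \<Longrightarrow> rGamma2 \<tau> x = exp (- log_Gamma2 x 1 \<tau>)"
  using rGamma2_eq_trunc[of \<tau> x 0] by (simp add: rGamma2_trunc_def)

lemma rGamma2_shift:
  assumes "Im \<tau> > 0"
  shows "rGamma2 \<tau> x = of_real (sqrt (2 * pi)) * rGamma x * rGamma2 \<tau> (x + \<tau>)"
proof -
  obtain K where K: "Im (x + of_nat K * \<tau>) > 0" using ex_Im_pos[OF assms] by blast
  have "rGamma2 \<tau> x = rGamma2_trunc (Suc K) \<tau> x"
    using K assms by (intro rGamma2_eq_trunc) (auto simp: algebra_simps)
  also have "\<dots> = of_real (sqrt (2 * pi)) * rGamma x * rGamma2_trunc K \<tau> (x + \<tau>)"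
    unfolding rGamma2_trunc_def prod.lessThan_Suc_shift by (simp add: algebra_simps)
  also have "rGamma2_trunc K \<tau> (x + \<tau>) = rGamma2 \<tau> (x + \<tau>)"
    using K assms by (intro rGamma2_eq_trunc[symmetric]) (auto simp: algebra_simps)
  finally show ?thesis .
qed

section \<open>Joint holomorphy of the reciprocal\<close>

lemma holo2_on_compose2:
  assumes "holo2_on f S" "holo2_on g U" "holo2_on g' U" "\<And>p. p \<in> U \<Longrightarrow> (g p, g' p) \<in> S"
  shows "holo2_on (\<lambda>p. f (g p, g' p)) U"
  unfolding holo2_on_def
proof
  fix p assume p: "p \<in> U"
  then obtain a b c d where g: "(g has_derivative (\<lambda>(h, k). a * h + b * k)) (at p)"
    "(g' has_derivative (\<lambda>(h, k). c * h + d * k)) (at p)"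
    using assms(2,3) unfolding holo2_on_def by blast
  obtain u v where "(f has_derivative (\<lambda>(h, k). u * h + v * k)) (at (g p, g' p))"
    using assms(1) assms(4)[OF p] unfolding holo2_on_def by blast
  from has_derivative_compose[OF has_derivative_Pair[OF g] this]
  have "((\<lambda>p. f (g p, g' p)) has_derivative (\<lambda>(h, k). (u * a + v * c) * h + (u * b + v * d) * k)) (at p)"
    by (rule has_derivative_eq_rhs) (auto simp: algebra_simps)
  thus "\<exists>a b. ((\<lambda>p. f (g p, g' p)) has_derivative (\<lambda>(h, k). a * h + b * k)) (at p)" by blast
qed

lemma holo2_on_local:
  assumes "\<And>p. p \<in> U \<Longrightarrow> \<exists>V g. open V \<and> p \<in> V \<and> holo2_on g V \<and> (\<forall>q\<in>V. f q = g q)"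
  shows "holo2_on f U"
  unfolding holo2_on_def
proof
  fix p assume "p \<in> U"
  from assms[OF this] obtain V g where V: "open V" "p \<in> V" "holo2_on g V" "\<And>q. q \<in> V \<Longrightarrow> g q = f q"
    by metis
  then obtain a b where "(g has_derivative (\<lambda>(h, k). a * h + b * k)) (at p)"
    unfolding holo2_on_def by blast
  hence "(f has_derivative (\<lambda>(h, k). a * h + b * k)) (at p)"
    using V(1,2,4) by (rule has_derivative_transform_within_open)
  thus "\<exists>a b. (f has_derivative (\<lambda>(h, k). a * h + b * k)) (at p)" by blast
qed

lemma holo2_rGamma2: "holo2_on (\<lambda>p. rGamma2 (fst p) (snd p)) HC"
proof (rule holo2_on_local)
  fix p assume "p \<in> HC"
  hence I: "Im (fst p) > 0" by (auto simp: HC_def)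
  then obtain K where K: "Im (snd p + of_nat K * fst p) > 0" using ex_Im_pos by blast
  \<comment> \<open>The same K serves a whole neighbourhood, where the choice in the definition
    becomes one explicit product.\<close>
  define V where "V = {p. Im (fst p) > 0} \<inter> {p. Im (snd p + of_nat K * fst p) > 0}"
  have "open V" unfolding V_def
    by (intro open_Int open_Collect_less continuous_intros)
  moreover have "p \<in> V" using I K by (auto simp: V_def)
  moreover have "holo2_on (\<lambda>p. rGamma2_trunc K (fst p) (snd p)) V"
  proof -
    have lin: "holo2_on (\<lambda>p. snd p + of_nat k * fst p) V" for k by (intro holo2_intros)
    have "holo2_on (\<lambda>p. rGamma (snd p + of_nat k * fst p)) V" for k
      by (rule holo2_on_compose[OF holomorphic_rGamma[of UNIV] open_UNIV lin]) simp
    moreover have "holo2_on (\<lambda>p. log_Gamma2 (snd (fst p, snd p + of_nat K * fst p)) 1 (fst (fst p, snd p + of_nat K * fst p))) V"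
      by (rule holo2_on_compose2[OF holo2_log_Gamma2 holo2_on_fst lin]) (auto simp: V_def HH_def)
    hence "holo2_on (\<lambda>p. exp (- log_Gamma2 (snd p + of_nat K * fst p) 1 (fst p))) V"
      by (intro holo2_on_compose[OF holomorphic_on_exp open_UNIV holo2_on_uminus]) auto
    ultimately show ?thesis unfolding rGamma2_trunc_def by (intro holo2_intros)
  qed
  moreover have "\<forall>q\<in>V. rGamma2 (fst q) (snd q) = rGamma2_trunc K (fst q) (snd q)"
    by (auto simp: V_def intro!: rGamma2_eq_trunc)
  ultimately show "\<exists>V g. open V \<and> p \<in> V \<and> holo2_on g V \<and> (\<forall>q\<in>V. rGamma2 (fst q) (snd q) = g q)"
    by blast
qed

lemma rGamma2_holomorphic:
  assumes "Im \<tau> > 0" shows "rGamma2 \<tau> holomorphic_on A"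
  unfolding holomorphic_on_def
proof
  fix x
  have "(\<tau>, x) \<in> HC" using assms by (simp add: HC_def)
  then obtain a b where ab: "((\<lambda>p. rGamma2 (fst p) (snd p)) has_derivative (\<lambda>(h, k). a * h + b * k)) (at (\<tau>, x))"
    using holo2_rGamma2 unfolding holo2_on_def by blast
  have "((\<lambda>y. (\<tau>, y)) has_derivative (\<lambda>k. (0, k))) (at x)"
    by (auto intro!: derivative_eq_intros)
  from has_derivative_compose[OF this ab] have "(rGamma2 \<tau> has_field_derivative b) (at x)"
    by (simp add: has_field_derivative_def)
  thus "rGamma2 \<tau> field_differentiable at x within A"
    using field_differentiable_def field_differentiable_at_within by blast
qed

section \<open>Rotation of the parameters\<close>

text \<open>Coefficient k is homogeneous of degree k - 2 in the parameters, and the tower has the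
  opposite degree in u apart from its logarithm. Scaling is thus felt only by the logarithm, whose
  total coefficient is -B / 2.\<close>

lemma log_poly_scale:
  assumes "l \<noteq> 0" "a1 \<noteq> 0" "a2 \<noteq> 0" "Ln (l * u) = Ln u + c"
  shows "log_poly (l * a1) (l * a2) (l * u) = log_poly a1 a2 u - c / 2 * B22 u a1 a2"
proof -
  have T: "log_tower 0 (l * u) = l\<^sup>2 * (log_tower 0 u - u\<^sup>2 * c / 2)"
    "log_tower 1 (l * u) = l * (log_tower 1 u - u * c)" "log_tower 2 (l * u) = log_tower 2 u - c"
    unfolding One_nat_def log_tower_numeral assms(4) by (simp_all add: power_mult_distrib algebra_simps)
  have la: "l * a1 \<noteq> 0" "l * a2 \<noteq> 0" using assms by auto
  have C: "em_coeff (l * a1) (l * a2) 0 = em_coeff a1 a2 0 / l\<^sup>2"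
    "em_coeff (l * a1) (l * a2) 1 = em_coeff a1 a2 1 / l" "em_coeff (l * a1) (l * a2) 2 = em_coeff a1 a2 2"
    unfolding em_coeff_values[OF la] em_coeff_values[OF assms(2,3)] using assms(1)
    by (simp_all add: power2_eq_square divide_simps) (simp_all add: algebra_simps)
  have S: "(\<Sum>k\<le>2. f k) = f 0 + f 1 + f 2" for f :: "nat \<Rightarrow> complex" by (simp add: eval_nat_numeral)
  have "log_poly (l * a1) (l * a2) (l * u) = log_poly a1 a2 u -
      c / 2 * (em_coeff a1 a2 0 * u\<^sup>2 + 2 * em_coeff a1 a2 1 * u + 2 * em_coeff a1 a2 2)"
    unfolding log_poly_def S C T using assms(1) by (simp add: field_simps)
  also have "em_coeff a1 a2 0 * u\<^sup>2 + 2 * em_coeff a1 a2 1 * u + 2 * em_coeff a1 a2 2 = B22 u a1 a2"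
    unfolding em_coeff_values[OF assms(2,3)] B22_def using assms(2,3) by (simp add: field_simps)
  finally show ?thesis .
qed

lemma diff2_B22:
  assumes "a1 \<noteq> 0" "a2 \<noteq> 0"
  shows "diff2 a1 a2 (\<lambda>u. B22 u a1 a2) u = 2"
proof -
  have "diff2 a1 a2 (\<lambda>u. B22 u a1 a2) u = diff2 a1 a2 (\<lambda>u. u\<^sup>2) u / (a1 * a2) - (1 / a1 + 1 / a2) * diff2 a1 a2 (\<lambda>u. u) u"
    by (simp add: diff2_def B22_def diff_divide_distrib add_divide_distrib algebra_simps)
  also have "diff2 a1 a2 (\<lambda>u. u\<^sup>2) u = 2 * (a1 * a2)" by (simp add: diff2_def power2_eq_square algebra_simps)
  also have "diff2 a1 a2 (\<lambda>u. u) u = 0" by (simp add: diff2_def)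
  finally show ?thesis using assms by simp
qed

lemma log_rem_eq_diff2: "log_rem a1 a2 u = diff2 a1 a2 (log_poly a1 a2) u + Ln u"
  by (simp add: log_rem_def log_poly_def diff2_def log_tower_numeral sum.distrib sum_subtractf algebra_simps)

text \<open>The change -c B / 2 of \<open>log_poly\<close> has mixed difference -c, which cancels
  the change c of the logarithm.\<close>

lemma log_rem_scale:
  assumes "l \<noteq> 0" "a1 \<noteq> 0" "a2 \<noteq> 0" "\<And>v. v \<in> {u, u + a1, u + a2, u + a1 + a2} \<Longrightarrow> Ln (l * v) = Ln v + c"
  shows "log_rem (l * a1) (l * a2) (l * u) = log_rem a1 a2 u"
proof -
  define P where "P = (\<lambda>v. log_poly (l * a1) (l * a2) (l * v))"
  have P: "P u = log_poly a1 a2 u - c / 2 * B22 u a1 a2"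
    "P (u + a1) = log_poly a1 a2 (u + a1) - c / 2 * B22 (u + a1) a1 a2"
    "P (u + a2) = log_poly a1 a2 (u + a2) - c / 2 * B22 (u + a2) a1 a2"
    "P (u + a1 + a2) = log_poly a1 a2 (u + a1 + a2) - c / 2 * B22 (u + a1 + a2) a1 a2"
    unfolding P_def by (intro log_poly_scale assms; simp)+
  have "diff2 (l * a1) (l * a2) (log_poly (l * a1) (l * a2)) (l * u) = diff2 a1 a2 P u"
    by (simp add: diff2_def P_def distrib_left)
  also have "\<dots> = diff2 a1 a2 (log_poly a1 a2) u - c / 2 * diff2 a1 a2 (\<lambda>u. B22 u a1 a2) u"
    unfolding diff2_def P by (simp add: algebra_simps)
  finally have "diff2 (l * a1) (l * a2) (log_poly (l * a1) (l * a2)) (l * u) =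
    diff2 a1 a2 (log_poly a1 a2) u - c / 2 * diff2 a1 a2 (\<lambda>u. B22 u a1 a2) u" .
  thus ?thesis using assms by (simp add: log_rem_eq_diff2 diff2_B22)
qed

text \<open>The argument of v lies strictly between 0 and pi, and turning clockwise by less than pi
  / 2 does not reach the cut.\<close>

lemma Ln_rotate:
  assumes "Im v > 0" "0 \<le> m" "m < pi / 2"
  shows "Ln (exp (- \<i> * of_real m) * v) = Ln v + - \<i> * of_real m"
proof (rule Ln_unique)
  have v: "v \<noteq> 0" using assms by auto
  show "exp (Ln v + - \<i> * of_real m) = exp (- \<i> * of_real m) * v" using v by (simp add: exp_diff exp_minus divide_inverse)
  have "0 < Im (Ln v)" "Im (Ln v) < pi" using assms(1) v Im_Ln_pos_lt[of v] by auto
  thus "- pi < Im (Ln v + - \<i> * of_real m)" "Im (Ln v + - \<i> * of_real m) \<le> pi"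
    using assms by auto
qed

text \<open>All lattice remainders are invariant, so only the boundary term \<open>log_poly\<close>
  feels the rotation.\<close>

lemma log_Gamma2_rotate:
  assumes "Im \<tau> > 0" "Im x > 0" "0 \<le> m" "m < pi / 2" and l: "l = exp (- \<i> * of_real m)"
  shows "log_Gamma2 (l * x) l (l * \<tau>) = log_Gamma2 x 1 \<tau> + \<i> * of_real m / 2 * B22 x 1 \<tau>"
proof -
  have nz: "l \<noteq> 0" "\<tau> \<noteq> 0" using assms by auto
  have Ln: "Ln (l * v) = Ln v + - \<i> * of_real m" if "Im v > 0" for v
    unfolding l by (rule Ln_rotate[OF that assms(3,4)])
  have I: "Im (lattice_point x 1 \<tau> p) > 0" for p
    using assms by (auto simp: lattice_point_def case_prod_unfold intro!: add_pos_nonneg)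
  have "log_rem l (l * \<tau>) (lattice_point (l * x) l (l * \<tau>) p) = log_rem 1 \<tau> (lattice_point x 1 \<tau> p)" for p
  proof -
    have "lattice_point (l * x) l (l * \<tau>) p = l * lattice_point x 1 \<tau> p"
      by (simp add: lattice_point_def case_prod_unfold algebra_simps)
    moreover have "log_rem (l * 1) (l * \<tau>) (l * lattice_point x 1 \<tau> p) = log_rem 1 \<tau> (lattice_point x 1 \<tau> p)"
    proof (rule log_rem_scale)
      fix v assume "v \<in> {lattice_point x 1 \<tau> p, lattice_point x 1 \<tau> p + 1, lattice_point x 1 \<tau> p + \<tau>, lattice_point x 1 \<tau> p + 1 + \<tau>}"
      hence "Im v > 0" using I[of p] assms(1) by auto
      thus "Ln (l * v) = Ln v + - \<i> * of_real m" by (rule Ln)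
    qed (use nz in auto)
    ultimately show ?thesis by simp
  qed
  moreover have "log_poly l (l * \<tau>) (l * x) = log_poly 1 \<tau> x + \<i> * of_real m / 2 * B22 x 1 \<tau>"
    using log_poly_scale[of l 1 \<tau> x, OF _ _ _ Ln] nz assms by simp
  ultimately show ?thesis by (simp add: log_Gamma2_def)
qed

text \<open>With fixed parameters of positive real part, Re v alone bounds the lattice points from
  below. The result lets an identity known on part of the right half-plane extend to all of
  it.\<close>

lemma log_Gamma2_holomorphic_Re:
  assumes a: "Re a1 > 0" "Re a2 > 0"
  shows "(\<lambda>y. log_Gamma2 y a1 a2) holomorphic_on {y. Re y > 0}"
proof -
  let ?f = "\<lambda>p y. log_rem a1 a2 (lattice_point y a1 a2 p)"
  have tower: "log_tower k holomorphic_on {y. Re y > 0}" if "k \<le> 4" for k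
    unfolding holomorphic_on_def field_differentiable_def
    using has_field_derivative_at_within[OF log_tower_deriv[OF _ that]] notin_nonpos_Reals_Re by blast
  have comp: "(\<lambda>y. log_tower k (g y)) holomorphic_on {y. Re y > 0}"
    if "g holomorphic_on {y. Re y > 0}" "\<And>y. Re y > 0 \<Longrightarrow> Re (g y) > 0" "k \<le> 2" for k g
    using holomorphic_on_compose_gen[OF that(1) tower[of k]] that by (auto simp: o_def)
  have hol: "?f p holomorphic_on {y. Re y > 0}" for p
    unfolding log_rem_def diff2_def lattice_point_def case_prod_unfold using a
    by (intro holomorphic_intros comp) (auto intro!: add_pos_nonneg)
  have bound: "norm (log_rem a1 a2 u) \<le> 2 / r ^ 3 * em_const 2 a1 a2" if "r > 0" "Re u \<ge> r" for u r
  proof -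
    have T: "convex {v. Re v \<ge> r}" by (rule convex_halfspace_Re_ge)
    show ?thesis unfolding log_rem_def
    proof (rule diff2_euler_maclaurin[OF T])
      show "(log_tower k has_field_derivative log_tower (Suc k) v) (at v within {v. Re v \<ge> r})" if "v \<in> {v. Re v \<ge> r}" "k \<le> 2 + 2" for k v
        using that \<open>r > 0\<close> by (intro has_field_derivative_at_within[OF log_tower_deriv] notin_nonpos_Reals_Re) auto
      show "norm (log_tower (2 + 3) v) \<le> 2 / r ^ 3" if "v \<in> {v. Re v \<ge> r}" for v
      proof -
        have "r \<le> norm v" using that complex_Re_le_cmod[of v] by simp
        hence "2 / norm v ^ 3 \<le> 2 / r ^ 3" using \<open>r > 0\<close> by (intro divide_left_mono power_mono mult_pos_pos) auto
        moreover have "norm (log_tower (2 + 3) v) = 2 / norm v ^ 3"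
          by (simp add: log_tower_def norm_divide norm_mult eval_nat_numeral)
        ultimately show ?thesis by simp
      qed
    qed (use that a in auto)
  qed
  have "(\<lambda>y. \<Sum>\<^sub>\<infinity>p. ?f p y) field_differentiable (at y0)" if y0: "Re y0 > 0" for y0
  proof -
    define d where "d = Re y0 / 2"
    define c where "c = min d (min (Re a1) (Re a2))"
    have dc: "d > 0" "c > 0" using y0 a by (auto simp: d_def c_def)
    have Re: "Re y \<ge> d" if "y \<in> cball y0 d" for y
      using that abs_Re_le_cmod[of "y0 - y"] by (simp add: d_def dist_norm)
    have M: "norm (?f (m, n) y) \<le> 2 / c ^ 3 * em_const 2 a1 a2 * (1 + real m + real n) powr - 3" if "y \<in> cball y0 d" for y m n
    proof -
      have "c * 1 \<le> Re y" "real m * c \<le> real m * Re a1" "real n * c \<le> real n * Re a2"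
        using Re[OF that] by (auto simp: c_def intro!: mult_left_mono)
      hence "Re (lattice_point y a1 a2 (m, n)) \<ge> c * (1 + real m + real n)"
        by (simp add: lattice_point_def algebra_simps)
      hence "norm (?f (m, n) y) \<le> 2 / (c * (1 + real m + real n)) ^ 3 * em_const 2 a1 a2"
        using dc by (intro bound mult_pos_pos) auto
      thus ?thesis by (simp add: powr_minus powr_numeral power_mult_distrib divide_inverse mult_ac)
    qed
    have "uniform_limit (cball y0 d) (\<lambda>X y. \<Sum>p\<in>X. ?f p y) (\<lambda>y. \<Sum>\<^sub>\<infinity>p. ?f p y) (finite_subsets_at_top UNIV)"
    proof (rule Weierstrass_m_test_general)
      show "(\<lambda>p. 2 / c ^ 3 * em_const 2 a1 a2 * (case p of (m, n) \<Rightarrow> (1 + real m + real n) powr - 3)) summable_on (UNIV :: (nat \<times> nat) set)"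
        by (intro summable_on_cmult_right summable_on_lattice_powr) simp
    qed (use M in \<open>auto split: prod.split\<close>)
    note ul = this
    have sub: "cball y0 d \<subseteq> {y. Re y > 0}" using Re dc by force
    have "(\<lambda>y. \<Sum>\<^sub>\<infinity>p. ?f p y) holomorphic_on ball y0 d"
    proof (rule holomorphic_uniform_limit[OF _ ul])
      have "(\<lambda>y. \<Sum>p\<in>X. ?f p y) holomorphic_on cball y0 d" for X
        by (intro holomorphic_on_sum holomorphic_on_subset[OF hol sub])
      thus "\<forall>\<^sub>F X in finite_subsets_at_top UNIV. continuous_on (cball y0 d) (\<lambda>y. \<Sum>p\<in>X. ?f p y) \<and>
          (\<lambda>y. \<Sum>p\<in>X. ?f p y) holomorphic_on ball y0 d"
        by (intro always_eventually allI conjI holomorphic_on_imp_continuous_on)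
           (auto intro: holomorphic_on_subset[OF _ ball_subset_cball])
    qed auto
    thus ?thesis using dc by (auto simp: holomorphic_on_def at_within_ball)
  qed
  hence "(\<lambda>y. \<Sum>\<^sub>\<infinity>p. ?f p y) holomorphic_on {y. Re y > 0}"
    by (auto simp: holomorphic_on_def intro: field_differentiable_at_within)
  thus ?thesis unfolding log_Gamma2_def log_poly_def by (intro holomorphic_intros tower) auto
qed

lemma B22_holomorphic: "g holomorphic_on A \<Longrightarrow> a1 \<noteq> 0 \<Longrightarrow> a2 \<noteq> 0 \<Longrightarrow> (\<lambda>y. B22 (g y) a1 a2) holomorphic_on A"
  unfolding B22_def by (intro holomorphic_intros) auto

text \<open>The candidate reciprocal h is entire, so its inverse is normalized meromorphic. Rotation
  identifies h with the exponential of minus the logarithmic series where Re y and Im (y / l) are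
  positive; the identity theorem extends this to Re y > 0, and uniqueness evaluates the definite
  description.\<close>

lemma Gamma2_rhp_rotate:
  assumes \<tau>: "Im \<tau> > 0" and m: "0 \<le> m" "m < pi / 2" and l: "l = exp (- \<i> * of_real m)"
    and pos: "Re (l * \<tau>) > 0"
  shows "Gamma2_rhp (l * x) l (l * \<tau>) = exp (\<i> * of_real m / 2 * B22 x 1 \<tau>) * inverse (rGamma2 \<tau> x)"
proof -
  have nz: "l \<noteq> 0" "\<tau> \<noteq> 0" using assms by auto
  have Rl: "Re l > 0" using m by (auto simp: l Re_exp intro!: cos_gt_zero_pi)
  define h where "h = (\<lambda>y. exp (- (\<i> * of_real m / 2 * B22 (y / l) 1 \<tau>)) * rGamma2 \<tau> (y / l))"
  define G where "G = (\<lambda>y. inverse (h y))"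
  have hol: "h holomorphic_on A" for A
  proof -
    have "(\<lambda>y. y / l) holomorphic_on A" using nz by (intro holomorphic_intros) auto
    from holomorphic_on_compose[OF this rGamma2_holomorphic[OF \<tau>]]
    have "(\<lambda>y. rGamma2 \<tau> (y / l)) holomorphic_on A" by (simp add: o_def)
    thus ?thesis unfolding h_def using nz by (intro holomorphic_intros B22_holomorphic) auto
  qed
  have nm: "G nicely_meromorphic_on UNIV"
    unfolding G_def using hol[of UNIV] open_UNIV
    by (intro nicely_meromorphic_on_inverse analytic_on_imp_nicely_meromorphic_on) (simp add: analytic_on_open)
  have h_eq: "h y = exp (- log_Gamma2 y l (l * \<tau>))" if y: "Re y > 0" for y
  proof (rule analytic_continuation_open[where f = h and g = "\<lambda>y. exp (- log_Gamma2 y l (l * \<tau>))"])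
    let ?W = "{y. Re y > 0} \<inter> {y. Im (y / l) > 0}"
    show "open ?W" using nz by (intro open_Int open_Collect_less continuous_intros) auto
    \<comment> \<open>Dividing this point by l returns tau, so it lies in both half-planes.\<close>
    have "l * \<tau> \<in> ?W" using pos \<tau> nz by simp
    thus "?W \<noteq> {}" by blast
    show "h y = exp (- log_Gamma2 y l (l * \<tau>))" if "y \<in> ?W" for y
    proof -
      have "log_Gamma2 y l (l * \<tau>) = log_Gamma2 (y / l) 1 \<tau> + \<i> * of_real m / 2 * B22 (y / l) 1 \<tau>"
        using log_Gamma2_rotate[OF \<tau> _ m l, of "y / l"] that nz by simp
      moreover have "rGamma2 \<tau> (y / l) = exp (- log_Gamma2 (y / l) 1 \<tau>)"
        using that by (intro rGamma2_upper[OF \<tau>]) auto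
      ultimately show ?thesis by (simp only: h_def minus_add_distrib exp_add mult.commute)
    qed
    show "(\<lambda>y. exp (- log_Gamma2 y l (l * \<tau>))) holomorphic_on {y. Re y > 0}"
      by (intro holomorphic_intros log_Gamma2_holomorphic_Re Rl pos)
  qed (use y hol in \<open>auto simp: open_halfspace_Re_gt convex_connected convex_halfspace_Re_gt\<close>)
  let ?P = "\<lambda>G. G nicely_meromorphic_on UNIV \<and> (\<forall>y. Re y > 0 \<longrightarrow> G y = exp (deriv (zeta2 y l (l * \<tau>)) 0))"
  have PG: "?P G"
    using nm by (auto simp: G_def h_eq deriv_zeta2[OF _ Rl pos] exp_minus)
  moreover have "H = G" if "?P H" for H
  proof (rule nicely_meromorphic_unique[of _ _ "{s. Re s > 0}"])
    have "1 \<in> {s. Re s > 0}" by simp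
    thus "{s. Re s > 0} \<noteq> {}" by blast
  qed (use that PG in \<open>auto simp: open_halfspace_Re_gt\<close>)
  ultimately have "(THE G. ?P G) = G" by (rule the_equality)
  hence "Gamma2_rhp (l * x) l (l * \<tau>) = G (l * x)" by (simp add: Gamma2_rhp_def)
  thus ?thesis using nz by (simp add: G_def h_def exp_minus)
qed

text \<open>For Re tau > 0 there is no rotation, the case m = 0. Otherwise m = Arg tau / 2, because
  Arg 1 = 0, and l tau has argument m < pi / 2; the factor in the definition undoes the one produced
  by rotation.\<close>

lemma Gamma2_eq:
  assumes \<tau>: "Im \<tau> > 0"
  shows "Gamma2 x 1 \<tau> = inverse (rGamma2 \<tau> x)"
proof (cases "Re \<tau> > 0")
  case True
  thus ?thesis using Gamma2_rhp_rotate[OF \<tau>, of 0 1 x] by (simp add: Gamma2_def)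
next
  case False
  define m where "m = Arg \<tau> / 2"
  define l where "l = exp (- \<i> * of_real m)"
  have A: "0 < Arg \<tau>" "Arg \<tau> < pi" using \<tau> Arg_lt_pi[of \<tau>] by auto
  have t0: "\<tau> \<noteq> 0" using \<tau> by auto
  have "l * \<tau> = l * (of_real (norm \<tau>) * exp (\<i> * of_real (Arg \<tau>)))" using Arg_eq[OF t0] by simp
  also have "\<dots> = of_real (norm \<tau>) * exp (\<i> * of_real m)"
    by (simp add: l_def m_def mult_ac flip: exp_add)
  finally have "Re (l * \<tau>) = norm \<tau> * cos m" by (simp add: Re_exp)
  moreover have "cos m > 0" using A by (intro cos_gt_zero_pi) (auto simp: m_def)
  ultimately have "Re (l * \<tau>) > 0" using t0 by simp
  from Gamma2_rhp_rotate[OF \<tau> _ _ l_def this, of x] A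
  have "Gamma2_rhp (l * x) l (l * \<tau>) = exp (\<i> * of_real m / 2 * B22 x 1 \<tau>) * inverse (rGamma2 \<tau> x)"
    by (simp add: m_def)
  moreover have "Gamma2 x 1 \<tau> = exp (- \<i> * of_real m / 2 * B22 x 1 \<tau>) * Gamma2_rhp (l * x) l (l * \<tau>)"
    using False by (simp add: Gamma2_def Let_def l_def m_def)
  ultimately show ?thesis by (simp add: exp_minus)
qed

section \<open>Meromorphy and the difference equation of F\<close>

lemma holo2_on_inverse: "holo2_on f U \<Longrightarrow> (\<And>p. p \<in> U \<Longrightarrow> f p \<noteq> 0) \<Longrightarrow> holo2_on (\<lambda>p. inverse (f p)) U"
  by (rule holo2_on_compose[of inverse "- {0}"]) (auto intro!: holomorphic_intros)

lemma holo2_on_exp: "holo2_on f U \<Longrightarrow> holo2_on (\<lambda>p. exp (f p)) U"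
  by (rule holo2_on_compose[OF holomorphic_on_exp open_UNIV]) auto

lemma mero2_cong:
  assumes "\<And>q. q \<in> HC \<Longrightarrow> f q = g q" "mero2 g" shows "mero2 f"
proof (rule mero2I)
  fix p assume "p \<in> HC"
  with assms(2) obtain U a b where U: "open U" "p \<in> U" "U \<subseteq> HC" "holo2_on a U" "holo2_on b U"
    "U \<subseteq> closure {q\<in>U. b q \<noteq> 0}" "\<forall>q\<in>U. b q \<noteq> 0 \<longrightarrow> g q = a q / b q"
    by (rule mero2E)
  show "\<exists>U a b. open U \<and> p \<in> U \<and> U \<subseteq> HC \<and> holo2_on a U \<and> holo2_on b U \<and>
     U \<subseteq> closure {q\<in>U. b q \<noteq> 0} \<and> (\<forall>q\<in>U. b q \<noteq> 0 \<longrightarrow> f q = a q / b q)"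
    by (rule exI[of _ U], rule exI[of _ a], rule exI[of _ b]) (use U assms(1) in auto)
qed

lemma mero2_Lambda_fun:
  assumes "z \<noteq> 0" "t \<noteq> 0" "\<sigma> \<noteq> 0"
  shows "mero2 (Lambda_fun \<sigma> z t)"
proof -
  define w where "w = of_int \<sigma> * (z / (2 * of_real pi * \<i> * t))"
  define \<eta> where "\<eta> = (\<lambda>p. 1 / 2 - of_int \<sigma> * (snd p + fst p * (1 / 2)) :: complex)"
  have \<eta>: "holo2_on \<eta> U" for U unfolding \<eta>_def by (intro holo2_intros)
  have "holo2_on (\<lambda>p. rGamma (w + \<eta> p)) HC"
    by (rule holo2_on_compose[OF holomorphic_rGamma[of UNIV] open_UNIV]) (auto intro!: holo2_intros \<eta>)
  hence "mero2 (\<lambda>p. inverse (rGamma (w + \<eta> p)))" by (intro mero2_inverse holo2_imp_mero2)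
  moreover have "holo2_on (\<lambda>p. exp w * (2 * of_real pi) powr (- 1 / 2) * w powr (1 / 2 - \<eta> p - w)) HC"
    by (intro holo2_intros holo2_on_compose[OF holomorphic_on_powr_right[OF holomorphic_on_ident] open_UNIV] \<eta>) auto
  hence "mero2 (\<lambda>p. exp w * (2 * of_real pi) powr (- 1 / 2) * w powr (1 / 2 - \<eta> p - w))" by (rule holo2_imp_mero2)
  ultimately have "mero2 (\<lambda>p. inverse (rGamma (w + \<eta> p)) * (exp w * (2 * of_real pi) powr (- 1 / 2) * w powr (1 / 2 - \<eta> p - w)))"
    by (rule mero2_mult)
  thus ?thesis
    by (rule mero2_cong[rotated]) (auto simp: Lambda_fun_def Lambda1_def \<eta>_def w_def rGamma_inverse_Gamma mult_ac)
qed

text \<open>\<open>Gamma2\<close> enters as the inverse of a jointly holomorphic function; the other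
  divisions are rewritten with the inverse of tau, which is holomorphic on
  \<open>HC\<close>.\<close>

lemma mero2_F_fun: "mero2 (F_fun \<sigma> z t)"
proof -
  define w where "w = of_int \<sigma> * (z / (2 * of_real pi * \<i> * t))"
  define \<eta> where "\<eta> = (\<lambda>p. (1 + fst p) * (1 / 2) - of_int \<sigma> * snd p :: complex)"
  define B where "B = (\<lambda>p. (w + \<eta> p) * (w + \<eta> p) * inverse (fst p) - (1 + inverse (fst p)) * (w + \<eta> p) + 1 / 6 * (fst p + inverse (fst p)) + 1 / 2)"
  have \<eta>: "holo2_on \<eta> U" for U unfolding \<eta>_def by (intro holo2_intros)
  have inv: "holo2_on (\<lambda>p. inverse (fst p)) HC"
    by (intro holo2_on_inverse holo2_intros) (auto simp: HC_def)
  have we: "holo2_on (\<lambda>p. w + \<eta> p) HC" by (intro holo2_intros \<eta>)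
  have "holo2_on (\<lambda>p. rGamma2 (fst (fst p, w + \<eta> p)) (snd (fst p, w + \<eta> p))) HC"
    by (rule holo2_on_compose2[OF holo2_rGamma2 holo2_on_fst we]) (auto simp: HC_def)
  hence "mero2 (\<lambda>p. inverse (rGamma2 (fst p) (w + \<eta> p)))" by (intro mero2_inverse holo2_imp_mero2) simp
  moreover have "holo2_on (\<lambda>p. exp (1 / 2 * B p * Ln w) *
      exp (- (3 * w\<^sup>2 * (1 / 4) * inverse (fst p)) - \<eta> p * w * inverse (fst p) + w * (1 + fst p) * (1 / 2) * inverse (fst p))) HC"
    unfolding B_def by (intro holo2_on_exp holo2_intros \<eta> inv)
  hence "mero2 (\<lambda>p. exp (1 / 2 * B p * Ln w) *
      exp (- (3 * w\<^sup>2 * (1 / 4) * inverse (fst p)) - \<eta> p * w * inverse (fst p) + w * (1 + fst p) * (1 / 2) * inverse (fst p)))"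
    by (rule holo2_imp_mero2)
  ultimately have "mero2 (\<lambda>p. inverse (rGamma2 (fst p) (w + \<eta> p)) * (exp (1 / 2 * B p * Ln w) *
      exp (- (3 * w\<^sup>2 * (1 / 4) * inverse (fst p)) - \<eta> p * w * inverse (fst p) + w * (1 + fst p) * (1 / 2) * inverse (fst p))))"
    by (rule mero2_mult)
  thus ?thesis
  proof (rule mero2_cong[rotated])
    fix q assume "q \<in> HC"
    then obtain \<tau> \<theta> where q: "q = (\<tau>, \<theta>)" "Im \<tau> > 0" by (auto simp: HC_def)
    have t0: "\<tau> \<noteq> 0" using q(2) by auto
    have B: "B q = B22 (w + \<eta> q) 1 \<tau>"
      using t0 by (simp add: B_def B22_def q(1) field_simps power2_eq_square)
    have E: "- (3 * w\<^sup>2 / (4 * 1 * \<tau>)) - \<eta> q * w / (1 * \<tau>) + w * (1 + \<tau>) / (2 * 1 * \<tau>) =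
        - (3 * w\<^sup>2 * (1 / 4) * inverse \<tau>) - \<eta> q * w * inverse \<tau> + w * (1 + \<tau>) * (1 / 2) * inverse \<tau>"
      using t0 by (simp add: field_simps)
    have "F_fun \<sigma> z t q = F2 w (\<eta> q) 1 \<tau>"
      by (simp add: F_fun_def q(1) w_def \<eta>_def)
    also have "\<dots> = inverse (rGamma2 \<tau> (w + \<eta> q)) * exp (1 / 2 * B22 (w + \<eta> q) 1 \<tau> * Ln w) *
      exp (- (3 * w\<^sup>2 / (4 * 1 * \<tau>)) - \<eta> q * w / (1 * \<tau>) + w * (1 + \<tau>) / (2 * 1 * \<tau>))"
      unfolding F2_def Gamma2_eq[OF q(2)] ..
    finally show "F_fun \<sigma> z t q = inverse (rGamma2 (fst q) (w + \<eta> q)) * (exp (1 / 2 * B q * Ln w) *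
      exp (- (3 * w\<^sup>2 * (1 / 4) * inverse (fst q)) - \<eta> q * w * inverse (fst q) + w * (1 + fst q) * (1 / 2) * inverse (fst q)))"
      unfolding B E by (simp add: q(1) mult.assoc)
  qed
qed

text \<open>Each factor matches one of \<open>Lambda1\<close>: \<open>Gamma2\<close> gives Gamma
  over sqrt (2 pi), the relation B(x) - B(x + tau) = 1 - 2 x gives the power of w, and the last
  exponential gives exp w.\<close>

lemma F2_shift:
  assumes w: "w \<noteq> 0" and \<tau>: "Im \<tau> > 0"
  shows "F2 w \<eta> 1 \<tau> = Lambda1 w \<eta> * F2 w (\<eta> + \<tau>) 1 \<tau>"
proof -
  have t0: "\<tau> \<noteq> 0" using \<tau> by auto
  define x where "x = w + \<eta>"
  define E where "E = (\<lambda>\<eta>. - (3 * w\<^sup>2 / (4 * 1 * \<tau>)) - \<eta> * w / (1 * \<tau>) + w * (1 + \<tau>) / (2 * 1 * \<tau>))"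
  have G: "Gamma2 x 1 \<tau> = Gamma x * (2 * of_real pi) powr (- 1 / 2) * Gamma2 (x + \<tau>) 1 \<tau>"
  proof -
    have "(2 * of_real pi :: complex) powr (- 1 / 2) = of_real (2 * pi) powr of_real (- 1 / 2)" by simp
    also have "\<dots> = of_real ((2 * pi) powr (- 1 / 2))" by (rule powr_of_real) simp
    also have "(2 * pi) powr (- 1 / 2) = inverse (sqrt (2 * pi))"
      by (simp add: powr_minus powr_half_sqrt flip: minus_divide_left)
    finally have "(2 * of_real pi :: complex) powr (- 1 / 2) = inverse (of_real (sqrt (2 * pi)))"
      by (simp only: of_real_inverse)
    thus ?thesis
      unfolding Gamma2_eq[OF \<tau>] rGamma2_shift[OF \<tau>, of x] by (simp only: inverse_mult_distrib rGamma_inverse_Gamma inverse_inverse_eq mult_ac)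
  qed
  have B: "1 / 2 * B22 x 1 \<tau> * Ln w = (1 / 2 - \<eta> - w) * Ln w + 1 / 2 * B22 (x + \<tau>) 1 \<tau> * Ln w"
  proof -
    have "B22 x 1 \<tau> - B22 (x + \<tau>) 1 \<tau> = 1 - 2 * x"
      using t0 by (simp add: B22_def field_simps power2_eq_square)
    hence "1 / 2 * B22 x 1 \<tau> = (1 / 2 - \<eta> - w) + 1 / 2 * B22 (x + \<tau>) 1 \<tau>" by (simp add: x_def field_simps)
    thus ?thesis by (simp only: distrib_right)
  qed
  have E: "E \<eta> = w + E (\<eta> + \<tau>)" using t0 by (simp add: E_def field_simps)
  have "F2 w \<eta> 1 \<tau> = Gamma2 x 1 \<tau> * exp (1 / 2 * B22 x 1 \<tau> * Ln w) * exp (E \<eta>)"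
    by (simp only: F2_def x_def E_def)
  also have "\<dots> = Lambda1 w \<eta> * (Gamma2 (x + \<tau>) 1 \<tau> * exp (1 / 2 * B22 (x + \<tau>) 1 \<tau> * Ln w) * exp (E (\<eta> + \<tau>)))"
    unfolding G B E exp_add unfolding Lambda1_def x_def using w by (simp add: powr_def mult_ac)
  also have "\<dots> = Lambda1 w \<eta> * F2 w (\<eta> + \<tau>) 1 \<tau>"
    by (simp only: F2_def x_def E_def add.assoc)
  finally show ?thesis .
qed

section \<open>Passage to classes in the field of meromorphic functions\<close>

lemma abs_mero_eqI: "mero2 f \<Longrightarrow> mero2 g \<Longrightarrow> mero2_eq f g \<Longrightarrow> abs_mero f = abs_mero g"
  using Quotient_rel_abs[OF Quotient_mero] by blast

lemma abs_mero_eq_0_iff: "mero2 f \<Longrightarrow> abs_mero f = 0 \<longleftrightarrow> mero2_eq f (\<lambda>_. 0)"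
  using Quotient_rel[OF Quotient_mero, of f "\<lambda>_. 0"] mero2_const[of 0] mero2_eq_refl
  by (auto simp: zero_mero_def)

lemma abs_mero_mult: "mero2 f \<Longrightarrow> mero2 g \<Longrightarrow> abs_mero f * abs_mero g = abs_mero (\<lambda>q. f q * g q)"
  by (rule times_mero.abs_eq) (auto simp: mero2_eq_refl)

lemma abs_mero_shift: "mero2 f \<Longrightarrow> mero_shift n (abs_mero f) = abs_mero (\<lambda>(\<tau>, \<theta>). f (\<tau>, \<theta> + of_int n * \<tau>))"
  by (rule mero_shift.abs_eq) (auto simp: mero2_eq_refl)

text \<open>Where the argument of Gamma_2 has positive imaginary part, \<open>F2\<close> is a
  product of exponentials; this region is open and contains a point of \<open>HC\<close>, so it
  meets every dense set.\<close>

lemma F_fun_nonzero: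
  assumes "\<sigma> \<in> {1, -1}"
  shows "abs_mero (F_fun \<sigma> z t) \<noteq> 0"
proof
  assume "abs_mero (F_fun \<sigma> z t) = 0"
  hence "mero2_eq (F_fun \<sigma> z t) (\<lambda>_. 0)" by (simp add: abs_mero_eq_0_iff mero2_F_fun)
  then obtain D where D: "HC \<subseteq> closure D" "D \<subseteq> HC" "\<And>q. q \<in> D \<Longrightarrow> F_fun \<sigma> z t q = 0"
    unfolding mero2_eq_def by blast
  define w where "w = of_int \<sigma> * (z / (2 * of_real pi * \<i> * t))"
  define V where "V = {p. Im (w + ((1 + fst p) / 2 - of_int \<sigma> * snd p)) > 0}"
  \<comment> \<open>At tau = i this theta adds |Im w| + 1 to the imaginary part of the argument,
    because sigma^2 = 1.\<close>
  define p where "p = (\<i>, - (of_int \<sigma> * \<i> * of_real (\<bar>Im w\<bar> + 1)))"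
  have "open V" unfolding V_def by (intro open_Collect_less continuous_intros) auto
  moreover have "p \<in> V" using assms by (auto simp: V_def p_def)
  moreover have "p \<in> closure D" using D(1) by (auto simp: HC_def p_def)
  ultimately obtain q where q: "q \<in> D" "q \<in> V" using closure_meets_open by blast
  obtain \<tau> \<theta> where qq: "q = (\<tau>, \<theta>)" by (cases q)
  have I: "Im \<tau> > 0" "Im (w + ((1 + \<tau>) / 2 - of_int \<sigma> * \<theta>)) > 0"
    using q D(2) by (auto simp: qq HC_def V_def)
  have "F_fun \<sigma> z t q = F2 w ((1 + \<tau>) / 2 - of_int \<sigma> * \<theta>) 1 \<tau>"
    by (simp add: F_fun_def qq w_def)
  hence "F_fun \<sigma> z t q \<noteq> 0"
    using I by (simp add: F2_def Gamma2_eq rGamma2_upper)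
  thus False using D(3) q(1) by blast
qed

text \<open>Moving theta by tau lowers eta by tau for sigma = 1 and raises it for sigma = -1, so
  \<open>F2_shift\<close> is read in opposite directions; hence the exponent sigma.\<close>

lemma mero_shift_F_fun:
  assumes "z \<noteq> 0" "t \<noteq> 0" and \<sigma>: "\<sigma> \<in> {1, -1}"
  shows "mero_shift 1 (abs_mero (F_fun \<sigma> z t)) = abs_mero (Lambda_fun \<sigma> z t) powi \<sigma> * abs_mero (F_fun \<sigma> z t)"
proof -
  let ?F = "F_fun \<sigma> z t" and ?L = "Lambda_fun \<sigma> z t"
  let ?S = "\<lambda>(\<tau>, \<theta>). ?F (\<tau>, \<theta> + of_int 1 * \<tau>)"
  define w where "w = of_int \<sigma> * (z / (2 * of_real pi * \<i> * t))"
  have w: "w \<noteq> 0" using assms by (auto simp: w_def)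
  have mF: "mero2 ?F" by (rule mero2_F_fun)
  have mL: "mero2 ?L" by (rule mero2_Lambda_fun) (use assms in auto)
  have mS: "mero2 ?S" by (rule mero2_shift[OF mF])
  have F: "?F (\<tau>, \<theta>) = F2 w ((1 + \<tau>) / 2 - of_int \<sigma> * \<theta>) 1 \<tau>" for \<tau> \<theta>
    by (simp add: F_fun_def w_def)
  have L: "?L (\<tau>, \<theta>) = Lambda1 w (1 / 2 - of_int \<sigma> * (\<theta> + \<tau> / 2))" for \<tau> \<theta>
    by (simp add: Lambda_fun_def w_def)
  show ?thesis
  proof (cases "\<sigma> = 1")
    case True
    have "?S q = ?L q * ?F q" if q0: "q \<in> HC" for q
    proof -
      obtain \<tau> \<theta> where q: "q = (\<tau>, \<theta>)" "Im \<tau> > 0" using q0 by (auto simp: HC_def)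
      have "(1 + \<tau>) / 2 - of_int \<sigma> * (\<theta> + of_int 1 * \<tau>) = 1 / 2 - of_int \<sigma> * (\<theta> + \<tau> / 2)"
        "(1 + \<tau>) / 2 - of_int \<sigma> * \<theta> = 1 / 2 - of_int \<sigma> * (\<theta> + \<tau> / 2) + \<tau>"
        using True by (simp_all add: field_simps)
      thus ?thesis unfolding q(1) prod.case F L by (simp only: F2_shift[OF w q(2), of "1 / 2 - of_int \<sigma> * (\<theta> + \<tau> / 2)"])
    qed
    hence "abs_mero ?S = abs_mero (\<lambda>q. ?L q * ?F q)"
      by (intro abs_mero_eqI mS mero2_mult mL mF mero2_eqI)
    thus ?thesis using True mF mL by (simp add: abs_mero_shift abs_mero_mult)
  next
    case False
    hence s: "\<sigma> = -1" using \<sigma> by auto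
    have "?F q = ?L q * ?S q" if q0: "q \<in> HC" for q
    proof -
      obtain \<tau> \<theta> where q: "q = (\<tau>, \<theta>)" "Im \<tau> > 0" using q0 by (auto simp: HC_def)
      have "(1 + \<tau>) / 2 - of_int \<sigma> * \<theta> = 1 / 2 - of_int \<sigma> * (\<theta> + \<tau> / 2)"
        "(1 + \<tau>) / 2 - of_int \<sigma> * (\<theta> + of_int 1 * \<tau>) = 1 / 2 - of_int \<sigma> * (\<theta> + \<tau> / 2) + \<tau>"
        using s by (simp_all add: field_simps)
      thus ?thesis unfolding q(1) prod.case F L by (simp only: F2_shift[OF w q(2), of "1 / 2 - of_int \<sigma> * (\<theta> + \<tau> / 2)"])
    qed
    hence "abs_mero ?F = abs_mero (\<lambda>q. ?L q * ?S q)"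
      by (intro abs_mero_eqI mS mero2_mult mL mF mero2_eqI)
    hence eq: "abs_mero ?F = abs_mero ?L * mero_shift 1 (abs_mero ?F)"
      unfolding abs_mero_shift[OF mF] abs_mero_mult[OF mL mS] .
    \<comment> \<open>The product on the right equals a nonzero class, so its factor is nonzero and
      can be inverted.\<close>
    hence "abs_mero ?L \<noteq> 0" using F_fun_nonzero[OF \<sigma>, of z t] by auto
    hence "inverse (abs_mero ?L) * abs_mero ?F = mero_shift 1 (abs_mero ?F)"
      by (subst eq) (simp add: mult.assoc[symmetric])
    thus ?thesis by (simp add: s power_int_minus)
  qed
qed

section \<open>Automorphisms of the quantum torus\<close>

lemma qmon_one: "qmon 1 0 = 1"
  by (simp add: qmon_def one_qtorus_def)

lemma qmon_deg0_mult: "qmon f 0 * qmon g n = qmon (f * g) n"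
  by (simp add: qmon_mult mero_shift_simps)

lemma qmon_inverse: "f \<noteq> 0 \<Longrightarrow> qmon f 0 * qmon (inverse f) 0 = 1" "f \<noteq> 0 \<Longrightarrow> qmon (inverse f) 0 * qmon f 0 = 1"
  by (simp_all add: qmon_deg0_mult qmon_one)

lemma qt_inv_unique:
  assumes "g * h = 1" "h * g = 1" shows "qt_inv g = h"
  unfolding qt_inv_def
proof (rule the_equality)
  fix k assume "g * k = 1 \<and> k * g = 1"
  thus "k = h" using assms by (metis mult.assoc mult_1_left mult_1_right)
qed (use assms in auto)

lemma qtorus_induct:
  assumes "\<And>f n. P (qmon f n)" "\<And>a b. P a \<Longrightarrow> P b \<Longrightarrow> P (a + b)"
  shows "P a"
proof -
  have "P (Qtorus p)" for p
  proof (induction p rule: poly_mapping_add_induct)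
    case (1 n f)
    thus ?case using assms(1) by (simp add: qmon_def)
  next
    case (2 a b)
    thus ?case using assms(2)[of "Qtorus a" "Qtorus b"] by (simp add: plus_qtorus.abs_eq)
  qed
  thus ?thesis by (metis qt_coeffs_inverse)
qed

text \<open>Degree 0 and y_1 determine everything: the value at y_{-1} is forced as the inverse of
  the value at y_1, and every element is a sum of products f y_n.\<close>

lemma qt_Aut_eqI:
  assumes \<Phi>: "\<Phi> \<in> qt_Aut" and \<Psi>: "\<Psi> \<in> qt_Aut"
    and deg0: "\<And>a. a \<in> qt_deg0 \<Longrightarrow> \<Phi> a = \<Psi> a" and y: "\<Phi> (qt_y 1) = \<Psi> (qt_y 1)"
  shows "\<Phi> = \<Psi>"
proof
  fix a
  have hom: "\<Phi> 1 = 1" "\<Psi> 1 = 1" "\<And>a b. \<Phi> (a + b) = \<Phi> a + \<Phi> b" "\<And>a b. \<Psi> (a + b) = \<Psi> a + \<Psi> b"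
    "\<And>a b. \<Phi> (a * b) = \<Phi> a * \<Phi> b" "\<And>a b. \<Psi> (a * b) = \<Psi> a * \<Psi> b"
    using \<Phi> \<Psi> by (auto simp: qt_Aut_def)
  have ym: "qt_y m * qt_y n = qt_y (m + n)" for m n
    by (simp add: qt_y_def qmon_mult mero_shift_simps)
  have y0: "qt_y 0 = 1" by (simp add: qt_y_def qmon_one)
  have neg: "\<Phi> (qt_y (- 1)) = \<Psi> (qt_y (- 1))"
  proof -
    have "\<Phi> (qt_y (- 1)) = \<Phi> (qt_y (- 1)) * (\<Psi> (qt_y 1) * \<Psi> (qt_y (- 1)))"
      by (simp add: ym y0 hom flip: hom(6))
    also have "\<dots> = \<Phi> (qt_y (- 1)) * \<Phi> (qt_y 1) * \<Psi> (qt_y (- 1))" by (simp add: y mult.assoc)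
    also have "\<dots> = \<Psi> (qt_y (- 1))" by (simp add: ym y0 hom flip: hom(5))
    finally show ?thesis .
  qed
  have yn: "\<Phi> (qt_y n) = \<Psi> (qt_y n)" for n
  proof (induction n rule: int_induct[where k = 0])
    case base
    show ?case by (simp add: y0 hom)
  next
    case (step1 n)
    thus ?case by (simp add: hom y flip: ym)
  next
    case (step2 n)
    have "qt_y (n - 1) = qt_y n * qt_y (- 1)" by (simp add: ym)
    thus ?case using step2 by (simp add: hom neg)
  qed
  show "\<Phi> a = \<Psi> a"
  proof (induction a rule: qtorus_induct)
    case (1 f n)
    have "qmon f n = qmon f 0 * qt_y n" by (simp add: qt_y_def qmon_deg0_mult)
    thus ?case using deg0[of "qmon f 0"] yn by (simp add: hom qt_deg0_def)
  qed (simp add: hom)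
qed

text \<open>With g = 1 / f in degree 0, moving f past y_1 shifts it, so conjugation multiplies y_1
  by the shift of f over f. Degree 0 is commutative and hence fixed.\<close>

lemma is_Psi_Ad_psi:
  assumes "z \<noteq> 0" "t \<noteq> 0" "\<sigma> \<in> {1, -1}"
  shows "is_Psi \<sigma> z t (Ad (psi \<sigma> z t))"
proof -
  define f where "f = abs_mero (F_fun \<sigma> z t)"
  define g h where "g = psi \<sigma> z t" and "h = qmon f 0"
  have f: "f \<noteq> 0" unfolding f_def using assms(3) by (rule F_fun_nonzero)
  have g: "g = qmon (inverse f) 0" by (simp add: g_def psi_def f_def)
  have gh: "g * h = 1" "h * g = 1" using f by (simp_all add: g h_def qmon_inverse)
  have Ad: "Ad g a = g * a * h" for a by (simp add: Ad_def qt_inv_unique[OF gh])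
  have deg0: "Ad g (qmon k 0) = qmon k 0" for k
  proof -
    have "inverse f * k * f = k" using f by (simp add: field_simps)
    thus ?thesis unfolding Ad by (simp only: g h_def qmon_deg0_mult)
  qed
  have "bij (Ad g)"
  proof (rule o_bij)
    have "h * (g * a * h) * g = (h * g) * a * (h * g)" "g * (h * a * g) * h = (g * h) * a * (g * h)" for a
      by (simp_all only: mult.assoc)
    thus "(\<lambda>a. h * a * g) \<circ> Ad g = id" "Ad g \<circ> (\<lambda>a. h * a * g) = id"
      by (simp_all add: fun_eq_iff Ad gh)
  qed
  moreover have mult: "Ad g (a * b) = Ad g a * Ad g b" for a b
  proof -
    have "Ad g a * Ad g b = g * a * (h * g) * b * h" by (simp add: Ad mult.assoc)
    thus ?thesis by (simp add: Ad gh mult.assoc)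
  qed
  moreover have "Ad g (qmon (mero_const c) 0 * a) = qmon (mero_const c) 0 * Ad g a" for c a
    by (simp add: mult deg0)
  ultimately have "Ad g \<in> qt_Aut"
    by (auto simp: qt_Aut_def Ad gh algebra_simps)
  moreover have "Ad g (qt_y 1) = qmon (abs_mero (Lambda_fun \<sigma> z t) powi \<sigma>) 0 * qt_y 1"
  proof -
    have "Ad g (qt_y 1) = qmon (inverse f * mero_shift 1 f) 1"
      unfolding Ad by (simp add: g h_def qt_y_def qmon_mult mero_shift_simps)
    also have "inverse f * mero_shift 1 f = abs_mero (Lambda_fun \<sigma> z t) powi \<sigma>"
      using mero_shift_F_fun[OF assms] f by (simp flip: f_def)
    finally show ?thesis by (simp add: qt_y_def qmon_deg0_mult)
  qed
  ultimately show ?thesis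
    using deg0 by (auto simp: is_Psi_def qt_deg0_def simp flip: g_def)
qed

theorem theorem3p2:
  fixes z t :: complex and \<sigma> :: int
  assumes "z \<noteq> 0" and "\<sigma> \<in> {1, -1}"
    and "t \<noteq> 0" and "t \<notin> (\<lambda>u. \<i> * u) ` ray \<sigma> z"
  shows "mero2 (Lambda_fun \<sigma> z t) \<and> mero2 (F_fun \<sigma> z t) \<and>
    (\<exists>!\<Phi>. is_Psi \<sigma> z t \<Phi>) \<and> qt_invertible (psi \<sigma> z t) \<and>
    Psi \<sigma> z t = Ad (psi \<sigma> z t)"
proof -
  have Ad: "is_Psi \<sigma> z t (Ad (psi \<sigma> z t))" using assms by (intro is_Psi_Ad_psi)
  \<comment> \<open>Uniqueness makes the definite description in \<open>Psi\<close> denote this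
    conjugation.\<close>
  have uniq: "\<Phi> = Ad (psi \<sigma> z t)" if "is_Psi \<sigma> z t \<Phi>" for \<Phi>
    using that Ad by (intro qt_Aut_eqI) (auto simp: is_Psi_def)
  have "abs_mero (F_fun \<sigma> z t) \<noteq> 0" using assms by (intro F_fun_nonzero)
  hence inv: "qt_invertible (psi \<sigma> z t)"
    unfolding qt_invertible_def psi_def using qmon_inverse by blast
  have "Psi \<sigma> z t = Ad (psi \<sigma> z t)"
    unfolding Psi_def using Ad uniq by (rule the_equality)
  moreover have "mero2 (Lambda_fun \<sigma> z t)" using assms by (intro mero2_Lambda_fun) auto
  moreover have "\<exists>!\<Phi>. is_Psi \<sigma> z t \<Phi>" using Ad uniq by (rule ex1I)
  ultimately show ?thesis using mero2_F_fun inv by (intro conjI)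
qed

end
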